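(* Let $L/K$ be a finite-dimensional normal field extension with Galois group $G$ (the group of automorphisms of $L$ over $K$), where the field $L$ is finite. Let $S=G(\star)$ be a modification of $G$, let $U$ be the group of invertible elements of $S$, let $P=\{\ell\in L: u(\ell)=\ell \text{ for all } u\in U\}$ be the subfield of $U$-fixed elements, and let $S/U$ be the quotient semigroup of $S$ by the congruence whose classes are $\{0\}$ and the cosets of $U$. Regard $L^{\times}$ and $P^{\times}$ as 0-modules over $S$ and $S/U$ respectively via the Galois action. Then $$H_0^2(S,L^{\times})\cong H^2_0(S/U, P^{\times}).$$
   Context: **0-modules.** Let $S$ be a semigroup with zero $0$. An abelian group $A$ (written additively) is a 0-module over $S$ if there is an action $(S\setminus 0)\times A\to A$ such that $s(a+b)=sa+sb$ for all $s\in S\setminus 0$, $a,b\in A$, and $s(ta)=(st)a$ whenever $s,t\in S\setminus 0$ and $st\neq 0$. **0-cohomology.** An $n$-dimensional 0-cochain is a function to $A$ defined on exactly those $n$-tuples $(s_1,\dots,s_n)$ of elements of $S$ with $s_1\cdots s_n\ne 0$; these form a group $C^n_0(S,A)$ under pointwise addition. The coboundary operator $\partial^n: C^n_0(S,A)\to C^{n+1}_0(S,A)$ is $$\partial^nf(s_1,\dots,s_{n+1})=s_1f(s_2,\dots,s_{n+1})+\sum_{i=1}^n(-1)^if(s_1,\dots,s_is_{i+1},\dots,s_{n+1})+(-1)^{n+1}f(s_1,\dots,s_n)$$ for $s_1\cdots s_{n+1}\neq 0$. One has $\partial^{n+1}\partial^{n}=0$. The 0-cocycles are $Z^n_0(S,A)=\ker\partial^n$,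 and $H^n_0(S,A)=Z^n_0(S,A)/\operatorname{im}\partial^{n-1}$ is the $n$-th 0-cohomology group. **Modifications.** A modification $G(\star)$ of a group $G$ is a semigroup on the set $G\cup\{0\}$ (with $0\notin G$) whose associative operation $\star$ satisfies: for all $x,y\in G$, $x\star y$ equals either $xy$ (the product in $G$) or $0$; $0\star x=x\star 0=0\star 0=0$; and the identity element of $G$ is also the identity element of $G(\star)$. The group $U$ of invertible elements of $G(\star)$ is a subgroup of $G$. **Module structures.** $L^{\times}$ (the multiplicative group of $L$, with its group operation playing the role of addition above) is a 0-module over $S=G(\star)$, with elements of $S\setminus 0=G$ acting as automorphisms of $L$. When $U$ is normal in $S$, meaning $x\star U=U\star x$ for all $x\in S$ (which holds automatically when $G$ is abelian, as is the case for finite $L$), the cosets $x\star U=U\star x$ ($x\in S\setminus 0$) together with $\{0\}$ are the classes of a congruence on $S$, giving the quotient semigroup with zero $S/U$. The group $P^{\times}$ is a 0-module over $S/U$, where the class of $x\in S\setminus 0$ acts on $P^\times$ as $x$ does. *)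

theory Defs
  imports "HOL-Algebra.Algebra"
begin

section \<open>Semigroups with zero and 0-modules\<close>

text \<open>
  The record also carries the field \<open>one\<close> of \<^typ>\<open>'a monoid\<close>, so that the library's
  \<^const>\<open>Units\<close> and cosets apply to modifications.  The locale \<open>semigroup_zero\<close> does not
  constrain it: a semigroup with zero need not have an identity.
\<close>

record 'a monoid_zero = "'a monoid" +
  szero :: 'a  (\<open>\<zero>\<^sub>0\<index>\<close>)

locale semigroup_zero =
  fixes S :: "('s, 'm) monoid_zero_scheme" (structure)
  assumes sg_closed: "\<lbrakk>x \<in> carrier S; y \<in> carrier S\<rbrakk> \<Longrightarrow> x \<otimes> y \<in> carrier S"
    and sg_assoc: "\<lbrakk>x \<in> carrier S; y \<in> carrier S; z \<in> carrier S\<rbrakk> \<Longrightarrow> (x \<otimes> y) \<otimes> z = x \<otimes> (y \<otimes> z)"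
    and szero_closed: "\<zero>\<^sub>0 \<in> carrier S"
    and szero_left: "x \<in> carrier S \<Longrightarrow> \<zero>\<^sub>0 \<otimes> x = \<zero>\<^sub>0"
    and szero_right: "x \<in> carrier S \<Longrightarrow> x \<otimes> \<zero>\<^sub>0 = \<zero>\<^sub>0"

text \<open>Abelian groups of coefficients are written multiplicatively throughout.\<close>

locale zero_module = S?: semigroup_zero S + A?: comm_group A
  for S :: "('s, 'm) monoid_zero_scheme" (structure)
    and A :: "('a, 'n) monoid_scheme" (structure) +
  fixes act :: "'s \<Rightarrow> 'a \<Rightarrow> 'a"
  assumes act_closed: "\<lbrakk>s \<in> carrier S - {\<zero>\<^sub>0\<^bsub>S\<^esub>}; a \<in> carrier A\<rbrakk> \<Longrightarrow> act s a \<in> carrier A"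
    and act_mult: "\<lbrakk>s \<in> carrier S - {\<zero>\<^sub>0\<^bsub>S\<^esub>}; a \<in> carrier A; b \<in> carrier A\<rbrakk>
      \<Longrightarrow> act s (a \<otimes>\<^bsub>A\<^esub> b) = act s a \<otimes>\<^bsub>A\<^esub> act s b"
    and act_act: "\<lbrakk>s \<in> carrier S - {\<zero>\<^sub>0\<^bsub>S\<^esub>}; t \<in> carrier S - {\<zero>\<^sub>0\<^bsub>S\<^esub>}; s \<otimes>\<^bsub>S\<^esub> t \<noteq> \<zero>\<^sub>0\<^bsub>S\<^esub>;
      a \<in> carrier A\<rbrakk> \<Longrightarrow> act s (act t a) = act (s \<otimes>\<^bsub>S\<^esub> t) a"


section \<open>0-cohomology\<close>

text \<open>Tuples are lists; for \<open>n = 0\<close> the empty tuple is admitted, so that 0-dimensional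
  cochains amount to elements of the coefficient group.\<close>

definition nonzero_tuples :: "('s, 'm) monoid_zero_scheme \<Rightarrow> nat \<Rightarrow> 's list set" where
  "nonzero_tuples S n = {xs. length xs = n \<and> set xs \<subseteq> carrier S \<and>
     (xs \<noteq> [] \<longrightarrow> foldl (monoid.mult S) (hd xs) (tl xs) \<noteq> \<zero>\<^sub>0\<^bsub>S\<^esub>)}"

text \<open>Functions on \<open>nonzero_tuples S n\<close> are modelled as extensional functions.\<close>

definition cochains ::
  "('s, 'm) monoid_zero_scheme \<Rightarrow> ('a, 'n) monoid_scheme \<Rightarrow> nat \<Rightarrow> ('s list \<Rightarrow> 'a) monoid" where
  "cochains S A n = product_group (nonzero_tuples S n) (\<lambda>_. A)"

text \<open>\<open>contract S i (s\<^sub>1, \<dots>, s\<^sub>m) = (s\<^sub>1, \<dots>, s\<^sub>i s\<^sub>i\<^sub>+\<^sub>1, \<dots>, s\<^sub>m)\<close>,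
  with \<open>i\<close> counted from 1 and list positions from 0.\<close>

definition contract :: "('s, 'm) monoid_zero_scheme \<Rightarrow> nat \<Rightarrow> 's list \<Rightarrow> 's list" where
  "contract S i xs = take (i - 1) xs @ [xs ! (i - 1) \<otimes>\<^bsub>S\<^esub> xs ! i] @ drop (i + 1) xs"

definition coboundary ::
  "('s, 'm) monoid_zero_scheme \<Rightarrow> ('a, 'n) monoid_scheme \<Rightarrow> ('s \<Rightarrow> 'a \<Rightarrow> 'a) \<Rightarrow> nat
     \<Rightarrow> ('s list \<Rightarrow> 'a) \<Rightarrow> ('s list \<Rightarrow> 'a)" where
  "coboundary S A act n f = (\<lambda>xs \<in> nonzero_tuples S (n + 1).
     act (hd xs) (f (tl xs))
     \<otimes>\<^bsub>A\<^esub> (\<Otimes>\<^bsub>A\<^esub>i\<in>{1..n}. f (contract S i xs) [^]\<^bsub>A\<^esub> ((-1) ^ i :: int))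
     \<otimes>\<^bsub>A\<^esub> f (butlast xs) [^]\<^bsub>A\<^esub> ((-1) ^ (n + 1) :: int))"

definition cocycles ::
  "('s, 'm) monoid_zero_scheme \<Rightarrow> ('a, 'n) monoid_scheme \<Rightarrow> ('s \<Rightarrow> 'a \<Rightarrow> 'a) \<Rightarrow> nat
     \<Rightarrow> ('s list \<Rightarrow> 'a) set" where
  "cocycles S A act n = kernel (cochains S A n) (cochains S A (n + 1)) (coboundary S A act n)"

definition coboundaries ::
  "('s, 'm) monoid_zero_scheme \<Rightarrow> ('a, 'n) monoid_scheme \<Rightarrow> ('s \<Rightarrow> 'a \<Rightarrow> 'a) \<Rightarrow> nat
     \<Rightarrow> ('s list \<Rightarrow> 'a) set" where
  "coboundaries S A act n =
     (if n = 0 then {\<one>\<^bsub>cochains S A 0\<^esub>}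
      else coboundary S A act (n - 1) ` carrier (cochains S A (n - 1)))"

definition zero_cohomology ::
  "nat \<Rightarrow> ('s, 'm) monoid_zero_scheme \<Rightarrow> ('a, 'n) monoid_scheme \<Rightarrow> ('s \<Rightarrow> 'a \<Rightarrow> 'a)
     \<Rightarrow> ('s list \<Rightarrow> 'a) set monoid" where
  "zero_cohomology n S A act =
     (cochains S A n \<lparr>carrier := cocycles S A act n\<rparr>) Mod coboundaries S A act n"


section \<open>Modifications of a group\<close>

text \<open>The zero adjoined to \<open>G\<close> may be any object of the element type outside \<open>G\<close>.\<close>

locale modification = G?: group G + S?: semigroup_zero S
  for G :: "('g, 'n) monoid_scheme" (structure)
    and S :: "('g, 'm) monoid_zero_scheme" (structure) +
  assumes szero_notin: "\<zero>\<^sub>0\<^bsub>S\<^esub> \<notin> carrier G"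
    and carrier_modification: "carrier S = insert \<zero>\<^sub>0\<^bsub>S\<^esub> (carrier G)"
    and mult_modification: "\<lbrakk>x \<in> carrier G; y \<in> carrier G\<rbrakk>
      \<Longrightarrow> x \<otimes>\<^bsub>S\<^esub> y = x \<otimes>\<^bsub>G\<^esub> y \<or> x \<otimes>\<^bsub>S\<^esub> y = \<zero>\<^sub>0\<^bsub>S\<^esub>"
    and one_modification: "\<one>\<^bsub>S\<^esub> = \<one>\<^bsub>G\<^esub>"
    and one_left: "x \<in> carrier S \<Longrightarrow> \<one>\<^bsub>S\<^esub> \<otimes>\<^bsub>S\<^esub> x = x"
    and one_right: "x \<in> carrier S \<Longrightarrow> x \<otimes>\<^bsub>S\<^esub> \<one>\<^bsub>S\<^esub> = x"

definition unit_cong :: "('s, 'm) monoid_zero_scheme \<Rightarrow> ('s \<times> 's) set" where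
  "unit_cong S = {(x, y). x \<in> carrier S \<and> y \<in> carrier S \<and>
     (x = \<zero>\<^sub>0\<^bsub>S\<^esub> \<and> y = \<zero>\<^sub>0\<^bsub>S\<^esub> \<or>
      x \<noteq> \<zero>\<^sub>0\<^bsub>S\<^esub> \<and> y \<noteq> \<zero>\<^sub>0\<^bsub>S\<^esub> \<and> x <#\<^bsub>S\<^esub> Units S = y <#\<^bsub>S\<^esub> Units S)}"

text \<open>For a congruence \<open>r\<close> the union below is the single class of \<open>x y\<close>.\<close>

definition quotient_semigroup ::
  "('s, 'm) monoid_zero_scheme \<Rightarrow> ('s \<times> 's) set \<Rightarrow> 's set monoid_zero" where
  "quotient_semigroup S r =
     \<lparr>carrier = carrier S // r,
      monoid.mult = \<lambda>C D. \<Union>x\<in>C. \<Union>y\<in>D. r `` {x \<otimes>\<^bsub>S\<^esub> y},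
      one = r `` {\<one>\<^bsub>S\<^esub>},
      szero = r `` {\<zero>\<^sub>0\<^bsub>S\<^esub>}\<rparr>"

definition quotient_by_units :: "('s, 'm) monoid_zero_scheme \<Rightarrow> 's set monoid_zero" where
  "quotient_by_units S = quotient_semigroup S (unit_cong S)"


section \<open>Field extensions\<close>

definition normal_extension :: "('a, 'm) ring_scheme \<Rightarrow> 'a set \<Rightarrow> bool" where
  "normal_extension L K \<longleftrightarrow>
     (\<forall>x \<in> carrier L. (ring.algebraic L over K) x) \<and>
     (\<forall>p \<in> carrier (univ_poly L K). pirreducible\<^bsub>L\<^esub> K p \<longrightarrow>
        (\<exists>x. ring.is_root L p x) \<longrightarrow> ring.splitted L p)"

definition galois_group :: "('a, 'm) ring_scheme \<Rightarrow> 'a set \<Rightarrow> ('a \<Rightarrow> 'a) monoid" where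
  "galois_group L K = BijGroup (carrier L)
     \<lparr>carrier := {\<sigma> \<in> Bij (carrier L) \<inter> ring_hom L L. \<forall>k \<in> K. \<sigma> k = k}\<rparr>"

definition fixed_elements :: "('a, 'm) ring_scheme \<Rightarrow> ('a \<Rightarrow> 'a) set \<Rightarrow> 'a set" where
  "fixed_elements L U = {l \<in> carrier L. \<forall>u \<in> U. u l = l}"

text \<open>The action of a class of automorphisms is the common value of its members.\<close>

definition class_action :: "('a \<Rightarrow> 'a) set \<Rightarrow> 'a \<Rightarrow> 'a" where
  "class_action C a = the_elem ((\<lambda>x. x a) ` C)"


section \<open>The 0-modules \<open>L\<^sup>\<times>\<close> over \<open>S\<close> and \<open>P\<^sup>\<times>\<close> over \<open>S/U\<close>\<close>

text \<open>The remaining lemmas show that the structures above exist as intended: the automorphisms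
  form a group (commutative for finite \<open>L\<close>), \<open>unit_cong\<close> is a congruence with the stated classes,
  and the two actions are 0-module structures.\<close>

lemma galois_groupD:
  assumes "\<sigma> \<in> carrier (galois_group L K)"
  shows "\<sigma> \<in> Bij (carrier L)" and "\<sigma> \<in> ring_hom L L"
  using assms by (auto simp: galois_group_def)

lemma galois_mult_apply:
  assumes "\<sigma> \<in> carrier (galois_group L K)" "\<tau> \<in> carrier (galois_group L K)" "a \<in> carrier L"
  shows "(\<sigma> \<otimes>\<^bsub>galois_group L K\<^esub> \<tau>) a = \<sigma> (\<tau> a)"
  using assms by (simp add: galois_group_def BijGroup_def compose_def)

lemma ring_hom_commute_finite_field:
  assumes "field L" and "finite (carrier L)"
    and \<sigma>: "\<sigma> \<in> ring_hom L L" and \<tau>: "\<tau> \<in> ring_hom L L" and x: "x \<in> carrier L"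
  shows "\<sigma> (\<tau> x) = \<tau> (\<sigma> x)"
proof -
  interpret field L by fact
  interpret s: ring_hom_cring L L \<sigma> by unfold_locales (rule \<sigma>)
  interpret t: ring_hom_cring L L \<tau> by unfold_locales (rule \<tau>)
  obtain g where g: "g \<in> carrier L - {\<zero>\<^bsub>L\<^esub>}"
    and gen: "carrier L - {\<zero>\<^bsub>L\<^esub>} = {g [^]\<^bsub>L\<^esub> i | i::nat. i \<in> UNIV}"
    using finite_field_mult_group_has_gen[OF assms(2)]
    by (auto simp: Multiplicative_Group.mult_of_simps)
  have nz: "\<phi> g \<noteq> \<zero>\<^bsub>L\<^esub>" if "ring_hom_cring L L \<phi>" for \<phi>
  proof
    interpret p: ring_hom_cring L L \<phi> by fact
    assume "\<phi> g = \<zero>\<^bsub>L\<^esub>"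
    moreover have "g \<otimes>\<^bsub>L\<^esub> inv\<^bsub>L\<^esub> g = \<one>\<^bsub>L\<^esub>" "inv\<^bsub>L\<^esub> g \<in> carrier L"
      using g field_Units by auto
    ultimately have "\<one>\<^bsub>L\<^esub> = \<zero>\<^bsub>L\<^esub>"
      using g by (metis DiffD1 p.hom_closed p.hom_mult p.hom_one l_null)
    then show False by simp
  qed
  have "\<sigma> g \<in> carrier L - {\<zero>\<^bsub>L\<^esub>}" "\<tau> g \<in> carrier L - {\<zero>\<^bsub>L\<^esub>}"
    using g nz s.ring_hom_cring_axioms t.ring_hom_cring_axioms by auto
  then obtain i j :: nat where ij: "\<sigma> g = g [^]\<^bsub>L\<^esub> i" "\<tau> g = g [^]\<^bsub>L\<^esub> j"
    using gen by auto
  have "\<sigma> (\<tau> (g [^]\<^bsub>L\<^esub> k)) = \<tau> (\<sigma> (g [^]\<^bsub>L\<^esub> k))" for k :: nat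
    using g ij by (simp add: nat_pow_pow mult.commute mult.left_commute)
  moreover have "\<exists>k::nat. x = g [^]\<^bsub>L\<^esub> k" if "x \<noteq> \<zero>\<^bsub>L\<^esub>"
    using gen x that by blast
  ultimately show ?thesis
    by (cases "x = \<zero>\<^bsub>L\<^esub>") auto
qed

lemma comm_group_galois_group:
  assumes "field L" and "finite (carrier L)" and "group (galois_group L K)"
  shows "comm_group (galois_group L K)"
proof -
  interpret field L by fact
  interpret G: group "galois_group L K" by fact
  show ?thesis
  proof (rule G.group_comm_groupI)
    fix \<sigma> \<tau> assume st: "\<sigma> \<in> carrier (galois_group L K)" "\<tau> \<in> carrier (galois_group L K)"
    have "\<sigma> \<otimes>\<^bsub>galois_group L K\<^esub> \<tau> \<in> extensional (carrier L)"
      "\<tau> \<otimes>\<^bsub>galois_group L K\<^esub> \<sigma> \<in> extensional (carrier L)"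
      using st galois_groupD(1)[THEN Bij_imp_extensional] G.m_closed by blast+
    then show "\<sigma> \<otimes>\<^bsub>galois_group L K\<^esub> \<tau> = \<tau> \<otimes>\<^bsub>galois_group L K\<^esub> \<sigma>"
      using st ring_hom_commute_finite_field[OF assms(1,2) st[THEN galois_groupD(2)]]
      by (intro extensionalityI[of _ "carrier L"]) (auto simp: galois_mult_apply)
  qed
qed

lemma group_galois_group:
  assumes "field L" and K: "K \<subseteq> carrier L"
  shows "group (galois_group L K)"
proof -
  interpret field L by fact
  interpret B: group "BijGroup (carrier L)" by (rule group_BijGroup)
  have "subgroup (carrier (galois_group L K)) (BijGroup (carrier L))"
  proof (rule B.subgroupI)
    show "carrier (galois_group L K) \<subseteq> carrier (BijGroup (carrier L))"
      by (auto simp: galois_group_def BijGroup_def)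
    have "(\<lambda>x\<in>carrier L. x) \<in> carrier (galois_group L K)"
      using K by (auto simp: galois_group_def id_Bij ring_hom_def)
    then show "carrier (galois_group L K) \<noteq> {}" by blast
  next
    fix s assume s: "s \<in> carrier (galois_group L K)"
    let ?t = "\<lambda>x\<in>carrier L. inv_into (carrier L) s x"
    have b: "bij_betw s (carrier L) (carrier L)" and B: "s \<in> Bij (carrier L)"
      using galois_groupD(1)[OF s] by (auto simp: Bij_def)
    have h: "s \<in> ring_hom L L" using s galois_groupD(2) by blast
    have i: "inv\<^bsub>BijGroup (carrier L)\<^esub> s = ?t" using B by (rule inv_BijGroup)
    have t: "?t y \<in> carrier L" "s (?t y) = y" if "y \<in> carrier L" for y
      using that b by (auto simp: bij_betw_def f_inv_into_f inv_into_into)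
    have inj: "x = y" if "s x = s y" "x \<in> carrier L" "y \<in> carrier L" for x y
      using that b by (auto simp: bij_betw_def inj_on_def)
    have "?t \<in> ring_hom L L"
    proof (rule ring_hom_memI)
      fix x y assume xy: "x \<in> carrier L" "y \<in> carrier L"
      show "?t (x \<otimes>\<^bsub>L\<^esub> y) = ?t x \<otimes>\<^bsub>L\<^esub> ?t y"
        by (rule inj) (use xy t ring_hom_memE(2)[OF h] in \<open>simp_all del: restrict_apply\<close>)
      show "?t (x \<oplus>\<^bsub>L\<^esub> y) = ?t x \<oplus>\<^bsub>L\<^esub> ?t y"
        by (rule inj) (use xy t ring_hom_memE(3)[OF h] in \<open>simp_all del: restrict_apply\<close>)
    next
      show "?t \<one>\<^bsub>L\<^esub> = \<one>\<^bsub>L\<^esub>"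
        by (rule inj) (use t ring_hom_memE(4)[OF h] in \<open>simp_all del: restrict_apply\<close>)
    qed (use t in blast)
    moreover have "?t k = k" if "k \<in> K" for k
      by (rule inj) (use that K s t in \<open>auto simp: galois_group_def simp del: restrict_apply\<close>)
    ultimately show "inv\<^bsub>BijGroup (carrier L)\<^esub> s \<in> carrier (galois_group L K)"
      using B unfolding i by (auto simp: galois_group_def restrict_inv_into_Bij simp del: restrict_apply)
  next
    fix s t assume st: "s \<in> carrier (galois_group L K)" "t \<in> carrier (galois_group L K)"
    have "compose (carrier L) s t \<in> Bij (carrier L)"
      using st galois_groupD(1) compose_Bij by blast
    moreover have "compose (carrier L) s t \<in> ring_hom L L"
      using ring_hom_memE[OF galois_groupD(2)[OF st(1)]] ring_hom_memE[OF galois_groupD(2)[OF st(2)]]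
      by (intro ring_hom_memI) (auto simp: compose_def)
    ultimately show "s \<otimes>\<^bsub>BijGroup (carrier L)\<^esub> t \<in> carrier (galois_group L K)"
      using st K by (auto simp: galois_group_def BijGroup_def compose_def)
  qed
  then have "group (BijGroup (carrier L)\<lparr>carrier := carrier (galois_group L K)\<rparr>)"
    by (rule subgroup.subgroup_is_group) (rule group_BijGroup)
  then show ?thesis by (simp add: galois_group_def)
qed

lemma galois_units_closed:
  assumes "ring L" and "s \<in> ring_hom L L" and "a \<in> Units L"
  shows "s a \<in> Units L"
  using assms(3) ring_hom_memE[OF assms(2)] unfolding Units_def by simp metis

lemma zero_module_units:
  assumes "field L" and "modification (galois_group L K) S"
  shows "zero_module S (units_of L) (\<lambda>\<sigma>. \<sigma>)"
proof -
  interpret field L by fact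
  interpret modification "galois_group L K" S by fact
  interpret U: comm_group "units_of L" by (rule units_comm_group)
  have mem: "s \<in> carrier (galois_group L K)" if "s \<in> carrier S - {\<zero>\<^sub>0\<^bsub>S\<^esub>}" for s
    using that carrier_modification by auto
  show ?thesis
  proof unfold_locales
    fix s a assume s: "s \<in> carrier S - {\<zero>\<^sub>0\<^bsub>S\<^esub>}" and a: "a \<in> carrier (units_of L)"
    have h: "s \<in> ring_hom L L" using galois_groupD(2) mem[OF s] by blast
    show "s a \<in> carrier (units_of L)"
      using a galois_units_closed[OF ring_axioms h] by (simp add: units_of_def)
    fix b assume b: "b \<in> carrier (units_of L)"
    show "s (a \<otimes>\<^bsub>units_of L\<^esub> b) = s a \<otimes>\<^bsub>units_of L\<^esub> s b"
      using a b ring_hom_memE[OF h] by (simp add: units_of_def Units_def)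
  next
    fix s t a assume s: "s \<in> carrier S - {\<zero>\<^sub>0\<^bsub>S\<^esub>}" "t \<in> carrier S - {\<zero>\<^sub>0\<^bsub>S\<^esub>}"
      and st: "s \<otimes>\<^bsub>S\<^esub> t \<noteq> \<zero>\<^sub>0\<^bsub>S\<^esub>" and a: "a \<in> carrier (units_of L)"
    have "s \<otimes>\<^bsub>S\<^esub> t = s \<otimes>\<^bsub>galois_group L K\<^esub> t"
      using mem s st mult_modification by blast
    then show "s (t a) = (s \<otimes>\<^bsub>S\<^esub> t) a"
      using mem s a galois_mult_apply[of s L K t a] by (auto simp: units_of_def)
  qed
qed

context modification
begin

lemma monoid_S: "monoid S"
proof (rule monoidI)
  show "\<one>\<^bsub>S\<^esub> \<in> carrier S" by (simp add: one_modification carrier_modification)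
qed (simp_all add: sg_closed sg_assoc one_left one_right)

lemma nonzero_cancel_unit:
  assumes "x \<in> carrier S" "x \<noteq> \<zero>\<^sub>0\<^bsub>S\<^esub>" "u \<in> Units S"
  shows "x \<otimes>\<^bsub>S\<^esub> u \<noteq> \<zero>\<^sub>0\<^bsub>S\<^esub>" "u \<otimes>\<^bsub>S\<^esub> x \<noteq> \<zero>\<^sub>0\<^bsub>S\<^esub>"
proof -
  interpret M: monoid S by (rule monoid_S)
  show "x \<otimes>\<^bsub>S\<^esub> u \<noteq> \<zero>\<^sub>0\<^bsub>S\<^esub>" "u \<otimes>\<^bsub>S\<^esub> x \<noteq> \<zero>\<^sub>0\<^bsub>S\<^esub>"
    using assms by (metis M.Units_closed M.Units_inv_closed M.Units_r_inv M.m_assoc M.r_one szero_left)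
      (use assms in \<open>metis M.Units_closed M.Units_inv_closed M.Units_l_inv M.m_assoc M.l_one szero_right\<close>)
qed

lemma Units_in_group: "u \<in> Units S \<Longrightarrow> u \<in> carrier G"
proof -
  interpret M: monoid S by (rule monoid_S)
  assume u: "u \<in> Units S"
  have "\<one>\<^bsub>S\<^esub> \<noteq> \<zero>\<^sub>0\<^bsub>S\<^esub>" using one_modification szero_notin G.one_closed by metis
  then have "u \<noteq> \<zero>\<^sub>0\<^bsub>S\<^esub>"
    using u by (metis M.Units_inv_closed M.Units_r_inv szero_left)
  then show "u \<in> carrier G" using u M.Units_closed carrier_modification by blast
qed

lemma unit_commute:
  assumes "comm_group G" and "x \<in> carrier S" and "u \<in> Units S"
  shows "x \<otimes>\<^bsub>S\<^esub> u = u \<otimes>\<^bsub>S\<^esub> x"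
proof -
  interpret G': comm_group G by fact
  interpret M: monoid S by (rule monoid_S)
  show ?thesis
  proof (cases "x = \<zero>\<^sub>0\<^bsub>S\<^esub>")
    case True
    then show ?thesis using M.Units_closed[OF assms(3)] by (simp add: szero_left szero_right)
  next
    case False
    then have "x \<in> carrier G" using assms(2) carrier_modification by auto
    then show ?thesis
      using nonzero_cancel_unit[OF assms(2) False assms(3)] Units_in_group[OF assms(3)]
        mult_modification[of x u] mult_modification[of u x] G'.m_comm by metis
  qed
qed

lemma units_normal:
  assumes "comm_group G" and "x \<in> carrier S"
  shows "x <#\<^bsub>S\<^esub> Units S = Units S #>\<^bsub>S\<^esub> x"
  using unit_commute[OF assms] by (auto simp: l_coset_def r_coset_def)

lemma equiv_unit_cong: "equiv (carrier S) (unit_cong S)"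
  by (rule equivI) (auto simp: unit_cong_def refl_on_def sym_def trans_def)

lemma unit_cong_iff:
  "(x, y) \<in> unit_cong S \<longleftrightarrow> x \<in> carrier S \<and> (\<exists>u \<in> Units S. y = x \<otimes>\<^bsub>S\<^esub> u)"
proof -
  interpret M: monoid S by (rule monoid_S)
  have 1: "x <#\<^bsub>S\<^esub> Units S = (x \<otimes>\<^bsub>S\<^esub> u) <#\<^bsub>S\<^esub> Units S" if "x \<in> carrier S" "u \<in> Units S" for x u
  proof -
    have u: "u \<in> carrier S" "inv\<^bsub>S\<^esub> u \<in> carrier S" "inv\<^bsub>S\<^esub> u \<in> Units S"
      using that M.Units_closed by auto
    have "x \<otimes>\<^bsub>S\<^esub> v \<in> (x \<otimes>\<^bsub>S\<^esub> u) <#\<^bsub>S\<^esub> Units S" if v: "v \<in> Units S" for v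
    proof -
      have vS: "v \<in> carrier S" using v M.Units_closed by blast
      have "(x \<otimes>\<^bsub>S\<^esub> u) \<otimes>\<^bsub>S\<^esub> (inv\<^bsub>S\<^esub> u \<otimes>\<^bsub>S\<^esub> v) = x \<otimes>\<^bsub>S\<^esub> ((u \<otimes>\<^bsub>S\<^esub> inv\<^bsub>S\<^esub> u) \<otimes>\<^bsub>S\<^esub> v)"
        using \<open>x \<in> carrier S\<close> u(1,2) vS by (simp only: M.m_assoc M.m_closed)
      also have "\<dots> = x \<otimes>\<^bsub>S\<^esub> v"
        using M.Units_r_inv[OF \<open>u \<in> Units S\<close>] M.l_one[OF vS] by simp
      finally have "x \<otimes>\<^bsub>S\<^esub> v = (x \<otimes>\<^bsub>S\<^esub> u) \<otimes>\<^bsub>S\<^esub> (inv\<^bsub>S\<^esub> u \<otimes>\<^bsub>S\<^esub> v)" by (rule sym)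
      then show ?thesis
        unfolding l_coset_def using M.Units_m_closed[OF u(3) v] by blast
    qed
    moreover have "(x \<otimes>\<^bsub>S\<^esub> u) \<otimes>\<^bsub>S\<^esub> v \<in> x <#\<^bsub>S\<^esub> Units S" if v: "v \<in> Units S" for v
      using M.m_assoc[OF \<open>x \<in> carrier S\<close> u(1) M.Units_closed[OF v]]
        M.Units_m_closed[OF \<open>u \<in> Units S\<close> v] unfolding l_coset_def by blast
    ultimately show ?thesis
      unfolding set_eq_subset l_coset_def[of S x] l_coset_def[of S "x \<otimes>\<^bsub>S\<^esub> u"] by simp blast
  qed
  have 2: "y \<in> y <#\<^bsub>S\<^esub> Units S" if "y \<in> carrier S" for y
    using that by (auto simp: l_coset_def intro!: bexI[of _ "\<one>\<^bsub>S\<^esub>"])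
  show ?thesis
  proof
    assume a: "(x, y) \<in> unit_cong S"
    show "x \<in> carrier S \<and> (\<exists>u \<in> Units S. y = x \<otimes>\<^bsub>S\<^esub> u)"
    proof (cases "x = \<zero>\<^sub>0\<^bsub>S\<^esub>")
      case True
      then show ?thesis using a by (auto simp: unit_cong_def intro!: bexI[of _ "\<one>\<^bsub>S\<^esub>"])
    next
      case False
      then have "x \<in> carrier S" "y \<in> x <#\<^bsub>S\<^esub> Units S"
        using a 2[of y] by (auto simp: unit_cong_def)
      then show ?thesis by (auto simp: l_coset_def)
    qed
  next
    assume "x \<in> carrier S \<and> (\<exists>u \<in> Units S. y = x \<otimes>\<^bsub>S\<^esub> u)"
    then obtain u where x: "x \<in> carrier S" and u: "u \<in> Units S" and y: "y = x \<otimes>\<^bsub>S\<^esub> u" by blast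
    show "(x, y) \<in> unit_cong S"
    proof (cases "x = \<zero>\<^sub>0\<^bsub>S\<^esub>")
      case True
      then show ?thesis using u y by (auto simp: unit_cong_def szero_left szero_closed)
    next
      case False
      then show ?thesis
        using x u y nonzero_cancel_unit[OF x False u] 1[OF x u] by (auto simp: unit_cong_def)
    qed
  qed
qed

lemma unit_cong_class: "x \<in> carrier S \<Longrightarrow> unit_cong S `` {x} = x <#\<^bsub>S\<^esub> Units S"
  by (auto simp: unit_cong_iff l_coset_def)

lemma unit_cong_mult:
  assumes "comm_group G" and xy: "(x, x') \<in> unit_cong S" "(y, y') \<in> unit_cong S"
  shows "(x \<otimes>\<^bsub>S\<^esub> y, x' \<otimes>\<^bsub>S\<^esub> y') \<in> unit_cong S"
proof -
  interpret M: monoid S by (rule monoid_S)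
  from xy obtain u v where *: "x \<in> carrier S" "y \<in> carrier S" "u \<in> Units S" "v \<in> Units S"
    "x' = x \<otimes>\<^bsub>S\<^esub> u" "y' = y \<otimes>\<^bsub>S\<^esub> v" unfolding unit_cong_iff by blast
  note uv = M.Units_closed[OF *(3)] M.Units_closed[OF *(4)]
  have "x' \<otimes>\<^bsub>S\<^esub> y' = x \<otimes>\<^bsub>S\<^esub> ((u \<otimes>\<^bsub>S\<^esub> y) \<otimes>\<^bsub>S\<^esub> v)"
    using * uv by (simp add: M.m_assoc)
  also have "\<dots> = (x \<otimes>\<^bsub>S\<^esub> y) \<otimes>\<^bsub>S\<^esub> (u \<otimes>\<^bsub>S\<^esub> v)"
    using * uv by (simp add: M.m_assoc flip: unit_commute[OF assms(1) *(2,3)])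
  finally show ?thesis using * unfolding unit_cong_iff by (auto intro: M.m_closed M.Units_m_closed)
qed

lemma quotient_mult:
  assumes "comm_group G" and "x \<in> carrier S" and "y \<in> carrier S"
  shows "unit_cong S `` {x} \<otimes>\<^bsub>quotient_by_units S\<^esub> unit_cong S `` {y} = unit_cong S `` {x \<otimes>\<^bsub>S\<^esub> y}"
proof -
  have "congruent2 (unit_cong S) (unit_cong S) (\<lambda>x y. unit_cong S `` {x \<otimes>\<^bsub>S\<^esub> y})"
    using unit_cong_mult[OF assms(1)] equiv_class_eq[OF equiv_unit_cong]
    by (intro congruent2I') blast
  from UN_equiv_class2[OF equiv_unit_cong equiv_unit_cong this assms(2,3)]
  show ?thesis by (simp add: quotient_by_units_def quotient_semigroup_def)
qed

lemma semigroup_zero_quotient: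
  assumes "comm_group G"
  shows "semigroup_zero (quotient_by_units S)"
proof
  have c: "carrier (quotient_by_units S) = (\<lambda>x. unit_cong S `` {x}) ` carrier S"
    and z: "\<zero>\<^sub>0\<^bsub>quotient_by_units S\<^esub> = unit_cong S `` {\<zero>\<^sub>0\<^bsub>S\<^esub>}"
    by (auto simp: quotient_by_units_def quotient_semigroup_def quotient_def)
  note q = quotient_mult[OF assms]
  show "\<zero>\<^sub>0\<^bsub>quotient_by_units S\<^esub> \<in> carrier (quotient_by_units S)"
    unfolding c z using szero_closed by blast
  fix x assume x: "x \<in> carrier (quotient_by_units S)"
  show "\<zero>\<^sub>0\<^bsub>quotient_by_units S\<^esub> \<otimes>\<^bsub>quotient_by_units S\<^esub> x = \<zero>\<^sub>0\<^bsub>quotient_by_units S\<^esub>"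
    "x \<otimes>\<^bsub>quotient_by_units S\<^esub> \<zero>\<^sub>0\<^bsub>quotient_by_units S\<^esub> = \<zero>\<^sub>0\<^bsub>quotient_by_units S\<^esub>"
    using x unfolding c z by (auto simp: q szero_closed szero_left szero_right)
  fix y assume y: "y \<in> carrier (quotient_by_units S)"
  show "x \<otimes>\<^bsub>quotient_by_units S\<^esub> y \<in> carrier (quotient_by_units S)"
    using x y unfolding c by (auto simp: q sg_closed)
  fix w assume w: "w \<in> carrier (quotient_by_units S)"
  show "(x \<otimes>\<^bsub>quotient_by_units S\<^esub> y) \<otimes>\<^bsub>quotient_by_units S\<^esub> w
      = x \<otimes>\<^bsub>quotient_by_units S\<^esub> (y \<otimes>\<^bsub>quotient_by_units S\<^esub> w)"
    using x y w unfolding c by (auto simp: q sg_closed sg_assoc)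
qed

end

lemma fixed_elementsI:
  assumes "l \<in> carrier L" and "\<And>u. u \<in> U \<Longrightarrow> u l = l"
  shows "l \<in> fixed_elements L U"
  unfolding fixed_elements_def by (intro CollectI conjI ballI assms)

lemma fixed_elementsD:
  assumes "l \<in> fixed_elements L U"
  shows "l \<in> carrier L" and "u \<in> U \<Longrightarrow> u l = l"
proof -
  have *: "l \<in> carrier L \<and> (\<forall>u\<in>U. u l = l)"
    using assms unfolding fixed_elements_def by (rule CollectD)
  show "l \<in> carrier L" by (rule conjunct1[OF *])
  show "u l = l" if "u \<in> U" by (rule bspec[OF conjunct2[OF *] that])
qed

lemma subfield_fixed_elements:
  assumes "field L" and "U \<subseteq> ring_hom L L"
  shows "subfield (fixed_elements L U) L"
proof -
  interpret field L by fact
  have h: "ring_hom_cring L L u" if "u \<in> U" for u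
    using subsetD[OF assms(2) that] by unfold_locales
  have hm: "u \<one>\<^bsub>L\<^esub> = \<one>\<^bsub>L\<^esub>"
    "\<lbrakk>x \<in> carrier L; y \<in> carrier L\<rbrakk> \<Longrightarrow> u (x \<otimes>\<^bsub>L\<^esub> y) = u x \<otimes>\<^bsub>L\<^esub> u y"
    "\<lbrakk>x \<in> carrier L; y \<in> carrier L\<rbrakk> \<Longrightarrow> u (x \<oplus>\<^bsub>L\<^esub> y) = u x \<oplus>\<^bsub>L\<^esub> u y" if "u \<in> U" for u x y
    using ring_hom_memE(2-4)[OF subsetD[OF assms(2) that]] by simp_all
  show ?thesis
  proof (rule subfieldI')
    show "subring (fixed_elements L U) L"
    proof (rule subringI)
      show "fixed_elements L U \<subseteq> carrier L" by (rule subsetI) (rule fixed_elementsD(1))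
      show "\<one>\<^bsub>L\<^esub> \<in> fixed_elements L U" by (rule fixed_elementsI) (simp, rule hm(1))
      fix a assume a: "a \<in> fixed_elements L U"
      note aL = fixed_elementsD(1)[OF a]
      show "\<ominus>\<^bsub>L\<^esub> a \<in> fixed_elements L U"
      proof (rule fixed_elementsI)
        fix u assume u: "u \<in> U"
        show "u (\<ominus>\<^bsub>L\<^esub> a) = \<ominus>\<^bsub>L\<^esub> a"
          using ring_hom_cring.hom_a_inv[OF h[OF u] aL] unfolding fixed_elementsD(2)[OF a u] .
      qed (rule a_inv_closed[OF aL])
      fix b assume b: "b \<in> fixed_elements L U"
      note bL = fixed_elementsD(1)[OF b]
      show "a \<otimes>\<^bsub>L\<^esub> b \<in> fixed_elements L U"
      proof (rule fixed_elementsI)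
        fix u assume u: "u \<in> U"
        show "u (a \<otimes>\<^bsub>L\<^esub> b) = a \<otimes>\<^bsub>L\<^esub> b"
          using hm(2)[OF u aL bL] unfolding fixed_elementsD(2)[OF a u] fixed_elementsD(2)[OF b u] .
      qed (rule m_closed[OF aL bL])
      show "a \<oplus>\<^bsub>L\<^esub> b \<in> fixed_elements L U"
      proof (rule fixed_elementsI)
        fix u assume u: "u \<in> U"
        show "u (a \<oplus>\<^bsub>L\<^esub> b) = a \<oplus>\<^bsub>L\<^esub> b"
          using hm(3)[OF u aL bL] unfolding fixed_elementsD(2)[OF a u] fixed_elementsD(2)[OF b u] .
      qed (rule a_closed[OF aL bL])
    qed
  next
    fix k assume k: "k \<in> fixed_elements L U - {\<zero>\<^bsub>L\<^esub>}"
    then have ku: "k \<in> Units L" using fixed_elementsD(1)[of k L U] field_Units by simp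
    have inv_fixed: "u (inv\<^bsub>L\<^esub> k) = inv\<^bsub>L\<^esub> k" if u: "u \<in> U" for u
    proof -
      interpret u: ring_hom_cring L L u by (rule h[OF u])
      have "u k = k" using fixed_elementsD(2)[of k L U u] k u by simp
      then have 1: "k \<otimes>\<^bsub>L\<^esub> u (inv\<^bsub>L\<^esub> k) = \<one>\<^bsub>L\<^esub>"
        using u.hom_mult[OF Units_closed[OF ku] Units_inv_closed[OF ku]] Units_r_inv[OF ku] by simp
      show ?thesis
        using comm_inv_char[OF Units_closed[OF ku] u.hom_closed[OF Units_inv_closed[OF ku]] 1] by simp
    qed
    show "inv\<^bsub>L\<^esub> k \<in> fixed_elements L U"
    proof (rule fixed_elementsI)
      show "inv\<^bsub>L\<^esub> k \<in> carrier L" by (rule Units_inv_closed[OF ku])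
    qed (rule inv_fixed)
  qed
qed

lemma class_action_class:
  assumes "modification (galois_group L K) S"
    and x: "x \<in> carrier S" "x \<noteq> \<zero>\<^sub>0\<^bsub>S\<^esub>" and a: "a \<in> fixed_elements L (Units S)"
  shows "class_action (unit_cong S `` {x}) a = x a"
proof -
  interpret modification "galois_group L K" S by fact
  have "y a = x a" if xy: "(x, y) \<in> unit_cong S" for y
  proof -
    obtain u where u: "u \<in> Units S" "y = x \<otimes>\<^bsub>S\<^esub> u" using xy unfolding unit_cong_iff by blast
    have "x \<in> carrier (galois_group L K)" using x carrier_modification by auto
    then have "y = x \<otimes>\<^bsub>galois_group L K\<^esub> u"
      using u Units_in_group[OF u(1)] nonzero_cancel_unit(1)[OF x u(1)] mult_modification[of x u]
      by auto
    then have "y a = x (u a)"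
      using \<open>x \<in> carrier (galois_group L K)\<close> Units_in_group[OF u(1)] fixed_elementsD(1)[OF a]
      by (simp only: galois_mult_apply)
    then show ?thesis by (simp only: fixed_elementsD(2)[OF a u(1)])
  qed
  then have "(\<lambda>y. y a) ` (unit_cong S `` {x}) \<subseteq> {x a}" by blast
  moreover have "(x, x) \<in> unit_cong S" using x by (auto simp: unit_cong_def)
  ultimately have "(\<lambda>y. y a) ` (unit_cong S `` {x}) = {x a}" by blast
  then show ?thesis by (simp add: class_action_def)
qed

lemma zero_module_fixed_units:
  assumes L: "field L" "finite (carrier L)" and S: "modification (galois_group L K) S"
  shows "zero_module (quotient_by_units S)
    (units_of (L\<lparr>carrier := fixed_elements L (Units S)\<rparr>)) class_action"
proof -
  interpret field L by fact
  interpret modification "galois_group L K" S by fact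
  have cG: "comm_group (galois_group L K)"
    using L G.group_axioms by (rule comm_group_galois_group)
  interpret Q: semigroup_zero "quotient_by_units S" by (rule semigroup_zero_quotient[OF cG])
  let ?P = "fixed_elements L (Units S)"
  have "Units S \<subseteq> ring_hom L L" using Units_in_group galois_groupD(2) by blast
  then have sf: "subfield ?P L" by (rule subfield_fixed_elements[OF L(1)])
  interpret P: field "L\<lparr>carrier := ?P\<rparr>" by (rule subfield_iff(2)[OF sf])
  interpret A: comm_group "units_of (L\<lparr>carrier := ?P\<rparr>)" by (rule P.units_comm_group)
  have cA: "carrier (units_of (L\<lparr>carrier := ?P\<rparr>)) = ?P - {\<zero>\<^bsub>L\<^esub>}"
    using P.field_Units by (simp add: units_of_def)
  have mA: "a \<otimes>\<^bsub>units_of (L\<lparr>carrier := ?P\<rparr>)\<^esub> b = a \<otimes>\<^bsub>L\<^esub> b" for a b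
    by (simp add: units_of_def)
  have cQ: "\<exists>x. x \<in> carrier (galois_group L K) \<and> x \<in> carrier S \<and> x \<noteq> \<zero>\<^sub>0\<^bsub>S\<^esub> \<and> s = unit_cong S `` {x}"
    if "s \<in> carrier (quotient_by_units S) - {\<zero>\<^sub>0\<^bsub>quotient_by_units S\<^esub>}" for s
    using that carrier_modification
    by (auto simp: quotient_by_units_def quotient_semigroup_def quotient_def)
  have act: "x a \<in> ?P - {\<zero>\<^bsub>L\<^esub>}"
    if x: "x \<in> carrier (galois_group L K)" and a: "a \<in> ?P - {\<zero>\<^bsub>L\<^esub>}" for x a
  proof -
    have h: "x \<in> ring_hom L L" using x galois_groupD(2) by blast
    have aP: "a \<in> ?P" using a by simp
    have aL: "a \<in> carrier L" by (rule fixed_elementsD(1)[OF aP])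
    have "u (x a) = x a" if u: "u \<in> Units S" for u
      using ring_hom_commute_finite_field[OF L galois_groupD(2)[OF Units_in_group[OF u]] h aL]
      by (simp only: fixed_elementsD(2)[OF aP u])
    note xa = this
    have xU: "x a \<in> Units L"
      by (rule galois_units_closed[OF ring_axioms h]) (use a aL field_Units in simp)
    have "x a \<in> ?P"
    proof (rule fixed_elementsI)
      show "x a \<in> carrier L" using xU by (simp add: Units_def)
    qed (rule xa)
    then show ?thesis using xU field_Units by simp
  qed
  show ?thesis
  proof unfold_locales
    fix s a assume s: "s \<in> carrier (quotient_by_units S) - {\<zero>\<^sub>0\<^bsub>quotient_by_units S\<^esub>}"
      and a: "a \<in> carrier (units_of (L\<lparr>carrier := ?P\<rparr>))"
    obtain x where x: "x \<in> carrier (galois_group L K)" "x \<in> carrier S" "x \<noteq> \<zero>\<^sub>0\<^bsub>S\<^esub>"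
      "s = unit_cong S `` {x}" using cQ[OF s] by blast
    note c = class_action_class[OF S x(2,3), folded x(4)]
    show "class_action s a \<in> carrier (units_of (L\<lparr>carrier := ?P\<rparr>))"
      using act[OF x(1)] a c[of a] unfolding cA by simp
    fix b assume b: "b \<in> carrier (units_of (L\<lparr>carrier := ?P\<rparr>))"
    have ab: "a \<otimes>\<^bsub>L\<^esub> b \<in> ?P" using A.m_closed[OF a b] unfolding mA cA by blast
    show "class_action s (a \<otimes>\<^bsub>units_of (L\<lparr>carrier := ?P\<rparr>)\<^esub> b)
        = class_action s a \<otimes>\<^bsub>units_of (L\<lparr>carrier := ?P\<rparr>)\<^esub> class_action s b"
      using a b c[OF ab] c[of a] c[of b] fixed_elementsD(1)[of a L "Units S"] fixed_elementsD(1)[of b L "Units S"]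
        ring_hom_memE(2)[OF galois_groupD(2)[OF x(1)], of a b] unfolding mA cA
      by simp
  next
    fix s t a assume s: "s \<in> carrier (quotient_by_units S) - {\<zero>\<^sub>0\<^bsub>quotient_by_units S\<^esub>}"
      and t: "t \<in> carrier (quotient_by_units S) - {\<zero>\<^sub>0\<^bsub>quotient_by_units S\<^esub>}"
      and st: "s \<otimes>\<^bsub>quotient_by_units S\<^esub> t \<noteq> \<zero>\<^sub>0\<^bsub>quotient_by_units S\<^esub>"
      and a: "a \<in> carrier (units_of (L\<lparr>carrier := ?P\<rparr>))"
    obtain x where x: "x \<in> carrier (galois_group L K)" "x \<in> carrier S" "x \<noteq> \<zero>\<^sub>0\<^bsub>S\<^esub>"
      "s = unit_cong S `` {x}" using cQ[OF s] by blast
    obtain y where y: "y \<in> carrier (galois_group L K)" "y \<in> carrier S" "y \<noteq> \<zero>\<^sub>0\<^bsub>S\<^esub>"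
      "t = unit_cong S `` {y}" using cQ[OF t] by blast
    have aP: "a \<in> ?P" "a \<in> carrier L" "y a \<in> ?P"
      using a act[OF y(1), of a] fixed_elementsD(1)[of a L "Units S"] unfolding cA by simp_all
    have q: "s \<otimes>\<^bsub>quotient_by_units S\<^esub> t = unit_cong S `` {x \<otimes>\<^bsub>S\<^esub> y}"
      unfolding x(4) y(4) by (rule quotient_mult[OF cG x(2) y(2)])
    then have xy: "x \<otimes>\<^bsub>S\<^esub> y \<noteq> \<zero>\<^sub>0\<^bsub>S\<^esub>"
      using st by (auto simp: quotient_by_units_def quotient_semigroup_def)
    then have e: "x \<otimes>\<^bsub>S\<^esub> y = x \<otimes>\<^bsub>galois_group L K\<^esub> y" using mult_modification x(1) y(1) by blast
    show "class_action s (class_action t a) = class_action (s \<otimes>\<^bsub>quotient_by_units S\<^esub> t) a"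
      unfolding q unfolding x(4) y(4)
      using class_action_class[OF S y(2,3) aP(1)] class_action_class[OF S x(2,3) aP(3)]
        class_action_class[OF S sg_closed[OF x(2) y(2)] xy aP(1)]
        galois_mult_apply[OF x(1) y(1) aP(2)] e by simp
  qed
qed

end

theory Submission
  imports Defs
begin

text \<open>
  The isomorphism is inflation along the projection \<open>S \<rightarrow> S/U\<close>.  The automorphisms of the finite field
  \<open>L\<close> in \<open>U\<close> form a cyclic group, so Hilbert 90 and the surjectivity of the norm of a finite field
  give \<open>H\<^sup>1(U, L\<^sup>\<times>) = H\<^sup>2(U, L\<^sup>\<times>) = 0\<close>.  With \<open>H\<^sup>2 = 0\<close> a 0-cocycle on \<open>S\<close> can be made trivial on
  \<open>U \<times> U\<close>, then, \<open>U\<close> being central and acting freely on \<open>S - {0}\<close>, on all pairs \<open>(u, x)\<close>; with \<open>H\<^sup>1 = 0\<close>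
  also on all pairs \<open>(x, u)\<close>.  Such a 0-cocycle is constant on cosets and \<open>U\<close>-invariant, hence inflated.
  Conversely, by \<open>H\<^sup>1 = 0\<close>, an inflated 0-cocycle that is a coboundary is the coboundary of an inflated cochain.
\<close>

section \<open>Automorphisms of finite fields\<close>

text \<open>Three facts about S are behind the steps. A nonzero product in S is the product in G, so
  by cancellation in G the equation u x = x with x nonzero forces u = 1; this is the freeness. G is
  abelian because L is finite, so U is central and units can be moved through every product. A
  product of units is a unit, hence never 0, so a 0-cochain of S restricts to an ordinary cochain of
  the group U. The comparison is carried out on cochains, and the obstacle is that a later
  normalisation may spoil an earlier one. It is met by correcting factors that are prescribed on
  representatives of the U-orbits, extended along each orbit, and equal to 1 on U. Cochains are not
  assumed normalised, so the value at (1, 1) has to be carried along. Surjectivity of the norm is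
  the statement that a finite module over a finite cyclic group has Herbrand quotient 1: Hilbert 90
  settles one Tate group, and counting settles the other.\<close>

lemma (in domain) dedekind_independence:
  assumes "monoid M" and "finite I"
    and "\<And>i. i \<in> I \<Longrightarrow> \<chi> i \<in> hom M (Multiplicative_Group.mult_of R)"
    and "\<And>i j. \<lbrakk>i \<in> I; j \<in> I; i \<noteq> j\<rbrakk> \<Longrightarrow> \<exists>x \<in> carrier M. \<chi> i x \<noteq> \<chi> j x"
    and "c \<in> I \<rightarrow> carrier R"
    and "\<And>x. x \<in> carrier M \<Longrightarrow> (\<Oplus>i\<in>I. c i \<otimes> \<chi> i x) = \<zero>"
    and "i \<in> I"
  shows "c i = \<zero>"
  using assms(2-7)
proof (induction I arbitrary: c i rule: finite_induct)
  case empty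
  then show ?case by simp
next
  case (insert k J)
  interpret M: monoid M by fact
  have X: "\<chi> i x \<in> carrier R" "\<chi> i x \<noteq> \<zero>" if "i \<in> insert k J" "x \<in> carrier M" for i x
    using insert.prems(1)[OF that(1)] that(2) by (auto simp: hom_def)
  have XM: "\<chi> i (x \<otimes>\<^bsub>M\<^esub> y) = \<chi> i x \<otimes> \<chi> i y" if "i \<in> insert k J" "x \<in> carrier M" "y \<in> carrier M" for i x y
    using insert.prems(1)[OF that(1)] that(2,3) by (auto simp: hom_def)
  have C: "c i \<in> carrier R" if "i \<in> insert k J" for i
    using insert.prems(3) that by auto
  have split: "(\<Oplus>i\<in>J. c i \<otimes> \<chi> i x) \<oplus> c k \<otimes> \<chi> k x = \<zero>" if "x \<in> carrier M" for x
  proof -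
    have "(\<Oplus>i\<in>insert k J. c i \<otimes> \<chi> i x) = c k \<otimes> \<chi> k x \<oplus> (\<Oplus>i\<in>J. c i \<otimes> \<chi> i x)"
      using insert.hyps that X C by (intro finsum_insert) auto
    then show ?thesis using insert.prems(4)[OF that] X C that
      by (subst a_comm) (auto intro!: finsum_closed)
  qed
  have J0: "c j = \<zero>" if j: "j \<in> J" for j
  proof -
    obtain y where y: "y \<in> carrier M" "\<chi> j y \<noteq> \<chi> k y"
      using insert.prems(2)[of j k] j insert.hyps by auto
    \<comment> \<open>Subtracting \<chi>_k(y) times the relation at x from the relation at y x
      cancels the term of k. What remains is a relation over \<open>J\<close> with these
      coefficients, and \<chi>_j(y) - \<chi>_k(y) is nonzero by the choice of y, so d_j = 0 forces
      c_j = 0.\<close>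
    define d where "d i = c i \<otimes> (\<chi> i y \<ominus> \<chi> k y)" for i
    have "d j = \<zero>"
    proof (rule insert.IH)
      fix x assume x: "x \<in> carrier M"
      let ?S = "\<lambda>x. \<Oplus>i\<in>J. c i \<otimes> \<chi> i x"
      have cl: "?S x \<in> carrier R" "?S (y \<otimes>\<^bsub>M\<^esub> x) \<in> carrier R"
        "c k \<in> carrier R" "\<chi> k x \<in> carrier R" "\<chi> k y \<in> carrier R"
        using X C x y by (auto intro!: finsum_closed)
      have e: "?S (y \<otimes>\<^bsub>M\<^esub> x) \<oplus> c k \<otimes> (\<chi> k y \<otimes> \<chi> k x) = \<zero>"
        using split[of "y \<otimes>\<^bsub>M\<^esub> x"] XM x y by simp
      have "?S (y \<otimes>\<^bsub>M\<^esub> x) = (\<Oplus>i\<in>J. c i \<otimes> (\<chi> i y \<ominus> \<chi> k y) \<otimes> \<chi> i x \<oplus> \<chi> k y \<otimes> (c i \<otimes> \<chi> i x))"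
      proof (intro add.finprod_cong' refl)
        fix i assume i: "i \<in> J"
        then have "c i \<in> carrier R" "\<chi> i y \<in> carrier R" "\<chi> i x \<in> carrier R" "\<chi> k y \<in> carrier R"
          using X C x y by auto
        then show "c i \<otimes> \<chi> i (y \<otimes>\<^bsub>M\<^esub> x) = c i \<otimes> (\<chi> i y \<ominus> \<chi> k y) \<otimes> \<chi> i x \<oplus> \<chi> k y \<otimes> (c i \<otimes> \<chi> i x)"
          using XM[of i y x] i x y by simp algebra
      qed (use X C x y in auto)
      also have "\<dots> = (\<Oplus>i\<in>J. c i \<otimes> (\<chi> i y \<ominus> \<chi> k y) \<otimes> \<chi> i x) \<oplus> \<chi> k y \<otimes> ?S x"
        using X C x y by (subst finsum_addf) (auto simp: finsum_rdistr insert.hyps)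
      finally have f: "?S (y \<otimes>\<^bsub>M\<^esub> x) = (\<Oplus>i\<in>J. c i \<otimes> (\<chi> i y \<ominus> \<chi> k y) \<otimes> \<chi> i x) \<oplus> \<chi> k y \<otimes> ?S x" .
      have tc: "(\<Oplus>i\<in>J. c i \<otimes> (\<chi> i y \<ominus> \<chi> k y) \<otimes> \<chi> i x) \<in> carrier R"
        using X C x y by (auto intro!: finsum_closed)
      have "?S x = \<ominus> (c k \<otimes> \<chi> k x)" using split[OF x] cl minus_equality by auto
      then have "(\<Oplus>i\<in>J. c i \<otimes> (\<chi> i y \<ominus> \<chi> k y) \<otimes> \<chi> i x)
          \<oplus> (\<chi> k y \<otimes> \<ominus> (c k \<otimes> \<chi> k x) \<oplus> c k \<otimes> (\<chi> k y \<otimes> \<chi> k x)) = \<zero>"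
        using e f tc cl by (simp add: a_assoc)
      moreover have "\<chi> k y \<otimes> \<ominus> (c k \<otimes> \<chi> k x) \<oplus> c k \<otimes> (\<chi> k y \<otimes> \<chi> k x) = \<zero>"
        using cl by algebra
      ultimately show "(\<Oplus>i\<in>J. d i \<otimes> \<chi> i x) = \<zero>"
        using tc by (simp add: d_def)
    qed (use insert.prems X C y j in \<open>auto simp: d_def\<close>)
    then show ?thesis
      unfolding d_def
      using integral_iff[of "c j" "\<chi> j y \<ominus> \<chi> k y"] C[of j] X(1)[of j y] X(1)[of k y] j y by auto
  qed
  have "c k \<otimes> \<chi> k \<one>\<^bsub>M\<^esub> = \<zero>"
  proof -
    have "(\<Oplus>i\<in>J. c i \<otimes> \<chi> i \<one>\<^bsub>M\<^esub>) = (\<Oplus>i\<in>J. \<zero>)"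
      using J0 X by (intro add.finprod_cong') auto
    then show ?thesis using split[of "\<one>\<^bsub>M\<^esub>"] C X by simp
  qed
  then have "c k = \<zero>" using integral_iff C X by simp
  then show ?case using J0 insert.prems(5) by auto
qed

section \<open>Endomorphisms of a finite field are powers of the Frobenius map\<close>

lemma (in cring) binomial_expansion:
  assumes x: "x \<in> carrier R"
  shows "(\<one> \<oplus> x) [^] n = (\<Oplus>j\<in>{..n}. [(n choose j)] \<cdot> (x [^] j))"
proof (induction n)
  case 0
  then show ?case using x by simp
next
  case (Suc n)
  let ?a = "\<lambda>m j. [(m choose j)] \<cdot> (x [^] j)"
  have c: "?a m j \<in> carrier R" for m j using x by simp
  have d: "(\<lambda>j. ?a n j \<otimes> x) \<in> {..n} \<rightarrow> carrier R" using x by simp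
  \<comment> \<open>Pascal's rule in every term of positive index, after the term of index 0 is
    split off.\<close>
  have "(\<Oplus>j\<in>{..Suc n}. ?a (Suc n) j)
      = (\<Oplus>j\<in>{..n}. ?a n j \<otimes> x \<oplus> ?a n (Suc j)) \<oplus> ?a (Suc n) 0"
    using x by (subst finsum_Suc2) (auto intro!: add.finprod_cong' simp: add.nat_pow_mult add_pow_ldistr)
  also have "\<dots> = (\<Oplus>j\<in>{..n}. ?a n j \<otimes> x) \<oplus> ((\<Oplus>j\<in>{..n}. ?a n (Suc j)) \<oplus> ?a n 0)"
    using x c by (subst finsum_addf) (auto simp: a_assoc)
  also have "(\<Oplus>j\<in>{..n}. ?a n (Suc j)) \<oplus> ?a n 0 = (\<Oplus>j\<in>{..Suc n}. ?a n j)"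
    using c by (intro finsum_Suc2[symmetric]) auto
  also have "\<dots> = (\<Oplus>j\<in>{..n}. ?a n j)" using c x by (subst finsum_Suc) (auto simp: binomial_eq_0)
  also have "(\<Oplus>j\<in>{..n}. ?a n j \<otimes> x) = (\<Oplus>j\<in>{..n}. ?a n j) \<otimes> x"
    using c x by (subst finsum_ldistr) auto
  also have "(\<Oplus>j\<in>{..n}. ?a n j) \<otimes> x \<oplus> (\<Oplus>j\<in>{..n}. ?a n j) = (\<one> \<oplus> x) [^] Suc n"
    using Suc x by (simp add: r_distr a_comm flip: Suc)
  finally show ?case by simp
qed

text \<open>Write s = p^a t with t prime to p. If t > 1, then j = p^a lies strictly between 0 and s,
  but p does not divide the binomial coefficient of p^a t over p^a.\<close>

lemma power_of_prime_if_binomials_dvd: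
  fixes p s :: nat
  assumes p: "Factorial_Ring.prime p" and s: "0 < s"
    and dvd: "\<And>j. \<lbrakk>0 < j; j < s\<rbrakk> \<Longrightarrow> p dvd (s choose j)"
  shows "\<exists>a. s = p ^ a"
proof -
  obtain a t where t: "s = p ^ a * t" "\<not> p dvd t"
    using multiplicity_decompose'[of s p] s p by (metis neq0_conv not_prime_unit)
  have t0: "t > 0" using t s by (cases t) auto
  have "t = 1"
  proof (rule ccontr)
    assume "t \<noteq> 1"
    then have "1 < t" using t0 by simp
    then have "p ^ a * 1 < p ^ a * t"
      using prime_gt_0_nat[OF p] by (intro mult_strict_left_mono) auto
    then have "p ^ a < s" using t(1) by simp
    moreover have "0 < p ^ a" using prime_gt_0_nat[OF p] by simp
    ultimately have "p dvd (p ^ a * t choose p ^ a)" using dvd[of "p ^ a"] t by simp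
    moreover have "multiplicity p (p ^ a * t choose p ^ a) = 0"
      using const_p_fac[OF t0 p] t by (simp add: not_dvd_imp_multiplicity_0)
    ultimately show False
      using \<open>p ^ a < s\<close> t p multiplicity_eq_zero_iff[of "p ^ a * t choose p ^ a" p]
      by (auto simp: binomial_eq_0_iff)
  qed
  then show ?thesis using t(1) by auto
qed

text \<open>The prime is the additive order of 1: positive by finiteness, different from 1 as 1 is
  not 0, and prime because (m n)1 = (m 1)(n 1) in a domain.\<close>

lemma (in domain) finite_characteristic_prime:
  assumes "finite (carrier R)"
  shows "\<exists>p::nat. Factorial_Ring.prime p \<and> (\<forall>n::nat. [n] \<cdot> \<one> = \<zero> \<longleftrightarrow> p dvd n)"
proof (intro exI conjI allI)
  let ?p = "add.ord \<one>"
  show dvd: "[n] \<cdot> \<one> = \<zero> \<longleftrightarrow> ?p dvd n" for n :: nat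
    using add.pow_eq_id[of \<one> n] by (simp add: add_pow_def)
  have "?p \<ge> 1" using assms add.ord_ge_1[of \<one>] by simp
  moreover have "?p \<noteq> 1" using dvd[of 1] by auto
  moreover have "?p dvd m \<or> ?p dvd n" if "?p dvd m * n" for m n
  proof -
    have "[(m * n)] \<cdot> \<one> = ([m] \<cdot> \<one>) \<otimes> ([n] \<cdot> \<one>)"
      by (simp add: add_pow_ldistr add_pow_rdistr add.nat_pow_pow mult.commute)
    then show ?thesis using that integral_iff[of "[m] \<cdot> \<one>" "[n] \<cdot> \<one>"] by (simp flip: dvd)
  qed
  ultimately show "Factorial_Ring.prime ?p"
    unfolding normalization_semidom_class.prime_def prime_elem_def by auto
qed

text \<open>On a generator g of the cyclic multiplicative group \<phi> is a power map, hence \<phi>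
  x = x^s everywhere. Additivity turns the binomial expansion of (1 + x)^s into a linear relation
  between the characters x \<mapsto> x^j with 0 < j < s. Their independence makes every inner
  binomial coefficient divisible by p, so s is a power of p.\<close>

lemma (in field) ring_endomorphism_prime_power:
  fixes p :: nat
  assumes fin: "finite (carrier R)" and p: "Factorial_Ring.prime p"
    and char: "\<And>n::nat. [n] \<cdot> \<one> = \<zero> \<longleftrightarrow> p dvd n"
    and \<phi>: "\<phi> \<in> ring_hom R R"
  shows "\<exists>a. \<forall>x \<in> carrier R. \<phi> x = x [^] (p ^ a)"
proof -
  interpret s: ring_hom_cring R R \<phi> by unfold_locales (rule \<phi>)
  interpret M: group "Multiplicative_Group.mult_of R" by (rule field_mult_group)
  obtain g where g: "g \<in> carrier (Multiplicative_Group.mult_of R)"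
    and gen: "carrier (Multiplicative_Group.mult_of R) = {g [^] i | i::nat. i \<in> UNIV}"
    using finite_field_mult_group_has_gen[OF fin] by blast
  have gR: "g \<in> carrier R" "g \<noteq> \<zero>" using g by auto
  define d where "d = M.ord g"
  have d: "d > 0" using M.ord_ge_1[OF _ g] fin by (simp add: d_def)
  have pow: "x [^]\<^bsub>Multiplicative_Group.mult_of R\<^esub> (n::nat) = x [^] n" for x n by (simp add: Multiplicative_Group.nat_pow_mult_of)
  have eq: "g [^] i = g [^] j \<longleftrightarrow> int d dvd int i - int j" for i j :: nat
    using M.int_pow_eq[OF g, of "int i" "int j"] by (simp add: int_pow_int pow d_def dvd_diff_commute)
  have "\<phi> g \<noteq> \<zero>"
  proof
    assume "\<phi> g = \<zero>"
    moreover have "g \<otimes> inv g = \<one>" "inv g \<in> carrier R" using gR field_Units by auto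
    ultimately show False
      using gR by (metis s.hom_closed s.hom_mult s.hom_one l_null zero_not_one)
  qed
  then have "\<phi> g \<in> carrier (Multiplicative_Group.mult_of R)" using gR by simp
  then obtain k :: nat where k: "\<phi> g = g [^] k" using gen by auto
  \<comment> \<open>The residue of k modulo d is taken in the range 1 to d: \<open>0 < s\<close>
    makes x^s correct at x = 0 as well, and \<open>s \<le> d\<close> keeps the exponents between 0
    and s distinct modulo d.\<close>
  define s where "s = (if k mod d = 0 then d else k mod d)"
  have s: "0 < s" "s \<le> d" using d by (auto simp: s_def less_imp_le)
  have "int d dvd int k - int s"
    by (auto simp: s_def zmod_int mod_eq_dvd_iff[symmetric])
  then have sg: "\<phi> g = g [^] s" using k eq by simp
  have pw: "\<phi> x = x [^] s" if x: "x \<in> carrier R" for x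
  proof (cases "x = \<zero>")
    case False
    then have "x \<in> carrier (Multiplicative_Group.mult_of R)" using x by simp
    then obtain i :: nat where "x = g [^] i" using gen by auto
    then show ?thesis using gR sg by (simp add: nat_pow_pow mult.commute)
  qed (use s in \<open>simp add: nat_pow_zero\<close>)
  have "p dvd (s choose j)" if j: "0 < j" "j < s" for j
  proof -
    have "[(s choose j)] \<cdot> \<one> = \<zero>"
    proof (rule dedekind_independence[where M = "Multiplicative_Group.mult_of R" and I = "{0<..<s}" and \<chi> = "\<lambda>j x. x [^] j"
          and c = "\<lambda>j. [(s choose j)] \<cdot> \<one>"])
      show "monoid (Multiplicative_Group.mult_of R)" by unfold_locales
      show "(\<lambda>x. x [^] i) \<in> hom (Multiplicative_Group.mult_of R) (Multiplicative_Group.mult_of R)" for i :: nat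
        using M.nat_pow_closed[of _ i, unfolded pow] by (auto simp: hom_def nat_pow_distrib)
      show "\<exists>x\<in>carrier (Multiplicative_Group.mult_of R). x [^] i \<noteq> x [^] j" if "i \<in> {0<..<s}" "j \<in> {0<..<s}" "i \<noteq> j" for i j
      proof (rule bexI[OF _ g])
        \<comment> \<open>Two exponents strictly between 0 and s differ by less than s, hence by
          less than the order d of g.\<close>
        have "\<not> int d dvd int i - int j"
          using that s zdvd_imp_le[of "int d" "int i - int j"] zdvd_imp_le[of "int d" "int j - int i"]
          by (cases i j rule: linorder_cases) (auto simp: dvd_diff_commute[of _ "int i"])
        then show "g [^] i \<noteq> g [^] j" using eq by simp
      qed
      fix x assume "x \<in> carrier (Multiplicative_Group.mult_of R)"
      then have x: "x \<in> carrier R" by simp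
      let ?t = "\<lambda>j. [(s choose j)] \<cdot> (x [^] j)"
      have t: "?t j \<in> carrier R" for j using x by simp
      have "{..s} = insert 0 (insert s {0<..<s})" using s by auto
      then have "(\<one> \<oplus> x) [^] s = (\<Oplus>j\<in>insert 0 (insert s {0<..<s}). ?t j)"
        using binomial_expansion[OF x] by simp
      also have "\<dots> = \<one> \<oplus> (x [^] s \<oplus> (\<Oplus>j\<in>{0<..<s}. ?t j))"
        using s x by (subst finsum_insert; simp)+
      \<comment> \<open>Additivity of \<phi> enters here: (1 + x)^s = \<phi>(1 + x) = 1 + x^s. The
        element 1 + x may be 0, which \<open>pw\<close> covers.\<close>
      finally have "\<one> \<oplus> x [^] s = \<one> \<oplus> (x [^] s \<oplus> (\<Oplus>j\<in>{0<..<s}. ?t j))"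
        using pw[of "\<one> \<oplus> x"] pw[of x] x by simp
      moreover have "(\<Oplus>j\<in>{0<..<s}. ?t j) \<in> carrier R" using x by (auto intro!: finsum_closed)
      ultimately have "(\<Oplus>j\<in>{0<..<s}. ?t j) = \<zero>" using x by (simp add: add.l_cancel_one')
      moreover have "(\<Oplus>j\<in>{0<..<s}. ([(s choose j)] \<cdot> \<one>) \<otimes> x [^] j) = (\<Oplus>j\<in>{0<..<s}. ?t j)"
        using x by (intro add.finprod_cong') (auto simp: add_pow_ldistr)
      ultimately show "(\<Oplus>j\<in>{0<..<s}. ([(s choose j)] \<cdot> \<one>) \<otimes> x [^] j) = \<zero>" by simp
    qed (use j in auto)
    then show ?thesis using char by simp
  qed
  then obtain a where "s = p ^ a" using power_of_prime_if_binomials_dvd[OF p s(1)] by blast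
  then show ?thesis using pw by auto
qed

section \<open>Groups of automorphisms of a finite field\<close>

text \<open>The automorphisms appear as an abstract group with a faithful action, because the
  instance in view is the group of units of S, whose product is that of S and agrees with
  composition only after an argument.\<close>

locale finite_field_action = L?: field L + W: group W
  for L :: "('a, 'm) ring_scheme" (structure) and W :: "('w, 'n) monoid_scheme" (structure) +
  fixes act :: "'w \<Rightarrow> 'a \<Rightarrow> 'a"
  assumes finite_field: "finite (carrier L)"
    and act_ring_hom: "w \<in> carrier W \<Longrightarrow> act w \<in> ring_hom L L"
    and act_comp: "\<lbrakk>v \<in> carrier W; w \<in> carrier W; x \<in> carrier L\<rbrakk>
      \<Longrightarrow> act (v \<otimes>\<^bsub>W\<^esub> w) x = act v (act w x)"
    and act_id: "x \<in> carrier L \<Longrightarrow> act \<one>\<^bsub>W\<^esub> x = x"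
    and faithful: "\<lbrakk>v \<in> carrier W; w \<in> carrier W; \<And>x. x \<in> carrier L \<Longrightarrow> act v x = act w x\<rbrakk> \<Longrightarrow> v = w"
begin

lemma act_in: "\<lbrakk>w \<in> carrier W; x \<in> carrier L\<rbrakk> \<Longrightarrow> act w x \<in> carrier L"
  using act_ring_hom by (auto simp: ring_hom_def)

lemma act_inv: "\<lbrakk>w \<in> carrier W; x \<in> carrier L\<rbrakk> \<Longrightarrow> act (inv\<^bsub>W\<^esub> w) (act w x) = x"
  by (metis W.inv_closed W.l_inv act_comp act_id)

text \<open>Every automorphism is \<open>x \<mapsto> x\<^bsup>p^a\<^esup>\<close>; the one with least positive exponent \<open>a\<close> generates.\<close>

lemma cyclic: "\<exists>t \<in> carrier W. carrier W = range (\<lambda>i::nat. t [^]\<^bsub>W\<^esub> i)"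
proof -
  obtain p :: nat where p: "Factorial_Ring.prime p" and char: "\<And>n::nat. [n] \<cdot>\<^bsub>L\<^esub> \<one>\<^bsub>L\<^esub> = \<zero>\<^bsub>L\<^esub> \<longleftrightarrow> p dvd n"
    using finite_characteristic_prime[OF finite_field] by blast
  \<comment> \<open>A relation, not a function: each automorphism has many Frobenius exponents.
    Exponents add under products and, by \<open>diff\<close>, subtract under quotients, so division
    with remainder applies to them.\<close>
  define E where "E w a \<longleftrightarrow> w \<in> carrier W \<and> (\<forall>x \<in> carrier L. act w x = x [^]\<^bsub>L\<^esub> (p ^ a))" for w a
  have ex: "\<exists>a. E w a" if "w \<in> carrier W" for w
    using ring_endomorphism_prime_power[OF finite_field p char act_ring_hom[OF that]] that E_def by auto
  have one: "w = \<one>\<^bsub>W\<^esub>" if "E w 0" for w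
    using that by (intro faithful) (auto simp: E_def act_id)
  have mult: "E (v \<otimes>\<^bsub>W\<^esub> w) (a + b)" if "E v a" "E w b" for v w a b
    using that unfolding E_def by (auto simp: act_comp L.nat_pow_pow act_in power_add mult.commute)
  have pw: "E (v [^]\<^bsub>W\<^esub> c) (a * c)" if "E v a" for v a and c :: nat
  proof (induction c)
    case 0
    then show ?case by (auto simp: E_def act_id)
  next
    case (Suc c)
    then show ?case using mult[OF Suc that] by (simp add: add.commute)
  qed
  \<comment> \<open>From x^(p^(a+d)) = v (x^(p^d)) the inverse of v strips off the exponent
    a.\<close>
  have diff: "E (inv\<^bsub>W\<^esub> v \<otimes>\<^bsub>W\<^esub> w) d" if "E v a" "E w (a + d)" for v w a d
  proof -
    have vw: "v \<in> carrier W" "w \<in> carrier W" using that by (auto simp: E_def)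
    have "act (inv\<^bsub>W\<^esub> v \<otimes>\<^bsub>W\<^esub> w) x = x [^]\<^bsub>L\<^esub> (p ^ d)" if x: "x \<in> carrier L" for x
    proof -
      have "act w x = act v (x [^]\<^bsub>L\<^esub> (p ^ d))"
        using \<open>E v a\<close> \<open>E w (a + d)\<close> x by (simp add: E_def L.nat_pow_pow power_add mult.commute)
      then show ?thesis using vw x by (simp add: act_comp act_inv)
    qed
    then show ?thesis using vw by (simp add: E_def)
  qed
  show ?thesis
  proof (cases "\<exists>a>0. \<exists>w. E w a")
    case True
    define a where "a = (LEAST a. 0 < a \<and> (\<exists>w. E w a))"
    have a: "0 < a" "\<exists>w. E w a" using LeastI_ex[OF True] by (auto simp: a_def)
    have least: "d = 0" if "d < a" "E w d" for w d
      using not_less_Least[of d "\<lambda>a. 0 < a \<and> (\<exists>w. E w a)"] that by (auto simp: a_def)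
    obtain t where t: "E t a" using a by blast
    have tW: "t \<in> carrier W" using t by (simp add: E_def)
    have "w \<in> range (\<lambda>i::nat. t [^]\<^bsub>W\<^esub> i)" if w: "w \<in> carrier W" for w
    proof -
      obtain b where b: "E w b" using ex[OF w] by blast
      \<comment> \<open>Dividing w by a power of t leaves the exponent \<open>b mod a\<close>, which
        is below the least positive one and hence 0. So the quotient is the identity.\<close>
      let ?v = "inv\<^bsub>W\<^esub> (t [^]\<^bsub>W\<^esub> (b div a)) \<otimes>\<^bsub>W\<^esub> w"
      have "E ?v (b mod a)" using diff[OF pw[OF t, of "b div a"], of w "b mod a"] b by simp
      moreover have "b mod a < a" using a by simp
      ultimately have "?v = \<one>\<^bsub>W\<^esub>" using least one by metis
      then have "w = t [^]\<^bsub>W\<^esub> (b div a)" using tW w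
        by (metis W.inv_closed W.inv_equality W.inv_inv W.nat_pow_closed W.inv_comm)
      then show ?thesis by blast
    qed
    then show ?thesis using tW by (intro bexI[of _ t]) auto
  next
    case False
    \<comment> \<open>No positive exponent occurs, so every element has exponent 0 and is the
      identity.\<close>
    then have "w = \<one>\<^bsub>W\<^esub>" if "w \<in> carrier W" for w using ex[OF that] one by (metis gr0I)
    then show ?thesis by (intro bexI[of _ "\<one>\<^bsub>W\<^esub>"]) auto
  qed
qed

end

section \<open>Cohomology of finite cyclic groups\<close>

text \<open>Hilbert 90 is made an assumption on the module: from it and the finiteness of A both
  vanishing theorems follow by pure group theory. It is written without division; b a = t(a) says b
  = t(a)/a.\<close>

locale finite_cyclic_module = W: group W + A?: comm_group A
  for W :: "('w, 'm) monoid_scheme" and A :: "('a, 'n) monoid_scheme" (structure) +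
  fixes act :: "'w \<Rightarrow> 'a \<Rightarrow> 'a" and t :: 'w
  assumes finite_W: "finite (carrier W)"
    and finite_A: "finite (carrier A)"
    and t_in: "t \<in> carrier W"
    and generated: "carrier W = range (\<lambda>i::nat. t [^]\<^bsub>W\<^esub> i)"
    and act_closed [simp]: "\<lbrakk>w \<in> carrier W; a \<in> carrier A\<rbrakk> \<Longrightarrow> act w a \<in> carrier A"
    and act_mult: "\<lbrakk>w \<in> carrier W; a \<in> carrier A; b \<in> carrier A\<rbrakk>
      \<Longrightarrow> act w (a \<otimes> b) = act w a \<otimes> act w b"
    and act_comp: "\<lbrakk>v \<in> carrier W; w \<in> carrier W; a \<in> carrier A\<rbrakk>
      \<Longrightarrow> act (v \<otimes>\<^bsub>W\<^esub> w) a = act v (act w a)"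
    and act_id: "a \<in> carrier A \<Longrightarrow> act \<one>\<^bsub>W\<^esub> a = a"
    and hilbert90: "\<lbrakk>b \<in> carrier A; (\<Otimes>i\<in>{..<W.ord t}. act (t [^]\<^bsub>W\<^esub> i) b) = \<one>\<rbrakk>
      \<Longrightarrow> \<exists>a \<in> carrier A. b \<otimes> a = act t a"
begin

abbreviation pw :: "nat \<Rightarrow> 'w" where "pw i \<equiv> t [^]\<^bsub>W\<^esub> i"

lemma pw_in [simp]: "pw i \<in> carrier W"
  using t_in by simp

lemma pw_Suc: "pw (Suc i) = pw i \<otimes>\<^bsub>W\<^esub> t" "pw (Suc i) = t \<otimes>\<^bsub>W\<^esub> pw i"
  using t_in W.nat_pow_Suc2 by simp_all

declare Group.nat_pow_Suc [simp del] W.nat_pow_Suc [simp del]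

lemma pw_ord: "pw (W.ord t) = \<one>\<^bsub>W\<^esub>"
  using t_in by simp

lemma pw_mod: "pw (i mod W.ord t) = pw i"
proof -
  have "pw i = pw (W.ord t * (i div W.ord t)) \<otimes>\<^bsub>W\<^esub> pw (i mod W.ord t)"
    using t_in by (simp add: W.nat_pow_mult)
  also have "pw (W.ord t * (i div W.ord t)) = \<one>\<^bsub>W\<^esub>"
    using t_in by (simp flip: W.nat_pow_pow)
  finally show ?thesis by simp
qed

lemma pw_eqD: "pw i = pw j \<Longrightarrow> i mod W.ord t = j mod W.ord t"
  using W.int_pow_eq[OF t_in, of "int i" "int j"]
  by (simp add: int_pow_int dvd_diff_commute flip: mod_eq_dvd_iff zmod_int)

lemma act_one: "w \<in> carrier W \<Longrightarrow> act w \<one> = \<one>"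
  using act_mult[of w \<one> \<one>] by (simp add: l_cancel_one')

lemma act_inv: "\<lbrakk>w \<in> carrier W; a \<in> carrier A\<rbrakk> \<Longrightarrow> act w (inv a) = inv (act w a)"
  using act_mult[of w a "inv a"] by (simp add: act_one inv_char[symmetric] inv_equality m_comm)

lemma act_finprod:
  assumes "w \<in> carrier W" and "f \<in> I \<rightarrow> carrier A"
  shows "act w (\<Otimes>i\<in>I. f i) = (\<Otimes>i\<in>I. act w (f i))"
  using assms(2)
proof (induction I rule: infinite_finite_induct)
  case (insert i I)
  then have "act w (\<Otimes>i\<in>insert i I. f i) = act w (f i) \<otimes> act w (\<Otimes>i\<in>I. f i)"
    using assms(1) by (simp add: act_mult finprod_closed Pi_iff)
  also have "\<dots> = (\<Otimes>i\<in>insert i I. act w (f i))"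
    using insert assms(1) by (subst finprod_insert) (auto simp: Pi_iff)
  finally show ?case .
qed (use assms(1) in \<open>simp_all add: act_one\<close>)

lemma finprod_lessThan_Suc:
  "f \<in> {..n} \<rightarrow> carrier A \<Longrightarrow> (\<Otimes>i\<in>{..<Suc n}. f i) = (\<Otimes>i\<in>{..<n}. f i) \<otimes> f n"
  by (subst lessThan_Suc, subst finprod_insert) (auto intro!: m_comm finprod_closed)

text \<open>Both sides are the product of f 0, ..., f n. If f n = f 0, cancelling shows that a
  product over one period does not change under a shift of the index.\<close>

lemma finprod_lessThan_shift:
  "f \<in> {..n} \<rightarrow> carrier A \<Longrightarrow> (\<Otimes>i\<in>{..<n}. f (Suc i)) \<otimes> f 0 = (\<Otimes>i\<in>{..<n}. f i) \<otimes> f n"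
proof (induction n)
  case (Suc n)
  then have c: "f i \<in> carrier A" if "i \<le> Suc n" for i using that by auto
  have d: "(\<Otimes>i\<in>{..<n}. f (Suc i)) \<in> carrier A" "(\<Otimes>i\<in>{..<n}. f i) \<in> carrier A"
    using c by (auto intro!: finprod_closed)
  have "(\<Otimes>i\<in>{..<Suc n}. f (Suc i)) \<otimes> f 0 = ((\<Otimes>i\<in>{..<n}. f (Suc i)) \<otimes> f 0) \<otimes> f (Suc n)"
    using c d by (subst finprod_lessThan_Suc) (auto simp: m_ac)
  also have "(\<Otimes>i\<in>{..<n}. f (Suc i)) \<otimes> f 0 = (\<Otimes>i\<in>{..<Suc n}. f i)"
    using Suc c by (subst finprod_lessThan_Suc) auto
  finally show ?case .
qed simp

definition norm :: "'a \<Rightarrow> 'a" where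
  "norm b = (\<Otimes>i\<in>{..<W.ord t}. act (pw i) b)"

lemma norm_closed: "b \<in> carrier A \<Longrightarrow> norm b \<in> carrier A"
  unfolding norm_def by (auto intro!: finprod_closed)

text \<open>The generator t permutes the factors of the norm cyclically, since t to its order is the
  identity.\<close>

lemma act_norm:
  assumes b: "b \<in> carrier A"
  shows "act t (norm b) = norm b"
proof -
  have "act t (norm b) = (\<Otimes>i\<in>{..<W.ord t}. act (pw (Suc i)) b)"
    unfolding norm_def using b t_in
    by (subst act_finprod) (auto simp: pw_Suc(2) act_comp)
  then have "act t (norm b) \<otimes> act (pw 0) b = norm b \<otimes> act (pw (W.ord t)) b"
    unfolding norm_def using finprod_lessThan_shift[of "\<lambda>i. act (pw i) b" "W.ord t"] b by auto
  then show ?thesis using b norm_closed[OF b] t_in by (simp add: act_id)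
qed

text \<open>Both the norm and \<open>a \<mapsto> t a / a\<close> are endomorphisms of the finite group \<open>A\<close>.  By Hilbert 90 the
  kernel of the first lies in the image of the second, so by counting the image of the
  first is at least as large as the kernel of the second, in which it is contained.\<close>

lemma norm_surj:
  assumes "a \<in> carrier A" and "act t a = a"
  shows "\<exists>b \<in> carrier A. norm b = a"
proof -
  define D where "D a = act t a \<otimes> inv a" for a
  have Dh: "D \<in> hom A A"
    using t_in by (auto simp: hom_def D_def act_mult inv_mult m_ac)
  have Nh: "norm \<in> hom A A"
    by (auto simp: hom_def norm_closed norm_def act_mult finprod_multf Pi_iff)
  interpret D: group_hom A A D by unfold_locales (rule Dh)
  interpret N: group_hom A A norm by unfold_locales (rule Nh)
  \<comment> \<open>First isomorphism theorem combined with Lagrange.\<close>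
  have cnt: "card (kernel A A \<phi>) * card (\<phi> ` carrier A) = card (carrier A)" if "group_hom A A \<phi>" for \<phi>
  proof -
    interpret h: group_hom A A \<phi> by fact
    interpret I: group "A\<lparr>carrier := \<phi> ` carrier A\<rparr>"
      using subgroup.subgroup_is_group[OF h.img_is_subgroup group_axioms] .
    interpret h': group_hom A "A\<lparr>carrier := \<phi> ` carrier A\<rparr>" \<phi>
      by unfold_locales (auto simp: hom_def)
    have "A Mod kernel A A \<phi> \<cong> A\<lparr>carrier := \<phi> ` carrier A\<rparr>"
      using h'.FactGroup_iso by (simp add: kernel_def)
    then have "card (rcosets (kernel A A \<phi>)) = card (\<phi> ` carrier A)"
      by (auto simp: is_iso_def iso_def FactGroup_def dest: bij_betw_same_card)
    then show ?thesis using lagrange[OF h.subgroup_kernel] by (simp add: order_def mult.commute)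
  qed
  have "kernel A A norm \<subseteq> D ` carrier A"
  proof
    fix b assume b: "b \<in> kernel A A norm"
    then obtain a where a: "a \<in> carrier A" "b \<otimes> a = act t a"
      using hilbert90[of b] by (auto simp: kernel_def norm_def)
    then have "b = D a" using b by (simp add: D_def kernel_def inv_solve_right' flip: a(2)) (simp add: m_assoc)
    then show "b \<in> D ` carrier A" using a by blast
  qed
  then have "card (kernel A A norm) \<le> card (D ` carrier A)"
    using finite_A by (intro card_mono) auto
  moreover have k: "card (kernel A A norm) * card (norm ` carrier A) = card (carrier A)"
    "card (kernel A A D) * card (D ` carrier A) = card (carrier A)"
    using cnt N.group_hom_axioms D.group_hom_axioms by blast+
  ultimately have le: "card (kernel A A D) \<le> card (norm ` carrier A)"
    using finite_A
    by (metis card_gt_0_iff carrier_not_empty mult.commute mult_le_mono1 mult_le_cancel1 nat_0_less_mult_iff)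
  have "norm ` carrier A \<subseteq> kernel A A D"
    using act_norm norm_closed by (auto simp: kernel_def D_def)
  then have "norm ` carrier A = kernel A A D"
    using le finite_A by (intro card_seteq) (auto simp: kernel_def)
  moreover have "a \<in> kernel A A D" using assms by (simp add: kernel_def D_def)
  ultimately have "a \<in> norm ` carrier A" by simp
  then show ?thesis by auto
qed

text \<open>The crossed homomorphism f takes the value f(t) t(f t) ... t^(n-1)(f t) at t^n. For n
  the order of t this is f(1) = 1, so f t has norm 1 and Hilbert 90 supplies a with f t = t(a)/a.
  The values at the powers of t follow from the one at t.\<close>

lemma H1_trivial:
  assumes f: "f \<in> carrier W \<rightarrow> carrier A"
    and cocycle: "\<And>v w. \<lbrakk>v \<in> carrier W; w \<in> carrier W\<rbrakk> \<Longrightarrow> f (v \<otimes>\<^bsub>W\<^esub> w) = f v \<otimes> act v (f w)"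
  shows "\<exists>a \<in> carrier A. \<forall>w \<in> carrier W. f w \<otimes> a = act w a"
proof -
  have fc: "f w \<in> carrier A" if "w \<in> carrier W" for w using f that by auto
  have f1: "f \<one>\<^bsub>W\<^esub> = \<one>"
    using cocycle[of "\<one>\<^bsub>W\<^esub>" "\<one>\<^bsub>W\<^esub>"] fc[of "\<one>\<^bsub>W\<^esub>"] by (simp add: act_id l_cancel_one')
  have "(\<Otimes>i\<in>{..<n}. act (pw i) (f t)) = f (pw n)" for n
  proof (induction n)
    case (Suc n)
    then show ?case
      using fc t_in cocycle[of "pw n" t] by (subst finprod_lessThan_Suc) (auto simp: pw_Suc(1))
  qed (simp add: f1)
  then have "(\<Otimes>i\<in>{..<W.ord t}. act (pw i) (f t)) = \<one>" by (simp add: pw_ord f1)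
  then obtain a where a: "a \<in> carrier A" "f t \<otimes> a = act t a"
    using hilbert90 fc t_in by blast
  have "f (pw n) \<otimes> a = act (pw n) a" for n
  proof (induction n)
    case (Suc n)
    have "f (pw (Suc n)) \<otimes> a = act (pw n) (f t) \<otimes> (f (pw n) \<otimes> a)"
      using a fc t_in cocycle[of "pw n" t] by (simp add: m_ac pw_Suc(1))
    also have "\<dots> = act (pw n) (f t \<otimes> a)"
      unfolding Suc using a(1) fc t_in by (subst act_mult) auto
    also have "\<dots> = act (pw (Suc n)) a" unfolding a(2) using a(1) t_in by (simp add: pw_Suc(1) act_comp)
    finally show ?case .
  qed (use a in \<open>simp add: f1 act_id\<close>)
  then show ?thesis using a(1) generated by auto
qed

text \<open>A trivialising cochain \<open>h\<close> is determined by \<open>b = h t\<close> through the equations for the pairs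
  \<open>(t\<^sup>n, t)\<close>; it is well defined on \<open>W\<close> exactly if \<open>b\<close> has norm \<open>\<Prod> f (t\<^sup>i, t)\<close>.\<close>

lemma H2_trivial:
  assumes f: "\<And>v w. \<lbrakk>v \<in> carrier W; w \<in> carrier W\<rbrakk> \<Longrightarrow> f v w \<in> carrier A"
    and cocycle: "\<And>u v w. \<lbrakk>u \<in> carrier W; v \<in> carrier W; w \<in> carrier W\<rbrakk>
      \<Longrightarrow> act u (f v w) \<otimes> f u (v \<otimes>\<^bsub>W\<^esub> w) = f (u \<otimes>\<^bsub>W\<^esub> v) w \<otimes> f u v"
  shows "\<exists>h \<in> carrier W \<rightarrow> carrier A. \<forall>v \<in> carrier W. \<forall>w \<in> carrier W.
    f v w \<otimes> h (v \<otimes>\<^bsub>W\<^esub> w) = act v (h w) \<otimes> h v"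
proof -
  let ?m = "W.ord t"
  \<comment> \<open>The norm that h(t) must have. To obtain such an element from
    \<open>norm_surj\<close>, a has to be fixed by t.\<close>
  define a where "a = (\<Otimes>i\<in>{..<?m}. f (pw i) t)"
  have a: "a \<in> carrier A" unfolding a_def using f t_in by (auto intro!: finprod_closed)
  \<comment> \<open>The cocycle identity at (t, t^i, t), multiplied over i < n; the values f(t, t^i)
    telescope. For n the order of t the two remaining values coincide, so t(a) is the product of the
    f(t^(i+1), t), which is a again by a cyclic shift.\<close>
  have p1: "(\<Otimes>i\<in>{..<n}. act t (f (pw i) t)) \<otimes> f t (pw n)
      = (\<Otimes>i\<in>{..<n}. f (pw (Suc i)) t) \<otimes> f t (pw 0)" for n
  proof (induction n)
    case (Suc n)
    have c: "(\<Otimes>i\<in>{..<n}. act t (f (pw i) t)) \<in> carrier A" "(\<Otimes>i\<in>{..<n}. f (pw (Suc i)) t) \<in> carrier A"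
      "f t (pw n) \<in> carrier A" "f t (pw 0) \<in> carrier A" "f t (pw (Suc n)) \<in> carrier A"
      "f (pw (Suc n)) t \<in> carrier A" "act t (f (pw n) t) \<in> carrier A"
      using f t_in pw_in[of "Suc n"] pw_in[of "Suc _"] by (auto intro!: finprod_closed)
    have co: "act t (f (pw n) t) \<otimes> f t (pw (Suc n)) = f (pw (Suc n)) t \<otimes> f t (pw n)"
      using cocycle[of t "pw n" t] pw_in by (simp only: t_in flip: pw_Suc)
    have "(\<Otimes>i\<in>{..<Suc n}. act t (f (pw i) t)) \<otimes> f t (pw (Suc n))
        = (\<Otimes>i\<in>{..<n}. act t (f (pw i) t)) \<otimes> (act t (f (pw n) t) \<otimes> f t (pw (Suc n)))"
      using f t_in c by (subst finprod_lessThan_Suc) (auto simp: m_assoc)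
    also have "\<dots> = f (pw (Suc n)) t \<otimes> ((\<Otimes>i\<in>{..<n}. act t (f (pw i) t)) \<otimes> f t (pw n))"
      unfolding co using c by (simp only: m_ac)
    also have "\<dots> = (\<Otimes>i\<in>{..<Suc n}. f (pw (Suc i)) t) \<otimes> f t (pw 0)"
      unfolding Suc using c f t_in pw_in
      by (subst finprod_lessThan_Suc) (auto simp: m_ac simp del: W.nat_pow_0)
    finally show ?case .
  qed (simp add: f t_in)
  have "act t a = (\<Otimes>i\<in>{..<?m}. f (pw (Suc i)) t)"
  proof -
    have c: "f t \<one>\<^bsub>W\<^esub> \<in> carrier A" "(\<Otimes>i\<in>{..<?m}. f (pw (Suc i)) t) \<in> carrier A"
      using f t_in pw_in by (auto intro!: finprod_closed)
    have "act t a = (\<Otimes>i\<in>{..<?m}. act t (f (pw i) t))"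
      unfolding a_def using f t_in by (intro act_finprod) auto
    then show ?thesis using p1[of ?m] c act_closed[OF t_in a] by (simp add: pw_ord)
  qed
  moreover have "(\<Otimes>i\<in>{..<?m}. f (pw (Suc i)) t) = a"
  proof -
    have c: "f \<one>\<^bsub>W\<^esub> t \<in> carrier A" "(\<Otimes>i\<in>{..<?m}. f (pw (Suc i)) t) \<in> carrier A"
      using f t_in pw_in by (auto intro!: finprod_closed)
    show ?thesis
      using finprod_lessThan_shift[of "\<lambda>i. f (pw i) t" ?m] c a f t_in
      unfolding a_def[symmetric] by (simp add: pw_ord)
  qed
  ultimately obtain b where b: "b \<in> carrier A" "norm b = a" using norm_surj[OF a] by auto
  \<comment> \<open>The equation for the pair (t^i, t) gives the ratio of h(t^(i+1)) to h(t^i); this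
    is q i. The starting value f(1, 1) in \<open>H\<close> is forced by the equation for (1, 1),
    which reads f(1,1) h(1) = h(1) h(1).\<close>
  define q where "q i = act (pw i) b \<otimes> inv (f (pw i) t)" for i
  define H where "H n = f \<one>\<^bsub>W\<^esub> \<one>\<^bsub>W\<^esub> \<otimes> (\<Otimes>i\<in>{..<n}. q i)" for n
  have q: "q i \<in> carrier A" for i unfolding q_def using b f t_in by auto
  have H: "H n \<in> carrier A" for n unfolding H_def using q f by (auto intro!: finprod_closed)
  have HSuc: "H (Suc n) = H n \<otimes> q n" for n
    unfolding H_def using q f by (subst finprod_lessThan_Suc) (auto simp: m_assoc finprod_closed)
  have "(\<Otimes>i\<in>{..<?m}. q i) \<otimes> a = norm b"
    unfolding q_def a_def norm_def using b f t_in by (subst finprod_multf[symmetric]) (auto simp: m_assoc)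
  \<comment> \<open>The choice norm b = a pays off: the ratios multiply to 1 over a full period, so
    \<open>H\<close> depends on n only modulo the order of t.\<close>
  then have qm: "(\<Otimes>i\<in>{..<?m}. q i) = \<one>"
    using a b q by (metis finprod_closed l_cancel_one' m_comm Pi_I)
  have per: "H (n + ?m) = H n" for n
  proof (induction n)
    case 0
    then show ?case by (simp add: H_def qm)
  next
    case (Suc n)
    have "pw (n + ?m) = pw n" using pw_mod[of "n + ?m"] pw_mod[of n] by simp
    then have "q (n + ?m) = q n" by (simp add: q_def)
    then show ?case using Suc HSuc[of n] HSuc[of "n + ?m"] by simp
  qed
  have per': "H (n + k * ?m) = H n" for n k
  proof (induction k)
    case (Suc k)
    then show ?case using per[of "n + k * ?m"] by (simp add: add.assoc add.commute[of ?m])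
  qed simp
  have Hmod: "H (n mod ?m) = H n" for n
    using per'[of "n mod ?m" "n div ?m"] by (simp only: mod_div_mult_eq)
  \<comment> \<open>Any exponent representing w serves, by the periodicity of
    \<open>H\<close>.\<close>
  define h where "h w = H (SOME i. pw i = w)" for w
  have hp: "h (pw i) = H i" for i
    using someI[of "\<lambda>j. pw j = pw i" i] pw_eqD Hmod unfolding h_def by metis
  have hc: "h w \<in> carrier A" for w unfolding h_def by (rule H)
  have f1: "f \<one>\<^bsub>W\<^esub> t = f \<one>\<^bsub>W\<^esub> \<one>\<^bsub>W\<^esub>"
    using cocycle[of "\<one>\<^bsub>W\<^esub>" "\<one>\<^bsub>W\<^esub>" t] f t_in by (simp add: act_id)
  have "H 1 = f \<one>\<^bsub>W\<^esub> \<one>\<^bsub>W\<^esub> \<otimes> (b \<otimes> inv (f \<one>\<^bsub>W\<^esub> t))"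
    using HSuc[of 0] f b by (simp add: H_def q_def act_id)
  also have "\<dots> = b" using f b by (simp add: f1 m_lcomm)
  finally have ht: "h t = b" using hp[of 1] t_in by (simp add: pw_Suc(1))
  have h1: "h \<one>\<^bsub>W\<^esub> = f \<one>\<^bsub>W\<^esub> \<one>\<^bsub>W\<^esub>" using hp[of 0] f by (simp add: H_def)
  have I1: "f (pw j) t \<otimes> h (pw (Suc j)) = act (pw j) b \<otimes> h (pw j)" for j
    unfolding hp HSuc q_def using f t_in b H[of j] by (simp add: m_ac)
  have I2: "f v t \<otimes> h (v \<otimes>\<^bsub>W\<^esub> t) = act v b \<otimes> h v" if "v \<in> carrier W" for v
    using that I1 generated by (auto simp: pw_Suc(1))
  \<comment> \<open>The equations for second argument t extend to all powers by induction on j,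
    through the cocycle identity at (v, t^j, t). At j = 0 the identity at (v, 1, 1) gives f(v, 1) =
    v(f(1, 1)).\<close>
  have "f v (pw j) \<otimes> h (v \<otimes>\<^bsub>W\<^esub> pw j) = act v (h (pw j)) \<otimes> h v" if v: "v \<in> carrier W" for v j
  proof (induction j)
    case 0
    have "f v \<one>\<^bsub>W\<^esub> = act v (f \<one>\<^bsub>W\<^esub> \<one>\<^bsub>W\<^esub>)"
      using cocycle[of v "\<one>\<^bsub>W\<^esub>" "\<one>\<^bsub>W\<^esub>"] f v by simp
    then show ?case using v hc by (simp add: h1)
  next
    case (Suc j)
    let ?vj = "v \<otimes>\<^bsub>W\<^esub> pw j" and ?vs = "v \<otimes>\<^bsub>W\<^esub> pw (Suc j)"
    have vs: "?vs = ?vj \<otimes>\<^bsub>W\<^esub> t" "?vj \<in> carrier W" using v t_in by (auto simp: W.m_assoc pw_Suc(1))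
    have c: "act v (f (pw j) t) \<in> carrier A" "f v (pw (Suc j)) \<in> carrier A" "f ?vj t \<in> carrier A"
      "f v (pw j) \<in> carrier A" "act v (act (pw j) b) \<in> carrier A" "act v (h (pw j)) \<in> carrier A"
      "act v (h (pw (Suc j))) \<in> carrier A" "h v \<in> carrier A" "h ?vs \<in> carrier A" "h ?vj \<in> carrier A"
      using f v b t_in hc vs pw_in by (auto)
    have "act v (f (pw j) t) \<otimes> (f v (pw (Suc j)) \<otimes> h ?vs)
        = (act v (f (pw j) t) \<otimes> f v (pw (Suc j))) \<otimes> h ?vs"
      using c by (simp only: m_assoc)
    also have "act v (f (pw j) t) \<otimes> f v (pw (Suc j)) = f ?vj t \<otimes> f v (pw j)"
      using cocycle[OF v pw_in t_in, of j] by (simp add: pw_Suc(1))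
    also have "\<dots> \<otimes> h ?vs = (f ?vj t \<otimes> h ?vs) \<otimes> f v (pw j)" using c by (simp only: m_ac m_closed)
    also have "f ?vj t \<otimes> h ?vs = act v (act (pw j) b) \<otimes> h ?vj"
      using I2[OF vs(2)] v b vs(1) by (simp only: act_comp pw_in)
    also have "\<dots> \<otimes> f v (pw j) = act v (act (pw j) b) \<otimes> (f v (pw j) \<otimes> h ?vj)"
      using c by (simp only: m_ac m_closed)
    also have "\<dots> = (act v (act (pw j) b) \<otimes> act v (h (pw j))) \<otimes> h v"
      unfolding Suc using c by (simp only: m_assoc)
    also have "act v (act (pw j) b) \<otimes> act v (h (pw j)) = act v (f (pw j) t) \<otimes> act v (h (pw (Suc j)))"
      using I1[of j] v b hc f t_in pw_in by (simp add: act_mult[symmetric])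
    finally show ?case using c by (simp add: m_assoc)
  qed
  then show ?thesis using hc generated by (intro bexI[of _ h]) auto
qed

end

section \<open>Hilbert 90\<close>

context finite_field_action
begin

lemma act_Units: "\<lbrakk>w \<in> carrier W; a \<in> Units L\<rbrakk> \<Longrightarrow> act w a \<in> Units L"
  by (rule galois_units_closed[OF L.ring_axioms act_ring_hom])

text \<open>The Lagrange resolvent y = sum of B_i t^i(x), with B_n the product of the t^i(b) for i <
  n, satisfies b t(y) = y: multiplying t of a term by b yields the next term, and norm 1 closes the
  cycle. By independence of characters y is nonzero for some x, and a is the inverse of y.\<close>

lemma hilbert90:
  assumes t: "t \<in> carrier W" and finite_W: "finite (carrier W)" and b: "b \<in> Units L"
    and norm: "(\<Otimes>\<^bsub>units_of L\<^esub>i\<in>{..<W.ord t}. act (t [^]\<^bsub>W\<^esub> i) b) = \<one>\<^bsub>units_of L\<^esub>"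
  shows "\<exists>a \<in> Units L. b \<otimes>\<^bsub>L\<^esub> a = act t a"
proof -
  interpret U: comm_group "units_of L" by (rule units_comm_group)
  interpret t: ring_hom_cring L L "act t" by unfold_locales (rule act_ring_hom[OF t])
  have UL: "carrier (units_of L) = Units L" "a \<otimes>\<^bsub>units_of L\<^esub> c = a \<otimes>\<^bsub>L\<^esub> c" "\<one>\<^bsub>units_of L\<^esub> = \<one>\<^bsub>L\<^esub>" for a c
    by (simp_all add: units_of_def)
  let ?m = "W.ord t" and ?s = "\<lambda>i::nat. act (t [^]\<^bsub>W\<^esub> i)"
  define B where "B n = (\<Otimes>\<^bsub>units_of L\<^esub>i\<in>{..<n}. ?s i b)" for n :: nat
  have m: "0 < ?m" using W.ord_ge_1[OF finite_W t] by simp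
  have s: "?s i x \<in> Units L" if "x \<in> Units L" for i x using act_Units that t by simp
  have sL: "?s i x \<in> carrier L" if "x \<in> carrier L" for i x using act_in that t by simp
  have BU: "B n \<in> Units L" for n
    using U.finprod_closed[of "\<lambda>i. ?s i b" "{..<n}"] s[OF b] by (simp add: B_def UL)
  have sS: "?s (Suc i) x = act t (?s i x)" if "x \<in> carrier L" for i x
    using t that W.nat_pow_Suc2[OF t, of i] by (simp add: act_comp)
  have B0: "B 0 = \<one>\<^bsub>L\<^esub>" by (simp add: B_def UL)
  have ins: "B (Suc n) = ?s n b \<otimes>\<^bsub>L\<^esub> B n" for n
    unfolding B_def lessThan_Suc using s[OF b] by (subst U.finprod_insert) (auto simp: UL)
  have BS: "B (Suc n) = b \<otimes>\<^bsub>L\<^esub> act t (B n)" for n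
  proof (induction n)
    case 0
    then show ?case using Units_closed[OF b] by (simp add: ins B0 act_id)
  next
    case (Suc n)
    have "B (Suc (Suc n)) = ?s (Suc n) b \<otimes>\<^bsub>L\<^esub> (b \<otimes>\<^bsub>L\<^esub> act t (B n))" using ins[of "Suc n"] Suc by simp
    also have "\<dots> = b \<otimes>\<^bsub>L\<^esub> act t (?s n b \<otimes>\<^bsub>L\<^esub> B n)"
      using Units_closed[OF b] Units_closed[OF BU[of n]] sL[of b n]
      by (simp only: sS t.hom_mult m_lcomm t.hom_closed)
    finally show ?case by (simp only: ins)
  qed
  have Bm: "B ?m = \<one>\<^bsub>L\<^esub>" using norm by (simp add: B_def units_of_def)
  have BL: "B n \<in> carrier L" for n using BU by (rule Units_closed)
  have bL: "b \<in> carrier L" using b by (rule Units_closed)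
  \<comment> \<open>The powers of t below its order are distinct characters of the unit group, so a
    vanishing resolvent would force all coefficients to be 0, although B_0 = 1.\<close>
  have "\<not> (\<forall>x \<in> Units L. (\<Oplus>\<^bsub>L\<^esub>i\<in>{..<?m}. B i \<otimes>\<^bsub>L\<^esub> ?s i x) = \<zero>\<^bsub>L\<^esub>)"
  proof
    assume z: "\<forall>x \<in> Units L. (\<Oplus>\<^bsub>L\<^esub>i\<in>{..<?m}. B i \<otimes>\<^bsub>L\<^esub> ?s i x) = \<zero>\<^bsub>L\<^esub>"
    have "B 0 = \<zero>\<^bsub>L\<^esub>"
    proof (rule dedekind_independence[where M = "units_of L" and I = "{..<?m}" and \<chi> = ?s])
      show "?s i \<in> hom (units_of L) (Multiplicative_Group.mult_of L)" for i
        using s[of _ i] ring_hom_memE(2)[OF act_ring_hom, of "t [^]\<^bsub>W\<^esub> i"] t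
        by (auto simp: hom_def UL field_Units)
      show "\<exists>x\<in>carrier (units_of L). ?s i x \<noteq> ?s j x" if ij: "i \<in> {..<?m}" "j \<in> {..<?m}" "i \<noteq> j" for i j
      proof (rule ccontr)
        assume a: "\<not> ?thesis"
        have "t [^]\<^bsub>W\<^esub> i = t [^]\<^bsub>W\<^esub> j"
        proof (rule faithful)
          fix x assume x: "x \<in> carrier L"
          \<comment> \<open>Faithfulness compares automorphisms on all of L, characters only on the
            units; at 0 both sides are 0.\<close>
          have z: "?s i \<zero>\<^bsub>L\<^esub> = \<zero>\<^bsub>L\<^esub>" for i
            using t by (intro ring_hom_zero[OF act_ring_hom]) (auto intro: L.ring_axioms)
          show "?s i x = ?s j x"
            using a x z[of i] z[of j] by (cases "x = \<zero>\<^bsub>L\<^esub>") (auto simp: UL field_Units)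
        qed (use t in auto)
        then have "i = j"
          using W.ord_inj[OF t] ij by (auto simp: inj_on_def)
        then show False using ij by simp
      qed
    qed (use z BL m in \<open>auto simp: UL U.monoid_axioms\<close>)
    then show False using B0 by simp
  qed
  then obtain x where x: "x \<in> Units L" and nz: "(\<Oplus>\<^bsub>L\<^esub>i\<in>{..<?m}. B i \<otimes>\<^bsub>L\<^esub> ?s i x) \<noteq> \<zero>\<^bsub>L\<^esub>" by blast
  have xL: "x \<in> carrier L" using x by (rule Units_closed)
  let ?T = "\<lambda>i. B i \<otimes>\<^bsub>L\<^esub> ?s i x"
  have T: "?T i \<in> carrier L" for i using BL sL xL by simp
  define y where "y = (\<Oplus>\<^bsub>L\<^esub>i\<in>{..<?m}. ?T i)"
  have y: "y \<in> carrier L" "y \<in> Units L"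
    using T nz by (auto simp: y_def field_Units intro!: finsum_closed)
  have TS: "b \<otimes>\<^bsub>L\<^esub> act t (?T i) = ?T (Suc i)" for i
    using bL BL sL[OF xL] by (simp only: BS sS[OF xL] t.hom_mult m_assoc t.hom_closed)
  have "b \<otimes>\<^bsub>L\<^esub> act t y = (\<Oplus>\<^bsub>L\<^esub>i\<in>{..<?m}. ?T (Suc i))"
    unfolding y_def TS[symmetric] using T bL
    by (subst t.hom_finsum) (auto simp: finsum_rdistr simp del: t.hom_mult)
  also have "\<dots> = y"
  proof -
    obtain n where n: "?m = Suc n" using m gr0_conv_Suc by blast
    \<comment> \<open>Here norm 1 is used: B_m = 1 = B_0 for m the order of t. So shifting the index
      permutes the terms of the sum cyclically.\<close>
    have "?T (Suc n) = ?T 0" unfolding n[symmetric] using t xL by (simp add: Bm B0)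
    then have "(\<Oplus>\<^bsub>L\<^esub>i\<in>{..n}. ?T (Suc i)) = (\<Oplus>\<^bsub>L\<^esub>i\<in>{..n}. ?T i)"
      using T finsum_Suc2[of ?T n] finsum_Suc[of ?T n]
      by (metis (no_types, lifting) Pi_I a_comm add.l_cancel finsum_closed)
    then show ?thesis unfolding y_def n lessThan_Suc_atMost .
  qed
  finally have e: "b \<otimes>\<^bsub>L\<^esub> act t y = y" .
  have iy: "inv\<^bsub>L\<^esub> y \<in> Units L" "inv\<^bsub>L\<^esub> y \<in> carrier L" using y by auto
  \<comment> \<open>Inverting y exchanges the two sides: b t(y) = y becomes b y^(-1) =
    t(y^(-1)).\<close>
  have "act t (inv\<^bsub>L\<^esub> y) = (b \<otimes>\<^bsub>L\<^esub> act t y) \<otimes>\<^bsub>L\<^esub> inv\<^bsub>L\<^esub> y \<otimes>\<^bsub>L\<^esub> act t (inv\<^bsub>L\<^esub> y)"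
    unfolding e using y iy by simp
  also have "\<dots> = b \<otimes>\<^bsub>L\<^esub> inv\<^bsub>L\<^esub> y \<otimes>\<^bsub>L\<^esub> act t (y \<otimes>\<^bsub>L\<^esub> inv\<^bsub>L\<^esub> y)"
    using bL y iy t.hom_closed by (simp only: t.hom_mult m_ac m_closed)
  finally show ?thesis using bL y iy by (intro bexI[of _ "inv\<^bsub>L\<^esub> y"]) auto
qed

lemma finite_W: "finite (carrier W)"
proof (rule inj_on_finite)
  show "inj_on (\<lambda>w. restrict (act w) (carrier L)) (carrier W)"
    by (rule inj_onI) (metis faithful restrict_apply')
  show "(\<lambda>w. restrict (act w) (carrier L)) ` carrier W \<subseteq> carrier L \<rightarrow>\<^sub>E carrier L"
    using act_in by auto
  show "finite (carrier L \<rightarrow>\<^sub>E carrier L)" using finite_field by (simp add: finite_PiE)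
qed

lemma finite_cyclic_module_units: "\<exists>t. finite_cyclic_module W (units_of L) act t"
proof -
  interpret U: comm_group "units_of L" by (rule units_comm_group)
  obtain t where t: "t \<in> carrier W" "carrier W = range (\<lambda>i::nat. t [^]\<^bsub>W\<^esub> i)" using cyclic by blast
  have "finite_cyclic_module W (units_of L) act t"
  proof unfold_locales
    show "finite (carrier (units_of L))"
      using finite_field by (simp add: units_of_def Units_def)
    fix w a b assume "w \<in> carrier W" "a \<in> carrier (units_of L)" "b \<in> carrier (units_of L)"
    then show "act w (a \<otimes>\<^bsub>units_of L\<^esub> b) = act w a \<otimes>\<^bsub>units_of L\<^esub> act w b"
      using ring_hom_memE(2)[OF act_ring_hom] by (simp add: units_of_def Units_closed)
  next
    fix b assume "b \<in> carrier (units_of L)"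
      "(\<Otimes>\<^bsub>units_of L\<^esub>i\<in>{..<W.ord t}. act (t [^]\<^bsub>W\<^esub> i) b) = \<one>\<^bsub>units_of L\<^esub>"
    then show "\<exists>a\<in>carrier (units_of L). b \<otimes>\<^bsub>units_of L\<^esub> a = act t a"
      using hilbert90[OF t(1) finite_W] by (simp add: units_of_def)
  qed (use t(1) finite_W act_Units Units_closed in \<open>auto simp: units_of_def act_comp act_id t(2)[symmetric]\<close>)
  then show ?thesis by blast
qed

end

section \<open>Two-dimensional 0-cocycles\<close>

text \<open>First isomorphism theorem for the composite of \<phi> with the projection to G/B; the
  hypothesis \<open>surj\<close> is surjectivity of this composite. It will be applied with G the
  cocycles of S, B the coboundaries and \<phi> the inflation.\<close>

lemma (in comm_group) Mod_iso_Mod: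
  assumes H: "group H" and B: "subgroup B G" and \<phi>: "\<phi> \<in> hom H G"
    and surj: "\<And>z. z \<in> carrier G \<Longrightarrow> \<exists>w \<in> carrier H. \<exists>b \<in> B. z \<otimes> b = \<phi> w"
  shows "G Mod B \<cong> H Mod {w \<in> carrier H. \<phi> w \<in> B}"
proof -
  interpret N: normal B G using B by (rule subgroup_imp_normal)
  interpret Q: group "G Mod B" by (rule N.factorgroup_is_group)
  interpret H: group H by (rule H)
  have \<phi>c: "\<phi> w \<in> carrier G" if "w \<in> carrier H" for w using \<phi> that by (auto simp: hom_def)
  have "(\<lambda>w. B #> \<phi> w) \<in> hom H (G Mod B)"
    using Group.hom_compose[OF \<phi> N.r_coset_hom_Mod] by (simp add: o_def)
  then interpret h: group_hom H "G Mod B" "\<lambda>w. B #> \<phi> w" by unfold_locales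
  have "(\<lambda>w. B #> \<phi> w) ` carrier H = carrier (G Mod B)"
  proof
    show "(\<lambda>w. B #> \<phi> w) ` carrier H \<subseteq> carrier (G Mod B)" using h.hom_closed by blast
    show "carrier (G Mod B) \<subseteq> (\<lambda>w. B #> \<phi> w) ` carrier H"
    proof
      fix C assume "C \<in> carrier (G Mod B)"
      then obtain z where z: "z \<in> carrier G" "C = B #> z" by (auto simp: FactGroup_def RCOSETS_def)
      obtain w b where w: "w \<in> carrier H" "b \<in> B" "z \<otimes> b = \<phi> w" using surj[OF z(1)] by blast
      have "B #> \<phi> w = B #> z"
        unfolding w(3)[symmetric] using w(2) z(1) N.subset N.rcos_const
        by (subst m_comm) (auto simp: coset_mult_assoc[symmetric])
      then show "C \<in> (\<lambda>w. B #> \<phi> w) ` carrier H" using w(1) z(2) by auto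
    qed
  qed
  then have "H Mod kernel H (G Mod B) (\<lambda>w. B #> \<phi> w) \<cong> G Mod B" by (rule h.FactGroup_iso)
  moreover have "kernel H (G Mod B) (\<lambda>w. B #> \<phi> w) = {w \<in> carrier H. \<phi> w \<in> B}"
    using N.subset N.rcos_const \<phi>c rcos_self[OF _ B] by (auto simp: kernel_def FactGroup_def)
  ultimately show ?thesis
    using group.iso_sym[OF normal.factorgroup_is_group[OF h.normal_kernel]] by simp
qed

section \<open>0-cochains in dimensions 1 to 3 in explicit form\<close>

lemma (in semigroup_zero) mult_nonzeroD:
  assumes "x \<in> carrier S" "y \<in> carrier S" "x \<otimes> y \<noteq> \<zero>\<^sub>0"
  shows "x \<noteq> \<zero>\<^sub>0" "y \<noteq> \<zero>\<^sub>0"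
  using assms szero_left szero_right by auto

lemma nonzero_tuples_1_iff:
  "xs \<in> nonzero_tuples S 1 \<longleftrightarrow> (\<exists>x. xs = [x] \<and> x \<in> carrier S \<and> x \<noteq> \<zero>\<^sub>0\<^bsub>S\<^esub>)"
  by (auto simp: nonzero_tuples_def length_Suc_conv)

lemma nonzero_tuples_2_iff:
  "xs \<in> nonzero_tuples S 2 \<longleftrightarrow>
    (\<exists>x y. xs = [x, y] \<and> x \<in> carrier S \<and> y \<in> carrier S \<and> x \<otimes>\<^bsub>S\<^esub> y \<noteq> \<zero>\<^sub>0\<^bsub>S\<^esub>)"
  by (auto simp: nonzero_tuples_def length_Suc_conv numeral_2_eq_2)

lemma nonzero_tuples_3_iff:
  "xs \<in> nonzero_tuples S 3 \<longleftrightarrow>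
    (\<exists>x y z. xs = [x, y, z] \<and> x \<in> carrier S \<and> y \<in> carrier S \<and> z \<in> carrier S
      \<and> x \<otimes>\<^bsub>S\<^esub> y \<otimes>\<^bsub>S\<^esub> z \<noteq> \<zero>\<^sub>0\<^bsub>S\<^esub>)"
  by (auto simp: nonzero_tuples_def length_Suc_conv numeral_3_eq_3)

context zero_module
begin

text \<open>Every argument occurring in the coboundary formula therefore lies in the domain of a
  0-cochain.\<close>

lemma nonzero_triple:
  assumes "x \<in> carrier S" "y \<in> carrier S" "z \<in> carrier S" "x \<otimes>\<^bsub>S\<^esub> y \<otimes>\<^bsub>S\<^esub> z \<noteq> \<zero>\<^sub>0\<^bsub>S\<^esub>"
  shows "x \<otimes>\<^bsub>S\<^esub> y \<noteq> \<zero>\<^sub>0\<^bsub>S\<^esub>" "y \<otimes>\<^bsub>S\<^esub> z \<noteq> \<zero>\<^sub>0\<^bsub>S\<^esub>" "x \<otimes>\<^bsub>S\<^esub> (y \<otimes>\<^bsub>S\<^esub> z) \<noteq> \<zero>\<^sub>0\<^bsub>S\<^esub>"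
    "x \<noteq> \<zero>\<^sub>0\<^bsub>S\<^esub>" "y \<noteq> \<zero>\<^sub>0\<^bsub>S\<^esub>" "z \<noteq> \<zero>\<^sub>0\<^bsub>S\<^esub>"
proof -
  show a: "x \<otimes>\<^bsub>S\<^esub> (y \<otimes>\<^bsub>S\<^esub> z) \<noteq> \<zero>\<^sub>0\<^bsub>S\<^esub>" using assms sg_assoc by simp
  show b: "x \<otimes>\<^bsub>S\<^esub> y \<noteq> \<zero>\<^sub>0\<^bsub>S\<^esub>" "z \<noteq> \<zero>\<^sub>0\<^bsub>S\<^esub>"
    using assms(3,4) sg_closed[OF assms(1,2)] mult_nonzeroD[of "x \<otimes>\<^bsub>S\<^esub> y" z] by auto
  show "y \<otimes>\<^bsub>S\<^esub> z \<noteq> \<zero>\<^sub>0\<^bsub>S\<^esub>" using a assms(1) szero_right by auto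
  show "x \<noteq> \<zero>\<^sub>0\<^bsub>S\<^esub>" "y \<noteq> \<zero>\<^sub>0\<^bsub>S\<^esub>" using b mult_nonzeroD[OF assms(1,2)] by auto
qed

lemma act_one [simp]: "s \<in> carrier S - {\<zero>\<^sub>0\<^bsub>S\<^esub>} \<Longrightarrow> act s \<one>\<^bsub>A\<^esub> = \<one>\<^bsub>A\<^esub>"
  using act_mult[of s "\<one>\<^bsub>A\<^esub>" "\<one>\<^bsub>A\<^esub>"] act_closed[of s "\<one>\<^bsub>A\<^esub>"] by (simp add: A.l_cancel_one')

lemma act_inv:
  assumes "s \<in> carrier S - {\<zero>\<^sub>0\<^bsub>S\<^esub>}" "a \<in> carrier A"
  shows "act s (inv\<^bsub>A\<^esub> a) = inv\<^bsub>A\<^esub> (act s a)"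
proof -
  have "act s (inv\<^bsub>A\<^esub> a) \<otimes>\<^bsub>A\<^esub> act s a = \<one>\<^bsub>A\<^esub>"
    using assms by (simp flip: act_mult)
  then show ?thesis using assms act_closed by (intro A.inv_equality[symmetric]) auto
qed

lemma cochains_app_closed:
  "\<lbrakk>f \<in> carrier (cochains S A n); xs \<in> nonzero_tuples S n\<rbrakk> \<Longrightarrow> f xs \<in> carrier A"
  by (auto simp: cochains_def)

lemma comm_group_cochains: "comm_group (cochains S A n)"
proof -
  interpret C: group "cochains S A n"
    unfolding cochains_def by (rule product_group) (rule A.group_axioms)
  show ?thesis
    by (rule C.group_comm_groupI)
      (auto simp: cochains_def PiE_iff A.m_comm intro!: restrict_ext)
qed

lemma coboundary_1:
  assumes "h \<in> carrier (cochains S A 1)" "x \<in> carrier S" "y \<in> carrier S" "x \<otimes>\<^bsub>S\<^esub> y \<noteq> \<zero>\<^sub>0\<^bsub>S\<^esub>"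
  shows "coboundary S A act 1 h [x, y]
    = act x (h [y]) \<otimes>\<^bsub>A\<^esub> inv\<^bsub>A\<^esub> (h [x \<otimes>\<^bsub>S\<^esub> y]) \<otimes>\<^bsub>A\<^esub> h [x]"
proof -
  have n: "x \<noteq> \<zero>\<^sub>0\<^bsub>S\<^esub>" "y \<noteq> \<zero>\<^sub>0\<^bsub>S\<^esub>" using mult_nonzeroD assms(2-4) by auto
  have c: "h [x] \<in> carrier A" "h [y] \<in> carrier A" "h [x \<otimes>\<^bsub>S\<^esub> y] \<in> carrier A"
    using cochains_app_closed[OF assms(1)] assms(2-4) n sg_closed by (auto simp: nonzero_tuples_1_iff[simplified])
  have m: "[x, y] \<in> nonzero_tuples S (1 + 1)" using assms by (simp add: nonzero_tuples_2_iff flip: numeral_2_eq_2)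
  show ?thesis
    unfolding coboundary_def restrict_apply'[OF m]
    using c by (simp add: contract_def A.int_pow_neg)
qed

lemma coboundary_2:
  assumes "f \<in> carrier (cochains S A 2)" "x \<in> carrier S" "y \<in> carrier S" "z \<in> carrier S"
    "x \<otimes>\<^bsub>S\<^esub> y \<otimes>\<^bsub>S\<^esub> z \<noteq> \<zero>\<^sub>0\<^bsub>S\<^esub>"
  shows "coboundary S A act 2 f [x, y, z]
    = act x (f [y, z]) \<otimes>\<^bsub>A\<^esub> (inv\<^bsub>A\<^esub> (f [x \<otimes>\<^bsub>S\<^esub> y, z]) \<otimes>\<^bsub>A\<^esub> f [x, y \<otimes>\<^bsub>S\<^esub> z])
      \<otimes>\<^bsub>A\<^esub> inv\<^bsub>A\<^esub> (f [x, y])"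
proof -
  note n = nonzero_triple[OF assms(2-5)]
  have c: "f [x, y] \<in> carrier A" "f [y, z] \<in> carrier A" "f [x \<otimes>\<^bsub>S\<^esub> y, z] \<in> carrier A"
    "f [x, y \<otimes>\<^bsub>S\<^esub> z] \<in> carrier A"
    using cochains_app_closed[OF assms(1)] assms(2-5) n sg_closed by (auto simp: nonzero_tuples_2_iff)
  have m: "[x, y, z] \<in> nonzero_tuples S (2 + 1)" using assms by (simp add: nonzero_tuples_3_iff)
  have I: "{1..2} = insert (1::nat) {2}" by auto
  show ?thesis
    unfolding coboundary_def restrict_apply'[OF m] I
    using c by (simp add: contract_def A.int_pow_neg)
qed

lemma coboundary_1_hom: "coboundary S A act 1 \<in> hom (cochains S A 1) (cochains S A 2)"
proof (rule homI)
  have app: "h [x] \<in> carrier A" if "h \<in> carrier (cochains S A 1)" "x \<in> carrier S" "x \<noteq> \<zero>\<^sub>0\<^bsub>S\<^esub>" for h x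
    using cochains_app_closed[OF that(1)] that(2,3) by (auto simp: nonzero_tuples_1_iff[simplified])
  fix h assume h: "h \<in> carrier (cochains S A 1)"
  have "coboundary S A act 1 h xs \<in> carrier A" if xs: "xs \<in> nonzero_tuples S 2" for xs
  proof -
    obtain x y where x: "xs = [x, y]" "x \<in> carrier S" "y \<in> carrier S" "x \<otimes>\<^bsub>S\<^esub> y \<noteq> \<zero>\<^sub>0\<^bsub>S\<^esub>"
      using xs by (auto simp: nonzero_tuples_2_iff)
    then show ?thesis
      using app[OF h] mult_nonzeroD[OF x(2-4)] sg_closed act_closed
      unfolding x(1) coboundary_1[OF h x(2-4)] by auto
  qed
  then show "coboundary S A act 1 h \<in> carrier (cochains S A 2)"
    by (auto simp: cochains_def coboundary_def simp flip: numeral_2_eq_2)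
  fix k assume k: "k \<in> carrier (cochains S A 1)"
  have hk: "h \<otimes>\<^bsub>cochains S A 1\<^esub> k \<in> carrier (cochains S A 1)"
    using h k by (auto simp: cochains_def)
  have "coboundary S A act 1 (h \<otimes>\<^bsub>cochains S A 1\<^esub> k) xs
      = coboundary S A act 1 h xs \<otimes>\<^bsub>A\<^esub> coboundary S A act 1 k xs" if xs: "xs \<in> nonzero_tuples S 2" for xs
  proof -
    obtain x y where x: "xs = [x, y]" "x \<in> carrier S" "y \<in> carrier S" "x \<otimes>\<^bsub>S\<^esub> y \<noteq> \<zero>\<^sub>0\<^bsub>S\<^esub>"
      using xs by (auto simp: nonzero_tuples_2_iff)
    note n = mult_nonzeroD[OF x(2-4)]
    have e: "(h \<otimes>\<^bsub>cochains S A 1\<^esub> k) [z] = h [z] \<otimes>\<^bsub>A\<^esub> k [z]" if "z \<in> carrier S" "z \<noteq> \<zero>\<^sub>0\<^bsub>S\<^esub>" for z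
      using that by (simp add: cochains_def nonzero_tuples_1_iff[simplified])
    show ?thesis
      unfolding x(1) coboundary_1[OF h x(2-4)] coboundary_1[OF k x(2-4)] coboundary_1[OF hk x(2-4)]
      using app[OF h] app[OF k] x(2-4) n sg_closed act_closed
      by (simp add: e[simplified] act_mult A.inv_mult A.m_ac)
  qed
  then show "coboundary S A act 1 (h \<otimes>\<^bsub>cochains S A 1\<^esub> k)
      = coboundary S A act 1 h \<otimes>\<^bsub>cochains S A 2\<^esub> coboundary S A act 1 k"
    by (intro extensionalityI[of _ "nonzero_tuples S 2"])
      (auto simp: cochains_def coboundary_def simp flip: numeral_2_eq_2)
qed

lemma coboundary_2_hom: "coboundary S A act 2 \<in> hom (cochains S A 2) (cochains S A 3)"
proof (rule homI)
  have app: "h [x, y] \<in> carrier A"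
    if "h \<in> carrier (cochains S A 2)" "x \<in> carrier S" "y \<in> carrier S" "x \<otimes>\<^bsub>S\<^esub> y \<noteq> \<zero>\<^sub>0\<^bsub>S\<^esub>" for h x y
    using cochains_app_closed[OF that(1)] that(2-4) by (auto simp: nonzero_tuples_2_iff)
  fix h assume h: "h \<in> carrier (cochains S A 2)"
  have "coboundary S A act 2 h xs \<in> carrier A" if xs: "xs \<in> nonzero_tuples S 3" for xs
  proof -
    obtain x y z where x: "xs = [x, y, z]" "x \<in> carrier S" "y \<in> carrier S" "z \<in> carrier S"
      "x \<otimes>\<^bsub>S\<^esub> y \<otimes>\<^bsub>S\<^esub> z \<noteq> \<zero>\<^sub>0\<^bsub>S\<^esub>"
      using xs by (auto simp: nonzero_tuples_3_iff)
    then show ?thesis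
      using app[OF h] nonzero_triple[OF x(2-5)] sg_closed act_closed
      unfolding x(1) coboundary_2[OF h x(2-5)] by auto
  qed
  then show "coboundary S A act 2 h \<in> carrier (cochains S A 3)"
    by (auto simp: cochains_def coboundary_def)
  fix k assume k: "k \<in> carrier (cochains S A 2)"
  have hk: "h \<otimes>\<^bsub>cochains S A 2\<^esub> k \<in> carrier (cochains S A 2)"
    using h k by (auto simp: cochains_def)
  have "coboundary S A act 2 (h \<otimes>\<^bsub>cochains S A 2\<^esub> k) xs
      = coboundary S A act 2 h xs \<otimes>\<^bsub>A\<^esub> coboundary S A act 2 k xs" if xs: "xs \<in> nonzero_tuples S 3" for xs
  proof -
    obtain x y z where x: "xs = [x, y, z]" "x \<in> carrier S" "y \<in> carrier S" "z \<in> carrier S"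
      "x \<otimes>\<^bsub>S\<^esub> y \<otimes>\<^bsub>S\<^esub> z \<noteq> \<zero>\<^sub>0\<^bsub>S\<^esub>"
      using xs by (auto simp: nonzero_tuples_3_iff)
    note n = nonzero_triple[OF x(2-5)]
    have e: "(h \<otimes>\<^bsub>cochains S A 2\<^esub> k) [x, y] = h [x, y] \<otimes>\<^bsub>A\<^esub> k [x, y]"
      if "x \<in> carrier S" "y \<in> carrier S" "x \<otimes>\<^bsub>S\<^esub> y \<noteq> \<zero>\<^sub>0\<^bsub>S\<^esub>" for x y
      using that by (simp add: cochains_def nonzero_tuples_2_iff)
    show ?thesis
      unfolding x(1) coboundary_2[OF h x(2-5)] coboundary_2[OF k x(2-5)] coboundary_2[OF hk x(2-5)]
      using app[OF h] app[OF k] x(2-5) n sg_closed act_closed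
      by (simp add: e act_mult A.inv_mult A.m_ac)
  qed
  then show "coboundary S A act 2 (h \<otimes>\<^bsub>cochains S A 2\<^esub> k)
      = coboundary S A act 2 h \<otimes>\<^bsub>cochains S A 3\<^esub> coboundary S A act 2 k"
    by (intro extensionalityI[of _ "nonzero_tuples S 3"]) (auto simp: cochains_def coboundary_def)
qed

lemma group_hom_coboundary_2: "group_hom (cochains S A 2) (cochains S A 3) (coboundary S A act 2)"
  using comm_group_cochains[THEN comm_group.axioms(2)] coboundary_2_hom
  by (simp add: group_hom_def group_hom_axioms_def)

lemma mult_inv_eq_one_iff:
  assumes "a \<in> carrier A" "b \<in> carrier A" "c \<in> carrier A" "d \<in> carrier A"
  shows "a \<otimes>\<^bsub>A\<^esub> (inv\<^bsub>A\<^esub> b \<otimes>\<^bsub>A\<^esub> c) \<otimes>\<^bsub>A\<^esub> inv\<^bsub>A\<^esub> d = \<one>\<^bsub>A\<^esub> \<longleftrightarrow> a \<otimes>\<^bsub>A\<^esub> c = b \<otimes>\<^bsub>A\<^esub> d"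
proof -
  have "a \<otimes>\<^bsub>A\<^esub> (inv\<^bsub>A\<^esub> b \<otimes>\<^bsub>A\<^esub> c) \<otimes>\<^bsub>A\<^esub> inv\<^bsub>A\<^esub> d = (a \<otimes>\<^bsub>A\<^esub> c) \<otimes>\<^bsub>A\<^esub> inv\<^bsub>A\<^esub> (b \<otimes>\<^bsub>A\<^esub> d)"
    using assms by (simp add: A.inv_mult A.m_ac)
  then show ?thesis using assms A.inv_solve_right'[of "\<one>\<^bsub>A\<^esub>" "a \<otimes>\<^bsub>A\<^esub> c" "b \<otimes>\<^bsub>A\<^esub> d"] by auto
qed

text \<open>The alternating product is sorted into an equation without inverses, the form in which
  the cocycle condition is used from here on.\<close>

lemma cocycles_2_iff:
  "f \<in> cocycles S A act 2 \<longleftrightarrow> f \<in> carrier (cochains S A 2) \<and>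
    (\<forall>x \<in> carrier S. \<forall>y \<in> carrier S. \<forall>z \<in> carrier S. x \<otimes>\<^bsub>S\<^esub> y \<otimes>\<^bsub>S\<^esub> z \<noteq> \<zero>\<^sub>0\<^bsub>S\<^esub> \<longrightarrow>
      act x (f [y, z]) \<otimes>\<^bsub>A\<^esub> f [x, y \<otimes>\<^bsub>S\<^esub> z] = f [x \<otimes>\<^bsub>S\<^esub> y, z] \<otimes>\<^bsub>A\<^esub> f [x, y])"
proof (cases "f \<in> carrier (cochains S A 2)")
  case True
  have one: "\<one>\<^bsub>cochains S A 3\<^esub> = (\<lambda>xs\<in>nonzero_tuples S 3. \<one>\<^bsub>A\<^esub>)" by (simp add: cochains_def)
  have "f \<in> cocycles S A act 2 \<longleftrightarrow> coboundary S A act 2 f = \<one>\<^bsub>cochains S A 3\<^esub>"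
    using True by (simp add: cocycles_def kernel_def)
  also have "\<dots> \<longleftrightarrow> (\<forall>xs \<in> nonzero_tuples S 3. coboundary S A act 2 f xs = \<one>\<^bsub>A\<^esub>)"
    unfolding one using coboundary_2_hom True
    by (auto simp: fun_eq_iff coboundary_def)
  also have "\<dots> \<longleftrightarrow> (\<forall>x \<in> carrier S. \<forall>y \<in> carrier S. \<forall>z \<in> carrier S. x \<otimes>\<^bsub>S\<^esub> y \<otimes>\<^bsub>S\<^esub> z \<noteq> \<zero>\<^sub>0\<^bsub>S\<^esub> \<longrightarrow>
      coboundary S A act 2 f [x, y, z] = \<one>\<^bsub>A\<^esub>)"
    by (auto simp: nonzero_tuples_3_iff)
  also have "\<dots> \<longleftrightarrow> (\<forall>x \<in> carrier S. \<forall>y \<in> carrier S. \<forall>z \<in> carrier S. x \<otimes>\<^bsub>S\<^esub> y \<otimes>\<^bsub>S\<^esub> z \<noteq> \<zero>\<^sub>0\<^bsub>S\<^esub> \<longrightarrow>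
      act x (f [y, z]) \<otimes>\<^bsub>A\<^esub> f [x, y \<otimes>\<^bsub>S\<^esub> z] = f [x \<otimes>\<^bsub>S\<^esub> y, z] \<otimes>\<^bsub>A\<^esub> f [x, y])"
  proof (intro ball_cong imp_cong refl)
    fix x y z assume x: "x \<in> carrier S" "y \<in> carrier S" "z \<in> carrier S" "x \<otimes>\<^bsub>S\<^esub> y \<otimes>\<^bsub>S\<^esub> z \<noteq> \<zero>\<^sub>0\<^bsub>S\<^esub>"
    note n = nonzero_triple[OF x]
    show "coboundary S A act 2 f [x, y, z] = \<one>\<^bsub>A\<^esub> \<longleftrightarrow>
      act x (f [y, z]) \<otimes>\<^bsub>A\<^esub> f [x, y \<otimes>\<^bsub>S\<^esub> z] = f [x \<otimes>\<^bsub>S\<^esub> y, z] \<otimes>\<^bsub>A\<^esub> f [x, y]"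
      unfolding coboundary_2[OF True x]
      using cochains_app_closed[OF True] x n sg_closed
      by (intro mult_inv_eq_one_iff act_closed) (auto simp: nonzero_tuples_2_iff)
  qed
  finally show ?thesis using True by simp
qed (simp add: cocycles_def kernel_def)

text \<open>Here h is a function of elements instead of one-element lists and its values at 0 are
  left free, so that h can be prescribed by a formula. The equation is again free of
  inverses.\<close>

lemma coboundaries_2_iff:
  assumes f: "f \<in> carrier (cochains S A 2)"
  shows "f \<in> coboundaries S A act 2 \<longleftrightarrow>
    (\<exists>h. (\<forall>x \<in> carrier S - {\<zero>\<^sub>0\<^bsub>S\<^esub>}. h x \<in> carrier A) \<and>
      (\<forall>x \<in> carrier S. \<forall>y \<in> carrier S. x \<otimes>\<^bsub>S\<^esub> y \<noteq> \<zero>\<^sub>0\<^bsub>S\<^esub> \<longrightarrow>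
        f [x, y] \<otimes>\<^bsub>A\<^esub> h (x \<otimes>\<^bsub>S\<^esub> y) = act x (h y) \<otimes>\<^bsub>A\<^esub> h x))" (is "_ \<longleftrightarrow> ?R")
proof -
  have app: "h [x] \<in> carrier A" if "h \<in> carrier (cochains S A 1)" "x \<in> carrier S" "x \<noteq> \<zero>\<^sub>0\<^bsub>S\<^esub>" for h x
    using cochains_app_closed[OF that(1)] that(2,3) by (auto simp: nonzero_tuples_1_iff[simplified])
  have eq: "f [x, y] = coboundary S A act 1 h [x, y] \<longleftrightarrow>
      f [x, y] \<otimes>\<^bsub>A\<^esub> h [x \<otimes>\<^bsub>S\<^esub> y] = act x (h [y]) \<otimes>\<^bsub>A\<^esub> h [x]"
    if h: "h \<in> carrier (cochains S A 1)" and x: "x \<in> carrier S" "y \<in> carrier S" "x \<otimes>\<^bsub>S\<^esub> y \<noteq> \<zero>\<^sub>0\<^bsub>S\<^esub>" for h x y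
  proof -
    note n = mult_nonzeroD[OF x]
    have c: "f [x, y] \<in> carrier A" "h [x \<otimes>\<^bsub>S\<^esub> y] \<in> carrier A" "act x (h [y]) \<in> carrier A" "h [x] \<in> carrier A"
      using app[OF h] x n sg_closed act_closed cochains_app_closed[OF f] by (auto simp: nonzero_tuples_2_iff)
    have "act x (h [y]) \<otimes>\<^bsub>A\<^esub> inv\<^bsub>A\<^esub> (h [x \<otimes>\<^bsub>S\<^esub> y]) \<otimes>\<^bsub>A\<^esub> h [x] =
      (act x (h [y]) \<otimes>\<^bsub>A\<^esub> h [x]) \<otimes>\<^bsub>A\<^esub> inv\<^bsub>A\<^esub> (h [x \<otimes>\<^bsub>S\<^esub> y])" using c by (simp add: A.m_ac)
    then show ?thesis unfolding coboundary_1[OF h x] using c A.inv_solve_right by auto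
  qed
  have B: "f \<in> coboundaries S A act 2 \<longleftrightarrow>
      (\<exists>h \<in> carrier (cochains S A 1). \<forall>x \<in> carrier S. \<forall>y \<in> carrier S. x \<otimes>\<^bsub>S\<^esub> y \<noteq> \<zero>\<^sub>0\<^bsub>S\<^esub> \<longrightarrow>
        f [x, y] = coboundary S A act 1 h [x, y])"
  proof -
    have "f = coboundary S A act 1 h \<longleftrightarrow> (\<forall>x \<in> carrier S. \<forall>y \<in> carrier S. x \<otimes>\<^bsub>S\<^esub> y \<noteq> \<zero>\<^sub>0\<^bsub>S\<^esub> \<longrightarrow>
        f [x, y] = coboundary S A act 1 h [x, y])" if h: "h \<in> carrier (cochains S A 1)" for h
    proof -
      have "f \<in> extensional (nonzero_tuples S 2)" "coboundary S A act 1 h \<in> extensional (nonzero_tuples S 2)"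
        using f by (auto simp: cochains_def coboundary_def PiE_def simp flip: numeral_2_eq_2)
      then show ?thesis
        by (auto simp: nonzero_tuples_2_iff intro!: extensionalityI[of _ "nonzero_tuples S 2"])
    qed
    then show ?thesis by (auto simp: coboundaries_def image_iff)
  qed
  show ?thesis
  proof
    assume "f \<in> coboundaries S A act 2"
    then obtain h where h: "h \<in> carrier (cochains S A 1)"
      "\<And>x y. x \<in> carrier S \<Longrightarrow> y \<in> carrier S \<Longrightarrow> x \<otimes>\<^bsub>S\<^esub> y \<noteq> \<zero>\<^sub>0\<^bsub>S\<^esub> \<Longrightarrow> f [x, y] = coboundary S A act 1 h [x, y]"
      using B by auto
    show ?R
      using app[OF h(1)] eq[OF h(1), THEN iffD1, OF _ _ _ h(2)]
      by (intro exI[of _ "\<lambda>x. h [x]"]) blast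
  next
    assume ?R
    then obtain h where h: "\<And>x. x \<in> carrier S - {\<zero>\<^sub>0\<^bsub>S\<^esub>} \<Longrightarrow> h x \<in> carrier A"
      "\<And>x y. x \<in> carrier S \<Longrightarrow> y \<in> carrier S \<Longrightarrow> x \<otimes>\<^bsub>S\<^esub> y \<noteq> \<zero>\<^sub>0\<^bsub>S\<^esub> \<Longrightarrow>
        f [x, y] \<otimes>\<^bsub>A\<^esub> h (x \<otimes>\<^bsub>S\<^esub> y) = act x (h y) \<otimes>\<^bsub>A\<^esub> h x" by auto
    define k where "k = (\<lambda>xs\<in>nonzero_tuples S 1. h (hd xs))"
    have kc: "k \<in> carrier (cochains S A 1)"
      using h(1) by (auto simp: k_def cochains_def nonzero_tuples_1_iff[simplified])
    have k: "k [x] = h x" if "x \<in> carrier S" "x \<noteq> \<zero>\<^sub>0\<^bsub>S\<^esub>" for x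
      using that by (simp add: k_def nonzero_tuples_1_iff[simplified])
    show "f \<in> coboundaries S A act 2"
      unfolding B
    proof (intro bexI[OF _ kc] ballI impI)
      fix x y assume x: "x \<in> carrier S" "y \<in> carrier S" "x \<otimes>\<^bsub>S\<^esub> y \<noteq> \<zero>\<^sub>0\<^bsub>S\<^esub>"
      show "f [x, y] = coboundary S A act 1 k [x, y]"
        unfolding eq[OF kc x] k[OF x(1) mult_nonzeroD(1)[OF x]] k[OF x(2) mult_nonzeroD(2)[OF x]]
          k[OF sg_closed[OF x(1,2)] x(3)] by (rule h(2)[OF x])
    qed
  qed
qed

text \<open>The instance \<partial>\<partial> = 0 from dimension 1 to dimension 3.\<close>

lemma coboundaries_2_subset_cocycles_2: "coboundaries S A act 2 \<subseteq> cocycles S A act 2"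
proof
  fix f assume f: "f \<in> coboundaries S A act 2"
  then have fc: "f \<in> carrier (cochains S A 2)"
    using coboundary_1_hom by (auto simp: coboundaries_def hom_def)
  obtain h where h: "\<And>x. x \<in> carrier S - {\<zero>\<^sub>0\<^bsub>S\<^esub>} \<Longrightarrow> h x \<in> carrier A"
      "\<And>x y. x \<in> carrier S \<Longrightarrow> y \<in> carrier S \<Longrightarrow> x \<otimes>\<^bsub>S\<^esub> y \<noteq> \<zero>\<^sub>0\<^bsub>S\<^esub> \<Longrightarrow>
        f [x, y] \<otimes>\<^bsub>A\<^esub> h (x \<otimes>\<^bsub>S\<^esub> y) = act x (h y) \<otimes>\<^bsub>A\<^esub> h x"
    using f coboundaries_2_iff[OF fc] by auto
  show "f \<in> cocycles S A act 2"
    unfolding cocycles_2_iff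
  proof (intro conjI fc ballI impI)
    fix x y z assume x: "x \<in> carrier S" "y \<in> carrier S" "z \<in> carrier S" "x \<otimes>\<^bsub>S\<^esub> y \<otimes>\<^bsub>S\<^esub> z \<noteq> \<zero>\<^sub>0\<^bsub>S\<^esub>"
    note n = nonzero_triple[OF x]
    define p where "p = x \<otimes>\<^bsub>S\<^esub> y"
    define q where "q = y \<otimes>\<^bsub>S\<^esub> z"
    define r where "r = p \<otimes>\<^bsub>S\<^esub> z"
    have r: "x \<otimes>\<^bsub>S\<^esub> q = r" using x by (simp add: r_def p_def q_def sg_assoc)
    have e: "p \<in> carrier S" "q \<in> carrier S" "r \<in> carrier S" "r \<noteq> \<zero>\<^sub>0\<^bsub>S\<^esub>" "p \<noteq> \<zero>\<^sub>0\<^bsub>S\<^esub>" "q \<noteq> \<zero>\<^sub>0\<^bsub>S\<^esub>"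
      using x n sg_closed by (auto simp: p_def q_def r_def)
    have fA: "f [y, z] \<in> carrier A" "f [x, q] \<in> carrier A" "f [p, z] \<in> carrier A" "f [x, y] \<in> carrier A"
      using cochains_app_closed[OF fc] x n e by (auto simp: nonzero_tuples_2_iff p_def q_def)
    have hA: "h x \<in> carrier A" "h y \<in> carrier A" "h z \<in> carrier A" "h p \<in> carrier A" "h q \<in> carrier A" "h r \<in> carrier A"
      using h(1) x n e by auto
    have xs: "x \<in> carrier S - {\<zero>\<^sub>0\<^bsub>S\<^esub>}" "y \<in> carrier S - {\<zero>\<^sub>0\<^bsub>S\<^esub>}" using x n by auto
    have aA: "act x (h y) \<in> carrier A" "act x (h q) \<in> carrier A" "act p (h z) \<in> carrier A"
      "act x (f [y, z]) \<in> carrier A" "act y (h z) \<in> carrier A"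
      using act_closed xs hA fA e by auto
    have "act x (f [y, z] \<otimes>\<^bsub>A\<^esub> h q) = act x (act y (h z) \<otimes>\<^bsub>A\<^esub> h y)" using h(2)[of y z] x n by (simp add: q_def)
    then have 1: "act x (f [y, z]) \<otimes>\<^bsub>A\<^esub> act x (h q) = act p (h z) \<otimes>\<^bsub>A\<^esub> act x (h y)"
      using act_act[of x y "h z"] xs hA fA aA n by (simp add: act_mult p_def)
    have 2: "f [x, q] \<otimes>\<^bsub>A\<^esub> h r = act x (h q) \<otimes>\<^bsub>A\<^esub> h x" using h(2)[of x q] x e r by simp
    have 3: "f [p, z] \<otimes>\<^bsub>A\<^esub> h r = act p (h z) \<otimes>\<^bsub>A\<^esub> h p" using h(2)[of p z] x e r_def by simp
    have 4: "f [x, y] \<otimes>\<^bsub>A\<^esub> h p = act x (h y) \<otimes>\<^bsub>A\<^esub> h x" using h(2)[of x y] x n by (simp add: p_def)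
    \<comment> \<open>After multiplication by this factor each value of f is paired with the value
      of h that its defining equation needs; both sides then become the same product of values of h,
      and the factor is cancelled.\<close>
    let ?w = "act x (h q) \<otimes>\<^bsub>A\<^esub> h r \<otimes>\<^bsub>A\<^esub> h p"
    have "(act x (f [y, z]) \<otimes>\<^bsub>A\<^esub> f [x, q]) \<otimes>\<^bsub>A\<^esub> ?w
        = (act x (f [y, z]) \<otimes>\<^bsub>A\<^esub> act x (h q)) \<otimes>\<^bsub>A\<^esub> (f [x, q] \<otimes>\<^bsub>A\<^esub> h r) \<otimes>\<^bsub>A\<^esub> h p"
      using aA fA hA by (simp only: A.m_ac A.m_closed)
    also have "\<dots> = (act p (h z) \<otimes>\<^bsub>A\<^esub> h p) \<otimes>\<^bsub>A\<^esub> (act x (h y) \<otimes>\<^bsub>A\<^esub> h x) \<otimes>\<^bsub>A\<^esub> act x (h q)"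
      unfolding 1 2 using aA fA hA by (simp only: A.m_ac A.m_closed)
    also have "\<dots> = (f [p, z] \<otimes>\<^bsub>A\<^esub> f [x, y]) \<otimes>\<^bsub>A\<^esub> ?w"
      unfolding 3[symmetric] 4[symmetric] using aA fA hA by (simp only: A.m_ac A.m_closed)
    finally show "act x (f [y, z]) \<otimes>\<^bsub>A\<^esub> f [x, y \<otimes>\<^bsub>S\<^esub> z] = f [x \<otimes>\<^bsub>S\<^esub> y, z] \<otimes>\<^bsub>A\<^esub> f [x, y]"
      unfolding p_def[symmetric] q_def[symmetric]
      by (rule A.right_cancel[THEN iffD1, rotated 3]) (intro A.m_closed aA fA hA)+
  qed
qed

lemma subgroup_cocycles_2: "subgroup (cocycles S A act 2) (cochains S A 2)"
  unfolding cocycles_def using group_hom.subgroup_kernel[OF group_hom_coboundary_2] by simp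

lemma comm_group_cocycles_2: "comm_group (cochains S A 2\<lparr>carrier := cocycles S A act 2\<rparr>)"
proof -
  interpret C: comm_group "cochains S A 2" by (rule comm_group_cochains)
  interpret Z: group "cochains S A 2\<lparr>carrier := cocycles S A act 2\<rparr>"
    by (rule subgroup.subgroup_is_group[OF subgroup_cocycles_2 C.group_axioms])
  show ?thesis
    using subgroup.subset[OF subgroup_cocycles_2] C.m_comm by (intro Z.group_comm_groupI) auto
qed

lemma subgroup_coboundaries_2:
  "subgroup (coboundaries S A act 2) (cochains S A 2\<lparr>carrier := cocycles S A act 2\<rparr>)"
proof -
  interpret C: comm_group "cochains S A 2" by (rule comm_group_cochains)
  interpret h: group_hom "cochains S A 1" "cochains S A 2" "coboundary S A act 1"
    using comm_group_cochains[THEN comm_group.axioms(2)] coboundary_1_hom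
    by (simp add: group_hom_def group_hom_axioms_def)
  have "subgroup (coboundaries S A act 2) (cochains S A 2)"
    using h.img_is_subgroup by (simp add: coboundaries_def)
  then show ?thesis
    using C.subgroup_incl subgroup_cocycles_2 coboundaries_2_subset_cocycles_2 by blast
qed

end

section \<open>Changing a 2-cocycle by a coboundary\<close>

context zero_module
begin

lemma cocycle_2_closed:
  "\<lbrakk>f \<in> cocycles S A act 2; x \<in> carrier S; y \<in> carrier S; x \<otimes>\<^bsub>S\<^esub> y \<noteq> \<zero>\<^sub>0\<^bsub>S\<^esub>\<rbrakk> \<Longrightarrow> f [x, y] \<in> carrier A"
  using cochains_app_closed[of f 2 "[x, y]"] by (simp add: cocycles_2_iff nonzero_tuples_2_iff)

lemma cocycle_2D:
  "\<lbrakk>f \<in> cocycles S A act 2; x \<in> carrier S; y \<in> carrier S; z \<in> carrier S; x \<otimes>\<^bsub>S\<^esub> y \<otimes>\<^bsub>S\<^esub> z \<noteq> \<zero>\<^sub>0\<^bsub>S\<^esub>\<rbrakk>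
    \<Longrightarrow> act x (f [y, z]) \<otimes>\<^bsub>A\<^esub> f [x, y \<otimes>\<^bsub>S\<^esub> z] = f [x \<otimes>\<^bsub>S\<^esub> y, z] \<otimes>\<^bsub>A\<^esub> f [x, y]"
  by (simp add: cocycles_2_iff)

definition cohomologous :: "('s list \<Rightarrow> 'a) \<Rightarrow> ('s list \<Rightarrow> 'a) \<Rightarrow> bool" where
  "cohomologous f g \<longleftrightarrow> (\<exists>b \<in> coboundaries S A act 2. f \<otimes>\<^bsub>cochains S A 2\<^esub> b = g)"

lemma cohomologous_trans:
  assumes "f \<in> cocycles S A act 2" "cohomologous f g" "cohomologous g h"
  shows "cohomologous f h"
proof -
  interpret C: comm_group "cochains S A 2" by (rule comm_group_cochains)
  obtain b c where bc: "b \<in> coboundaries S A act 2" "f \<otimes>\<^bsub>cochains S A 2\<^esub> b = g"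
    "c \<in> coboundaries S A act 2" "g \<otimes>\<^bsub>cochains S A 2\<^esub> c = h"
    using assms(2,3) by (auto simp: cohomologous_def)
  have Z: "cocycles S A act 2 \<subseteq> carrier (cochains S A 2)" by (auto simp: cocycles_2_iff)
  have "f \<in> carrier (cochains S A 2)" "b \<in> carrier (cochains S A 2)" "c \<in> carrier (cochains S A 2)"
    using Z assms(1) bc(1,3) coboundaries_2_subset_cocycles_2 by blast+
  then have "f \<otimes>\<^bsub>cochains S A 2\<^esub> (b \<otimes>\<^bsub>cochains S A 2\<^esub> c) = h"
    using bc by (simp add: C.m_assoc[symmetric])
  moreover have "b \<otimes>\<^bsub>cochains S A 2\<^esub> c \<in> coboundaries S A act 2"
    using subgroup.m_closed[OF subgroup_coboundaries_2 bc(1,3)] by simp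
  ultimately show ?thesis unfolding cohomologous_def by blast
qed

text \<open>The new cocycle is f times \<partial>h. All normalisations below are instances; each
  consists in finding an h for which the displayed equation makes g equal to 1 at the desired
  pairs.\<close>

lemma cohomologous_twist:
  assumes f: "f \<in> cocycles S A act 2" and h: "\<And>x. x \<in> carrier S - {\<zero>\<^sub>0\<^bsub>S\<^esub>} \<Longrightarrow> h x \<in> carrier A"
  obtains g where "g \<in> cocycles S A act 2" "cohomologous f g"
    "\<And>x y. \<lbrakk>x \<in> carrier S; y \<in> carrier S; x \<otimes>\<^bsub>S\<^esub> y \<noteq> \<zero>\<^sub>0\<^bsub>S\<^esub>\<rbrakk>
      \<Longrightarrow> g [x, y] \<otimes>\<^bsub>A\<^esub> h (x \<otimes>\<^bsub>S\<^esub> y) = f [x, y] \<otimes>\<^bsub>A\<^esub> (act x (h y) \<otimes>\<^bsub>A\<^esub> h x)"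
proof -
  define k where "k = (\<lambda>xs\<in>nonzero_tuples S 1. h (hd xs))"
  have kc: "k \<in> carrier (cochains S A 1)"
    using h by (auto simp: k_def cochains_def nonzero_tuples_1_iff[simplified])
  have k: "k [x] = h x" if "x \<in> carrier S" "x \<noteq> \<zero>\<^sub>0\<^bsub>S\<^esub>" for x
    using that by (simp add: k_def nonzero_tuples_1_iff[simplified])
  define b where "b = coboundary S A act 1 k"
  define g where "g = f \<otimes>\<^bsub>cochains S A 2\<^esub> b"
  have b: "b \<in> coboundaries S A act 2" using kc by (simp add: b_def coboundaries_def)
  have g: "g \<in> cocycles S A act 2"
    using subgroup.m_closed[OF subgroup_cocycles_2 f] b coboundaries_2_subset_cocycles_2
    unfolding g_def by blast
  have "g [x, y] \<otimes>\<^bsub>A\<^esub> h (x \<otimes>\<^bsub>S\<^esub> y) = f [x, y] \<otimes>\<^bsub>A\<^esub> (act x (h y) \<otimes>\<^bsub>A\<^esub> h x)"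
    if x: "x \<in> carrier S" "y \<in> carrier S" "x \<otimes>\<^bsub>S\<^esub> y \<noteq> \<zero>\<^sub>0\<^bsub>S\<^esub>" for x y
  proof -
    note n = mult_nonzeroD[OF x]
    have e: "b [x, y] = act x (h y) \<otimes>\<^bsub>A\<^esub> inv\<^bsub>A\<^esub> (h (x \<otimes>\<^bsub>S\<^esub> y)) \<otimes>\<^bsub>A\<^esub> h x"
      unfolding b_def coboundary_1[OF kc x] using k x n sg_closed by simp
    have "g [x, y] = f [x, y] \<otimes>\<^bsub>A\<^esub> b [x, y]"
      using x by (simp add: g_def cochains_def nonzero_tuples_2_iff)
    moreover have "h (x \<otimes>\<^bsub>S\<^esub> y) \<in> carrier A" "h x \<in> carrier A" "act x (h y) \<in> carrier A" "f [x, y] \<in> carrier A"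
      using h x n sg_closed act_closed cocycle_2_closed[OF f x] by auto
    moreover from this have "f [x, y] \<otimes>\<^bsub>A\<^esub> (act x (h y) \<otimes>\<^bsub>A\<^esub> inv\<^bsub>A\<^esub> (h (x \<otimes>\<^bsub>S\<^esub> y)) \<otimes>\<^bsub>A\<^esub> h x) \<otimes>\<^bsub>A\<^esub> h (x \<otimes>\<^bsub>S\<^esub> y)
        = f [x, y] \<otimes>\<^bsub>A\<^esub> (act x (h y) \<otimes>\<^bsub>A\<^esub> h x) \<otimes>\<^bsub>A\<^esub> (inv\<^bsub>A\<^esub> (h (x \<otimes>\<^bsub>S\<^esub> y)) \<otimes>\<^bsub>A\<^esub> h (x \<otimes>\<^bsub>S\<^esub> y))"
      by (simp only: A.m_ac A.m_closed A.inv_closed)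
    ultimately show ?thesis unfolding e by simp
  qed
  then show ?thesis using that[OF g] b unfolding cohomologous_def g_def by blast
qed

end

section \<open>Inflation from the quotient by the units\<close>

text \<open>Collects what the comparison rests on: the units are central and act freely on the
  nonzero elements, the fibres of \<pi> are their orbits, B is the group of invariants of A, and H^1
  and H^2 of the units vanish. A and B share an element type, so inflating a cochain is mere
  composition with \<pi>.\<close>

locale unit_inflation = SA: zero_module S A act + TB: zero_module T B qact
  for S :: "('s, 'k) monoid_zero_scheme" and A :: "('a, 'l) monoid_scheme" (structure)
    and act :: "'s \<Rightarrow> 'a \<Rightarrow> 'a"
    and T :: "('t, 'm) monoid_zero_scheme" and B :: "('a, 'n) monoid_scheme"
    and qact :: "'t \<Rightarrow> 'a \<Rightarrow> 'a" +
  fixes \<pi> :: "'s \<Rightarrow> 't"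
  assumes monoid_S: "monoid S"
    and one_nonzero: "\<one>\<^bsub>S\<^esub> \<noteq> \<zero>\<^sub>0\<^bsub>S\<^esub>"
    and unit_comm: "\<lbrakk>x \<in> carrier S; u \<in> Units S\<rbrakk> \<Longrightarrow> x \<otimes>\<^bsub>S\<^esub> u = u \<otimes>\<^bsub>S\<^esub> x"
    and unit_free: "\<lbrakk>x \<in> carrier S - {\<zero>\<^sub>0\<^bsub>S\<^esub>}; u \<in> Units S; u \<otimes>\<^bsub>S\<^esub> x = x\<rbrakk> \<Longrightarrow> u = \<one>\<^bsub>S\<^esub>"
    and proj_surj: "\<pi> ` carrier S = carrier T"
    and proj_mult: "\<lbrakk>x \<in> carrier S; y \<in> carrier S\<rbrakk> \<Longrightarrow> \<pi> (x \<otimes>\<^bsub>S\<^esub> y) = \<pi> x \<otimes>\<^bsub>T\<^esub> \<pi> y"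
    and proj_zero_iff: "x \<in> carrier S \<Longrightarrow> \<pi> x = \<zero>\<^sub>0\<^bsub>T\<^esub> \<longleftrightarrow> x = \<zero>\<^sub>0\<^bsub>S\<^esub>"
    and proj_eq_iff: "\<lbrakk>x \<in> carrier S; y \<in> carrier S\<rbrakk> \<Longrightarrow> \<pi> x = \<pi> y \<longleftrightarrow> (\<exists>u \<in> Units S. y = u \<otimes>\<^bsub>S\<^esub> x)"
    and carrier_B: "carrier B = {a \<in> carrier A. \<forall>u \<in> Units S. act u a = a}"
    and mult_B: "a \<otimes>\<^bsub>B\<^esub> b = a \<otimes> b"
    and qact_proj: "\<lbrakk>x \<in> carrier S - {\<zero>\<^sub>0\<^bsub>S\<^esub>}; b \<in> carrier B\<rbrakk> \<Longrightarrow> qact (\<pi> x) b = act x b"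
    and act_id: "a \<in> carrier A \<Longrightarrow> act \<one>\<^bsub>S\<^esub> a = a"
    and H1_units: "\<lbrakk>\<And>u. u \<in> Units S \<Longrightarrow> c u \<in> carrier A;
        \<And>u v. \<lbrakk>u \<in> Units S; v \<in> Units S\<rbrakk> \<Longrightarrow> c (u \<otimes>\<^bsub>S\<^esub> v) = c u \<otimes> act u (c v)\<rbrakk>
      \<Longrightarrow> \<exists>a \<in> carrier A. \<forall>u \<in> Units S. c u \<otimes> a = act u a"
    and H2_units: "\<lbrakk>\<And>u v. \<lbrakk>u \<in> Units S; v \<in> Units S\<rbrakk> \<Longrightarrow> f u v \<in> carrier A;
        \<And>u v w. \<lbrakk>u \<in> Units S; v \<in> Units S; w \<in> Units S\<rbrakk>
          \<Longrightarrow> act u (f v w) \<otimes> f u (v \<otimes>\<^bsub>S\<^esub> w) = f (u \<otimes>\<^bsub>S\<^esub> v) w \<otimes> f u v\<rbrakk>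
      \<Longrightarrow> \<exists>h \<in> Units S \<rightarrow> carrier A. \<forall>u \<in> Units S. \<forall>v \<in> Units S.
        f u v \<otimes> h (u \<otimes>\<^bsub>S\<^esub> v) = act u (h v) \<otimes> h u"
begin

abbreviation mult_S :: "'s \<Rightarrow> 's \<Rightarrow> 's" (infixl \<open>\<bullet>\<close> 70) where "x \<bullet> y \<equiv> x \<otimes>\<^bsub>S\<^esub> y"

abbreviation nonzero :: "'s set" where "nonzero \<equiv> carrier S - {\<zero>\<^sub>0\<^bsub>S\<^esub>}"

sublocale M: monoid S by (rule monoid_S)

declare M.Units_closed [simp]

lemma unit_mult_zero_iff:
  assumes "x \<in> carrier S" "u \<in> Units S"
  shows "u \<bullet> x = \<zero>\<^sub>0\<^bsub>S\<^esub> \<longleftrightarrow> x = \<zero>\<^sub>0\<^bsub>S\<^esub>"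
proof
  assume "u \<bullet> x = \<zero>\<^sub>0\<^bsub>S\<^esub>"
  then have "inv\<^bsub>S\<^esub> u \<bullet> (u \<bullet> x) = \<zero>\<^sub>0\<^bsub>S\<^esub>" using assms SA.szero_right by auto
  then show "x = \<zero>\<^sub>0\<^bsub>S\<^esub>" using assms by (simp flip: M.m_assoc)
qed (use assms SA.szero_right in auto)

lemma unit_nonzero: "u \<in> Units S \<Longrightarrow> u \<in> nonzero"
  using unit_mult_zero_iff[of "\<one>\<^bsub>S\<^esub>" u] one_nonzero by auto

lemma unit_mult_nonzero: "\<lbrakk>u \<in> Units S; x \<in> nonzero\<rbrakk> \<Longrightarrow> u \<bullet> x \<in> nonzero"
  using unit_mult_zero_iff[of x u] by auto

lemma unit_mult_mult:
  assumes "u \<in> Units S" "x \<in> carrier S" "y \<in> carrier S"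
  shows "(u \<bullet> x) \<bullet> y = u \<bullet> (x \<bullet> y)" "x \<bullet> (u \<bullet> y) = u \<bullet> (x \<bullet> y)" "(x \<bullet> u) \<bullet> y = u \<bullet> (x \<bullet> y)"
proof -
  show 1: "(u \<bullet> x) \<bullet> y = u \<bullet> (x \<bullet> y)" using assms by (simp add: M.m_assoc)
  show "x \<bullet> (u \<bullet> y) = u \<bullet> (x \<bullet> y)" "(x \<bullet> u) \<bullet> y = u \<bullet> (x \<bullet> y)"
    unfolding 1[symmetric] unit_comm[OF assms(2,1), symmetric] using assms by (simp_all add: M.m_assoc)
qed

lemma act_unit_unit:
  "\<lbrakk>u \<in> Units S; x \<in> nonzero; a \<in> carrier A\<rbrakk> \<Longrightarrow> act u (act x a) = act (u \<bullet> x) a"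
  using SA.act_act[of u x a] unit_nonzero[of u] unit_mult_nonzero[of u x] by auto

text \<open>Every nonzero element is uniquely a unit times a representative of its class.\<close>

definition rep :: "'t \<Rightarrow> 's" where "rep t = (SOME y. y \<in> carrier S \<and> \<pi> y = t)"

definition unit_part :: "'s \<Rightarrow> 's" where
  "unit_part x = (SOME u. u \<in> Units S \<and> x = u \<bullet> rep (\<pi> x))"

lemma rep: 
  assumes "t \<in> carrier T" 
  shows "rep t \<in> carrier S" "\<pi> (rep t) = t"
proof -
  have "\<exists>y. y \<in> carrier S \<and> \<pi> y = t" using assms proj_surj by (metis imageE)
  from someI_ex[OF this] show "rep t \<in> carrier S" "\<pi> (rep t) = t" by (simp_all add: rep_def)
qed

lemma proj_in: "x \<in> carrier S \<Longrightarrow> \<pi> x \<in> carrier T"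
  using proj_surj by auto

lemma rep_proj_nonzero: "x \<in> nonzero \<Longrightarrow> rep (\<pi> x) \<in> nonzero"
  using rep[OF proj_in] proj_zero_iff by (metis Diff_iff singletonD singletonI)

lemma proj_unit_mult: "\<lbrakk>u \<in> Units S; x \<in> carrier S\<rbrakk> \<Longrightarrow> \<pi> (u \<bullet> x) = \<pi> x"
  using proj_eq_iff[of x "u \<bullet> x"] by (metis M.Units_closed M.m_closed)

lemma unit_part:
  assumes "x \<in> carrier S"
  shows "unit_part x \<in> Units S" "unit_part x \<bullet> rep (\<pi> x) = x"
proof -
  have "\<exists>u. u \<in> Units S \<and> x = u \<bullet> rep (\<pi> x)"
    using proj_eq_iff[of "rep (\<pi> x)" x] rep[OF proj_in[OF assms]] assms by auto
  from someI_ex[OF this] show "unit_part x \<in> Units S" "unit_part x \<bullet> rep (\<pi> x) = x"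
    by (simp_all add: unit_part_def)
qed

lemma unit_cancel:
  assumes "u \<in> Units S" "v \<in> Units S" "x \<in> nonzero" "u \<bullet> x = v \<bullet> x"
  shows "u = v"
proof -
  have c: "u \<in> carrier S" "v \<in> carrier S" "x \<in> carrier S" using assms by auto
  have "(inv\<^bsub>S\<^esub> v \<bullet> u) \<bullet> x = inv\<^bsub>S\<^esub> v \<bullet> (v \<bullet> x)" using assms c by (simp add: M.m_assoc)
  also have "\<dots> = x" using assms c by (simp flip: M.m_assoc)
  finally have "inv\<^bsub>S\<^esub> v \<bullet> u = \<one>\<^bsub>S\<^esub>" using assms by (intro unit_free) auto
  then have "v \<bullet> (inv\<^bsub>S\<^esub> v \<bullet> u) = v" using c by simp
  then show "u = v" using assms c by (simp flip: M.m_assoc)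
qed

text \<open>Both x and u x have the same representative, and freeness makes the unit in front of it
  unique. This equivariance lets functions given on representatives be extended along
  orbits.\<close>

lemma unit_part_mult:
  assumes "u \<in> Units S" "x \<in> nonzero"
  shows "unit_part (u \<bullet> x) = u \<bullet> unit_part x"
proof (rule unit_cancel)
  have x: "x \<in> carrier S" using assms by simp
  show "unit_part (u \<bullet> x) \<bullet> rep (\<pi> x) = u \<bullet> unit_part x \<bullet> rep (\<pi> x)"
    using unit_part[of "u \<bullet> x"] unit_part[OF x] assms rep_proj_nonzero[OF assms(2)] 
    by (simp add: proj_unit_mult M.m_assoc)
qed (use assms unit_part[of "u \<bullet> x"] unit_part[of x] rep_proj_nonzero in auto)

end

section \<open>Surjectivity: normalising a cocycle on the units\<close>

context unit_inflation
begin

lemma units_of_mult_nonzero: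
  "\<lbrakk>u \<in> Units S; v \<in> Units S\<rbrakk> \<Longrightarrow> u \<bullet> v \<noteq> \<zero>\<^sub>0\<^bsub>S\<^esub>"
  using unit_nonzero[OF M.Units_m_closed] by blast

lemma trivialize_units:
  assumes f: "f \<in> cocycles S A act 2"
  obtains g where "g \<in> cocycles S A act 2" "SA.cohomologous f g"
    "\<And>u v. \<lbrakk>u \<in> Units S; v \<in> Units S\<rbrakk> \<Longrightarrow> g [u, v] = \<one>"
proof -
  have fc: "f [u, v] \<in> carrier A" if "u \<in> Units S" "v \<in> Units S" for u v
    using SA.cocycle_2_closed[OF f] units_of_mult_nonzero that by simp
  obtain h where h: "h \<in> Units S \<rightarrow> carrier A"
    "\<And>u v. \<lbrakk>u \<in> Units S; v \<in> Units S\<rbrakk> \<Longrightarrow> f [u, v] \<otimes> h (u \<bullet> v) = act u (h v) \<otimes> h u"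
  proof -
    have "\<exists>h \<in> Units S \<rightarrow> carrier A. \<forall>u \<in> Units S. \<forall>v \<in> Units S.
        f [u, v] \<otimes> h (u \<bullet> v) = act u (h v) \<otimes> h u"
    proof (rule H2_units)
      fix u v w assume u: "u \<in> Units S" "v \<in> Units S" "w \<in> Units S"
      show "act u (f [v, w]) \<otimes> f [u, v \<bullet> w] = f [u \<bullet> v, w] \<otimes> f [u, v]"
        using u SA.cocycle_2D[OF f] units_of_mult_nonzero[OF M.Units_m_closed] by simp
    qed (rule fc)
    then show ?thesis using that by blast
  qed
  \<comment> \<open>The inverse appears because the twist multiplies by \<partial>k, while h
    satisfies f = \<partial>h on U. The value 1 outside U does not affect pairs of units, whose
    product is again a unit.\<close>
  define k where "k x = (if x \<in> Units S then inv (h x) else \<one>)" for x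
  have "k x \<in> carrier A" if "x \<in> nonzero" for x using h(1) by (auto simp: k_def)
  then obtain g where g: "g \<in> cocycles S A act 2" "SA.cohomologous f g"
    "\<And>x y. \<lbrakk>x \<in> carrier S; y \<in> carrier S; x \<bullet> y \<noteq> \<zero>\<^sub>0\<^bsub>S\<^esub>\<rbrakk>
      \<Longrightarrow> g [x, y] \<otimes> k (x \<bullet> y) = f [x, y] \<otimes> (act x (k y) \<otimes> k x)"
    using SA.cohomologous_twist[OF f, of k] by metis
  have "g [u, v] = \<one>" if u: "u \<in> Units S" "v \<in> Units S" for u v
  proof -
    have c: "h u \<in> carrier A" "h v \<in> carrier A" "h (u \<bullet> v) \<in> carrier A" "act u (h v) \<in> carrier A"
      "f [u, v] \<in> carrier A" "g [u, v] \<in> carrier A"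
      using h(1) u SA.act_closed[OF unit_nonzero] fc SA.cocycle_2_closed[OF g(1)] units_of_mult_nonzero
      by auto
    have "g [u, v] \<otimes> inv (h (u \<bullet> v)) = f [u, v] \<otimes> inv (act u (h v) \<otimes> h u)"
      using g(3)[of u v] u c units_of_mult_nonzero
      by (simp add: k_def SA.act_inv[OF unit_nonzero] SA.A.inv_mult)
    also have "\<dots> = f [u, v] \<otimes> inv (f [u, v] \<otimes> h (u \<bullet> v))" by (simp add: h(2)[OF u])
    also have "\<dots> = inv (h (u \<bullet> v))" using c by (simp add: SA.A.inv_mult SA.A.m_assoc[symmetric])
    finally show ?thesis using c by simp
  qed
  then show ?thesis using that g(1,2) by blast
qed

lemma unit_inv_cancel: "\<lbrakk>u \<in> Units S; x \<in> carrier S\<rbrakk> \<Longrightarrow> inv\<^bsub>S\<^esub> u \<bullet> (u \<bullet> x) = x"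
  by (simp flip: M.m_assoc)

text \<open>Ensures that the correcting functions of the next two normalisations equal 1 on units,
  although the representative of the class of units need not be 1.\<close>

lemma rep_proj_unit:
  assumes u: "u \<in> Units S"
  shows "rep (\<pi> u) \<in> Units S"
proof -
  have "inv\<^bsub>S\<^esub> (unit_part u) \<bullet> u = rep (\<pi> u)"
    using unit_inv_cancel[of "unit_part u" "rep (\<pi> u)"] unit_part[of u] rep[OF proj_in[of u]] u by simp
  then show ?thesis using M.Units_m_closed[of "inv\<^bsub>S\<^esub> (unit_part u)" u] unit_part[of u] u by simp
qed

text \<open>With f trivial on U x U, the values f(u, x) form a 1-cocycle of U with values in
  functions on the free U-set of nonzero elements. Such a cocycle is trivialised by reading it off
  from representatives: h(v r) = f(v, r).\<close>

lemma trivialize_left: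
  assumes f: "f \<in> cocycles S A act 2"
    and U: "\<And>u v. \<lbrakk>u \<in> Units S; v \<in> Units S\<rbrakk> \<Longrightarrow> f [u, v] = \<one>"
  obtains g where "g \<in> cocycles S A act 2" "SA.cohomologous f g"
    "\<And>u x. \<lbrakk>u \<in> Units S; x \<in> nonzero\<rbrakk> \<Longrightarrow> g [u, x] = \<one>"
proof -
  define h where "h x = f [unit_part x, rep (\<pi> x)]" for x
  have fc: "f [u, x] \<in> carrier A" if "u \<in> Units S" "x \<in> nonzero" for u x
    using SA.cocycle_2_closed[OF f] unit_mult_nonzero[of u x] that by auto
  have hc: "h x \<in> carrier A" if "x \<in> nonzero" for x
    using fc unit_part rep_proj_nonzero that by (simp add: h_def)
  then obtain g where g: "g \<in> cocycles S A act 2" "SA.cohomologous f g"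
    "\<And>x y. \<lbrakk>x \<in> carrier S; y \<in> carrier S; x \<bullet> y \<noteq> \<zero>\<^sub>0\<^bsub>S\<^esub>\<rbrakk>
      \<Longrightarrow> g [x, y] \<otimes> h (x \<bullet> y) = f [x, y] \<otimes> (act x (h y) \<otimes> h x)"
    using SA.cohomologous_twist[OF f, of h] by metis
  have "g [u, x] = \<one>" if u: "u \<in> Units S" "x \<in> nonzero" for u x
  proof -
    let ?v = "unit_part x" and ?r = "rep (\<pi> x)"
    have x: "x \<in> carrier S" using u by simp
    note v = unit_part[OF x]
    have r: "?r \<in> nonzero" using rep_proj_nonzero u by blast
    have ux: "u \<bullet> x \<in> nonzero" using unit_mult_nonzero u by blast
    have c: "f [u, x] \<in> carrier A" "h x \<in> carrier A" "h (u \<bullet> x) \<in> carrier A" "act u (h x) \<in> carrier A"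
      "g [u, x] \<in> carrier A"
      using fc[OF u] hc[OF u(2)] hc[OF ux] SA.act_closed[OF unit_nonzero[OF u(1)]]
        SA.cocycle_2_closed[OF g(1)] u ux by auto
    \<comment> \<open>The cocycle identity at (u, v, r) for x = v r; the last factor is 1 since u
      and v are units.\<close>
    have "act u (f [?v, ?r]) \<otimes> f [u, ?v \<bullet> ?r] = f [u \<bullet> ?v, ?r] \<otimes> f [u, ?v]"
      using r u v ux by (intro SA.cocycle_2D[OF f]) (auto simp: M.m_assoc)
    then have 1: "act u (h x) \<otimes> f [u, x] = h (u \<bullet> x)"
      using v u U hc[OF ux] by (simp add: h_def unit_part_mult proj_unit_mult)
    have "h u = \<one>" using U unit_part(1)[of u] rep_proj_unit u by (simp add: h_def)
    then have "g [u, x] \<otimes> h (u \<bullet> x) = h (u \<bullet> x)"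
      using g(3)[of u x] u ux 1 c by (simp add: SA.A.m_comm)
    then show ?thesis using c by simp
  qed
  then show ?thesis using that g(1,2) by blast
qed


text \<open>The cocycle identity at (u, x, y), where both values with first argument u are
  1.\<close>

lemma cocycle_left_unit:
  assumes f: "f \<in> cocycles S A act 2"
    and U: "\<And>u x. \<lbrakk>u \<in> Units S; x \<in> nonzero\<rbrakk> \<Longrightarrow> f [u, x] = \<one>"
    and x: "x \<in> carrier S" "y \<in> carrier S" "x \<bullet> y \<noteq> \<zero>\<^sub>0\<^bsub>S\<^esub>" and u: "u \<in> Units S"
  shows "f [u \<bullet> x, y] = act u (f [x, y])"
proof -
  have n: "x \<in> nonzero" "x \<bullet> y \<in> nonzero" "u \<bullet> x \<bullet> y \<noteq> \<zero>\<^sub>0\<^bsub>S\<^esub>"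
    using SA.mult_nonzeroD[OF x] x u unit_mult_zero_iff[of "x \<bullet> y" u] by (auto simp: M.m_assoc)
  have c: "act u (f [x, y]) \<in> carrier A" "f [u \<bullet> x, y] \<in> carrier A"
    using SA.act_closed[OF unit_nonzero[OF u]] SA.cocycle_2_closed[OF f] x u n by auto
  have "act u (f [x, y]) \<otimes> f [u, x \<bullet> y] = f [u \<bullet> x, y] \<otimes> f [u, x]"
    using n x u by (intro SA.cocycle_2D[OF f]) auto
  then show ?thesis using U[OF u n(1)] U[OF u n(2)] c by simp
qed

text \<open>The cocycle identity at (x, u, y), with x u = u x and equivariance in the first
  argument. For y a unit it says that u \<mapsto> f(x, u) is a crossed homomorphism of U.\<close>

lemma cocycle_right_unit:
  assumes f: "f \<in> cocycles S A act 2"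
    and U: "\<And>u x. \<lbrakk>u \<in> Units S; x \<in> nonzero\<rbrakk> \<Longrightarrow> f [u, x] = \<one>"
    and x: "x \<in> carrier S" "y \<in> carrier S" "x \<bullet> y \<noteq> \<zero>\<^sub>0\<^bsub>S\<^esub>" and u: "u \<in> Units S"
  shows "f [x, u \<bullet> y] = act u (f [x, y]) \<otimes> f [x, u]"
proof -
  have n: "x \<in> nonzero" "y \<in> nonzero" "x \<bullet> u \<bullet> y \<noteq> \<zero>\<^sub>0\<^bsub>S\<^esub>" "x \<bullet> u \<noteq> \<zero>\<^sub>0\<^bsub>S\<^esub>" "x \<bullet> (u \<bullet> y) \<noteq> \<zero>\<^sub>0\<^bsub>S\<^esub>"
    using SA.mult_nonzeroD[OF x] x u unit_mult_zero_iff[of "x \<bullet> y" u] unit_mult_zero_iff[of x u]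
    by (auto simp: unit_mult_mult unit_comm)
  have c: "f [x, u \<bullet> y] \<in> carrier A"
    using SA.cocycle_2_closed[OF f] x u n by auto
  have "act x (f [u, y]) \<otimes> f [x, u \<bullet> y] = f [x \<bullet> u, y] \<otimes> f [x, u]"
    using n x u by (intro SA.cocycle_2D[OF f]) auto
  then show ?thesis
    using U[OF u n(2)] n(1) c unit_comm[OF x(1) u] cocycle_left_unit[OF f U x u] by simp
qed

text \<open>For each x the crossed homomorphism u \<mapsto> f(x, u) is split by some element, as H^1
  = 0. Twisting by these elements keeps the values at (u, x) trivial only if they depend
  U-equivariantly on x and are 1 on units, which determines the construction of
  \<open>c\<close>.\<close>

lemma trivialize_right:
  assumes f: "f \<in> cocycles S A act 2"
    and U: "\<And>u x. \<lbrakk>u \<in> Units S; x \<in> nonzero\<rbrakk> \<Longrightarrow> f [u, x] = \<one>"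
  obtains g where "g \<in> cocycles S A act 2" "SA.cohomologous f g"
    "\<And>u x. \<lbrakk>u \<in> Units S; x \<in> nonzero\<rbrakk> \<Longrightarrow> g [u, x] = \<one>"
    "\<And>u x. \<lbrakk>u \<in> Units S; x \<in> nonzero\<rbrakk> \<Longrightarrow> g [x, u] = \<one>"
proof -
  have xu: "x \<bullet> u \<noteq> \<zero>\<^sub>0\<^bsub>S\<^esub>" if "u \<in> Units S" "x \<in> nonzero" for u x
    using unit_mult_nonzero[OF that] unit_comm[of x u] that by auto
  have fc: "f [x, u] \<in> carrier A" if "u \<in> Units S" "x \<in> nonzero" for u x
    using SA.cocycle_2_closed[OF f] xu[OF that] that by auto
  \<comment> \<open>On a unit x the choice a = 1 is possible because f(x, u) = 1 there
    already.\<close>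
  have "\<exists>a \<in> carrier A. (\<forall>u \<in> Units S. f [x, u] \<otimes> a = act u a) \<and> (x \<in> Units S \<longrightarrow> a = \<one>)"
    if x: "x \<in> nonzero" for x
  proof (cases "x \<in> Units S")
    case True
    then show ?thesis using U unit_nonzero by (intro bexI[of _ \<one>]) auto
  next
    case False
    have "\<exists>a \<in> carrier A. \<forall>u \<in> Units S. f [x, u] \<otimes> a = act u a"
    proof (rule H1_units)
      fix u v assume uv: "u \<in> Units S" "v \<in> Units S"
      then show "f [x, u \<bullet> v] = f [x, u] \<otimes> act u (f [x, v])"
        using cocycle_right_unit[OF f U, of x v u] x xu fc SA.act_closed[OF unit_nonzero]
        by (simp add: SA.A.m_comm)
    qed (use fc x in auto)
    then show ?thesis using False by blast
  qed
  then obtain k where k: "\<And>x. x \<in> nonzero \<Longrightarrow> k x \<in> carrier A"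
    "\<And>x u. \<lbrakk>x \<in> nonzero; u \<in> Units S\<rbrakk> \<Longrightarrow> f [x, u] \<otimes> k x = act u (k x)"
    "\<And>x. x \<in> Units S \<Longrightarrow> k x = \<one>"
    using bchoice[of nonzero "\<lambda>x a. a \<in> carrier A \<and> (\<forall>u \<in> Units S. f [x, u] \<otimes> a = act u a)
      \<and> (x \<in> Units S \<longrightarrow> a = \<one>)"] unit_nonzero by metis
  \<comment> \<open>Only the splitting elements at representatives are kept; along an orbit they are
    transported by U, which makes c equivariant.\<close>
  define c where "c x = act (unit_part x) (k (rep (\<pi> x)))" for x
  have cc: "c x \<in> carrier A" if "x \<in> nonzero" for x
    using k(1)[OF rep_proj_nonzero[OF that]] SA.act_closed[OF unit_nonzero[OF unit_part(1)]] that
    by (simp add: c_def)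
  have cu: "c u = \<one>" if "u \<in> Units S" for u
    using k(3)[OF rep_proj_unit[OF that]] unit_nonzero[OF unit_part(1)] that by (simp add: c_def)
  have c_unit: "c (u \<bullet> x) = act u (c x)" if "u \<in> Units S" "x \<in> nonzero" for u x
    using that k(1)[OF rep_proj_nonzero] unit_nonzero[OF unit_part(1)[of x]]
    by (simp add: c_def proj_unit_mult unit_part_mult act_unit_unit)
  \<comment> \<open>The transported element still splits: f(v r, u) = v(f(r, u)) by equivariance in
    the first argument, and the actions of u and v commute.\<close>
  have fcx: "f [x, u] \<otimes> c x = act u (c x)" if u: "u \<in> Units S" and x: "x \<in> nonzero" for u x
  proof -
    let ?v = "unit_part x" and ?r = "rep (\<pi> x)"
    have v: "?v \<in> Units S" "?v \<bullet> ?r = x" using unit_part x by auto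
    have r: "?r \<in> nonzero" using rep_proj_nonzero[OF x] .
    have a: "k ?r \<in> carrier A" "f [?r, u] \<in> carrier A" using k(1)[OF r] fc[OF u r] .
    have "f [x, u] = act ?v (f [?r, u])"
      using cocycle_left_unit[OF f U, of ?r u ?v] v r u xu[OF u r] by simp
    then have "f [x, u] \<otimes> c x = act ?v (f [?r, u] \<otimes> k ?r)"
      unfolding c_def using SA.act_mult[OF unit_nonzero[OF v(1)] a(2,1)] by simp
    also have "\<dots> = act ?v (act u (k ?r))" using k(2)[OF r u] by simp
    also have "\<dots> = act u (act ?v (k ?r))"
      using act_unit_unit[OF v(1) unit_nonzero[OF u] a(1)] act_unit_unit[OF u unit_nonzero[OF v(1)] a(1)]
        unit_comm[of u ?v] u v by simp
    finally show ?thesis by (simp add: c_def)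
  qed
  obtain g where g: "g \<in> cocycles S A act 2" "SA.cohomologous f g"
    "\<And>x y. \<lbrakk>x \<in> carrier S; y \<in> carrier S; x \<bullet> y \<noteq> \<zero>\<^sub>0\<^bsub>S\<^esub>\<rbrakk>
      \<Longrightarrow> g [x, y] \<otimes> c (x \<bullet> y) = f [x, y] \<otimes> (act x (c y) \<otimes> c x)"
    using SA.cohomologous_twist[OF f, of c] cc by metis
  have "g [u, x] = \<one> \<and> g [x, u] = \<one>" if u: "u \<in> Units S" and x: "x \<in> nonzero" for u x
  proof -
    have ux: "u \<bullet> x \<in> nonzero" using unit_mult_nonzero[OF u x] .
    have cl: "c x \<in> carrier A" "c (u \<bullet> x) \<in> carrier A" "g [u, x] \<in> carrier A" "g [x, u] \<in> carrier A" "f [x, u] \<in> carrier A"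
      using cc[OF x] cc[OF ux] SA.cocycle_2_closed[OF g(1)] ux xu[OF u x] x u fc[OF u x] by auto
    have "g [u, x] \<otimes> c (u \<bullet> x) = c (u \<bullet> x)"
      using g(3)[of u x] u x ux cl by (simp add: U cu flip: c_unit)
    moreover have "g [x, u] \<otimes> c (u \<bullet> x) = c (u \<bullet> x)"
      using g(3)[of x u] u x xu[OF u x] cl by (simp add: cu fcx c_unit unit_comm)
    ultimately show ?thesis using cl by simp
  qed
  then show ?thesis using that g(1,2) by blast
qed

definition inflate :: "('t list \<Rightarrow> 'a) \<Rightarrow> 's list \<Rightarrow> 'a" where
  "inflate F = (\<lambda>xs \<in> nonzero_tuples S 2. F (map \<pi> xs))"

lemma act_B: "\<lbrakk>b \<in> carrier B; u \<in> Units S\<rbrakk> \<Longrightarrow> act u b = b"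
  by (simp add: carrier_B)

lemma descend:
  assumes f: "f \<in> cocycles S A act 2"
    and L: "\<And>u x. \<lbrakk>u \<in> Units S; x \<in> nonzero\<rbrakk> \<Longrightarrow> f [u, x] = \<one>"
    and R: "\<And>u x. \<lbrakk>u \<in> Units S; x \<in> nonzero\<rbrakk> \<Longrightarrow> f [x, u] = \<one>"
  shows "\<exists>F \<in> cocycles T B qact 2. inflate F = f"
proof -
  have n: "x \<in> nonzero" "y \<in> nonzero" "x \<bullet> y \<in> nonzero"
    if "x \<in> carrier S" "y \<in> carrier S" "x \<bullet> y \<noteq> \<zero>\<^sub>0\<^bsub>S\<^esub>" for x y
    using that SA.mult_nonzeroD[OF that] by auto
  have fc: "f [x, y] \<in> carrier A"
    if "x \<in> carrier S" "y \<in> carrier S" "x \<bullet> y \<noteq> \<zero>\<^sub>0\<^bsub>S\<^esub>" for x y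
    using SA.cocycle_2_closed[OF f that] .
  have inv2: "f [x, u \<bullet> y] = f [x, y]" and fix_u: "act u (f [x, y]) = f [x, y]"
    if x: "x \<in> carrier S" "y \<in> carrier S" "x \<bullet> y \<noteq> \<zero>\<^sub>0\<^bsub>S\<^esub>" and u: "u \<in> Units S" for x y u
  proof -
    have nz: "x \<bullet> y \<bullet> u \<noteq> \<zero>\<^sub>0\<^bsub>S\<^esub>" "x \<bullet> (u \<bullet> y) \<noteq> \<zero>\<^sub>0\<^bsub>S\<^esub>"
      using unit_mult_zero_iff[of "x \<bullet> y" u] x u by (auto simp: unit_mult_mult unit_comm)
    \<comment> \<open>The cocycle identity at (x, y, u), where both values with last argument u are
      1: f is constant along orbits in its second argument.\<close>
    have "act x (f [y, u]) \<otimes> f [x, y \<bullet> u] = f [x \<bullet> y, u] \<otimes> f [x, y]"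
      using x u nz by (intro SA.cocycle_2D[OF f]) auto
    then show e: "f [x, u \<bullet> y] = f [x, y]"
      using R[OF u n(2)[OF x]] R[OF u n(3)[OF x]] fc x u nz n[OF x] unit_comm[OF x(2) u] by simp
    \<comment> \<open>The change of the second argument by u was also computed as the action of u on
      the value. Comparing the two shows that the values of f are U-invariant, and so lie in
      B.\<close>
    show "act u (f [x, y]) = f [x, y]"
      using cocycle_right_unit[OF f L x u] R[OF u n(1)[OF x]] e fc[OF x] SA.act_closed[OF unit_nonzero[OF u]]
      by simp
  qed
  have inv1: "f [u \<bullet> x, y] = f [x, y]"
    if x: "x \<in> carrier S" "y \<in> carrier S" "x \<bullet> y \<noteq> \<zero>\<^sub>0\<^bsub>S\<^esub>" and u: "u \<in> Units S" for x y u
    using cocycle_left_unit[OF f L x u] fix_u[OF x u] by simp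
  have fB: "f [x, y] \<in> carrier B" if "x \<in> carrier S" "y \<in> carrier S" "x \<bullet> y \<noteq> \<zero>\<^sub>0\<^bsub>S\<^esub>" for x y
    using fc fix_u that by (simp add: carrier_B)
  \<comment> \<open>Evaluation on representatives, which by the invariance in both arguments agrees
    with evaluation on any members of the classes.\<close>
  define F where "F = (\<lambda>ts \<in> nonzero_tuples T 2. f (map rep ts))"
  have proj_nz: "\<pi> x \<otimes>\<^bsub>T\<^esub> \<pi> y \<noteq> \<zero>\<^sub>0\<^bsub>T\<^esub> \<longleftrightarrow> x \<bullet> y \<noteq> \<zero>\<^sub>0\<^bsub>S\<^esub>" if "x \<in> carrier S" "y \<in> carrier S" for x y
    using proj_zero_iff[of "x \<bullet> y"] that by (simp add: proj_mult)
  have F: "F [\<pi> x, \<pi> y] = f [x, y]" if x: "x \<in> carrier S" "y \<in> carrier S" "x \<bullet> y \<noteq> \<zero>\<^sub>0\<^bsub>S\<^esub>" for x y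
  proof -
    let ?r = "rep (\<pi> x)" and ?s = "rep (\<pi> y)"
    have r: "?r \<in> carrier S" "?s \<in> carrier S" "unit_part x \<bullet> ?r = x" "unit_part y \<bullet> ?s = y"
      "unit_part x \<in> Units S" "unit_part y \<in> Units S"
      using x rep proj_in unit_part by auto
    have "x \<bullet> ?s \<noteq> \<zero>\<^sub>0\<^bsub>S\<^esub>" using proj_nz[of x ?s] proj_nz[of x y] rep(2)[OF proj_in] x r by simp
    moreover have "?r \<bullet> ?s \<noteq> \<zero>\<^sub>0\<^bsub>S\<^esub>" using proj_nz[of ?r ?s] proj_nz[of x y] rep(2)[OF proj_in] x r by simp
    ultimately have "f [x, y] = f [?r, ?s]"
      using inv2[of x ?s "unit_part y"] inv1[of ?r ?s "unit_part x"] r x by simp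
    then show ?thesis using x proj_nz[OF x(1,2)] proj_in by (simp add: F_def nonzero_tuples_2_iff)
  qed
  have lift: "\<exists>x \<in> carrier S. t = \<pi> x" if "t \<in> carrier T" for t using that proj_surj by blast
  have Fc: "F \<in> carrier (cochains T B 2)"
  proof -
    have "F ts \<in> carrier B" if "ts \<in> nonzero_tuples T 2" for ts
    proof -
      obtain s t where st: "ts = [s, t]" "s \<in> carrier T" "t \<in> carrier T" "s \<otimes>\<^bsub>T\<^esub> t \<noteq> \<zero>\<^sub>0\<^bsub>T\<^esub>"
        using \<open>ts \<in> _\<close> by (auto simp: nonzero_tuples_2_iff)
      obtain x y where xy: "x \<in> carrier S" "y \<in> carrier S" "s = \<pi> x" "t = \<pi> y" using lift st by metis
      have "x \<bullet> y \<noteq> \<zero>\<^sub>0\<^bsub>S\<^esub>" using proj_nz[OF xy(1,2)] st xy by simp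
      then show ?thesis using F[OF xy(1,2)] fB[OF xy(1,2)] st(1) xy by simp
    qed
    moreover have "F \<in> extensional (nonzero_tuples T 2)" by (simp add: F_def)
    ultimately show ?thesis by (auto simp: cochains_def PiE_def)
  qed
  have "F \<in> cocycles T B qact 2"
    unfolding TB.cocycles_2_iff
  proof (intro conjI Fc ballI impI)
    fix s t w assume st: "s \<in> carrier T" "t \<in> carrier T" "w \<in> carrier T" "s \<otimes>\<^bsub>T\<^esub> t \<otimes>\<^bsub>T\<^esub> w \<noteq> \<zero>\<^sub>0\<^bsub>T\<^esub>"
    obtain x y z where x: "x \<in> carrier S" "y \<in> carrier S" "z \<in> carrier S" "s = \<pi> x" "t = \<pi> y" "w = \<pi> z"
      using lift st by metis
    have nz: "x \<bullet> y \<bullet> z \<noteq> \<zero>\<^sub>0\<^bsub>S\<^esub>" using st proj_zero_iff[of "x \<bullet> y \<bullet> z"] x by (simp add: proj_mult)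
    note m = SA.nonzero_triple[OF x(1-3) nz]
    show "qact s (F [t, w]) \<otimes>\<^bsub>B\<^esub> F [s, t \<otimes>\<^bsub>T\<^esub> w] = F [s \<otimes>\<^bsub>T\<^esub> t, w] \<otimes>\<^bsub>B\<^esub> F [s, t]"
      using SA.cocycle_2D[OF f x(1-3) nz] x nz m fB
      by (simp add: F mult_B qact_proj flip: proj_mult)
  qed
  moreover have "inflate F = f"
  proof (rule extensionalityI[of _ "nonzero_tuples S 2"])
    show "f \<in> extensional (nonzero_tuples S 2)"
      using f by (auto simp: SA.cocycles_2_iff cochains_def PiE_def)
    fix xs assume "xs \<in> nonzero_tuples S 2"
    then show "inflate F xs = f xs" by (auto simp: inflate_def nonzero_tuples_2_iff F)
  qed (simp add: inflate_def)
  ultimately show ?thesis by blast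
qed

lemma inflate_surj:
  assumes f: "f \<in> cocycles S A act 2"
  shows "\<exists>F \<in> cocycles T B qact 2. SA.cohomologous f (inflate F)"
proof -
  obtain g where g: "g \<in> cocycles S A act 2" "SA.cohomologous f g"
    "\<And>u v. \<lbrakk>u \<in> Units S; v \<in> Units S\<rbrakk> \<Longrightarrow> g [u, v] = \<one>"
    using trivialize_units[OF f] by metis
  obtain h where h: "h \<in> cocycles S A act 2" "SA.cohomologous g h"
    "\<And>u x. \<lbrakk>u \<in> Units S; x \<in> nonzero\<rbrakk> \<Longrightarrow> h [u, x] = \<one>"
    using trivialize_left[OF g(1,3)] by metis
  obtain k where k: "k \<in> cocycles S A act 2" "SA.cohomologous h k"
    "\<And>u x. \<lbrakk>u \<in> Units S; x \<in> nonzero\<rbrakk> \<Longrightarrow> k [u, x] = \<one>"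
    "\<And>u x. \<lbrakk>u \<in> Units S; x \<in> nonzero\<rbrakk> \<Longrightarrow> k [x, u] = \<one>"
    using trivialize_right[OF h(1,3)] by metis
  have "SA.cohomologous f k"
    using SA.cohomologous_trans f g h k by metis
  then show ?thesis using descend[OF k(1,3,4)] by metis
qed

end

section \<open>Inflation as a homomorphism, and its injectivity on cohomology\<close>

context unit_inflation
begin

lemma nonzero_proj:
  "\<lbrakk>x \<in> carrier S; y \<in> carrier S\<rbrakk> \<Longrightarrow> \<pi> x \<otimes>\<^bsub>T\<^esub> \<pi> y = \<zero>\<^sub>0\<^bsub>T\<^esub> \<longleftrightarrow> x \<bullet> y = \<zero>\<^sub>0\<^bsub>S\<^esub>"
  using proj_zero_iff[of "x \<bullet> y"] by (simp add: proj_mult)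

lemma inflate_apply:
  "\<lbrakk>x \<in> carrier S; y \<in> carrier S; x \<bullet> y \<noteq> \<zero>\<^sub>0\<^bsub>S\<^esub>\<rbrakk> \<Longrightarrow> inflate F [x, y] = F [\<pi> x, \<pi> y]"
  by (simp add: inflate_def nonzero_tuples_2_iff)

lemma B_subset_A: "b \<in> carrier B \<Longrightarrow> b \<in> carrier A"
  by (simp add: carrier_B)

lemma cocycle_2_proj_closed:
  assumes "F \<in> cocycles T B qact 2" "x \<in> carrier S" "y \<in> carrier S" "x \<bullet> y \<noteq> \<zero>\<^sub>0\<^bsub>S\<^esub>"
  shows "F [\<pi> x, \<pi> y] \<in> carrier B"
  using assms proj_in by (intro TB.cocycle_2_closed) (auto simp: nonzero_proj)

lemma inflate_cochain:
  assumes "F \<in> carrier (cochains T B 2)"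
  shows "inflate F \<in> carrier (cochains S A 2)"
proof -
  have "F (map \<pi> xs) \<in> carrier A" if xs: "xs \<in> nonzero_tuples S 2" for xs
  proof -
    have "map \<pi> xs \<in> nonzero_tuples T 2"
      using xs by (auto simp: nonzero_tuples_2_iff nonzero_proj proj_in)
    then show ?thesis using TB.cochains_app_closed[OF assms] B_subset_A by blast
  qed
  then show ?thesis by (simp add: cochains_def inflate_def)
qed

lemma inflate_cocycle:
  assumes F: "F \<in> cocycles T B qact 2"
  shows "inflate F \<in> cocycles S A act 2"
  unfolding SA.cocycles_2_iff
proof (intro conjI ballI impI)
  show "inflate F \<in> carrier (cochains S A 2)"
    using F by (intro inflate_cochain) (simp add: TB.cocycles_2_iff)
  fix x y z assume x: "x \<in> carrier S" "y \<in> carrier S" "z \<in> carrier S" "x \<bullet> y \<bullet> z \<noteq> \<zero>\<^sub>0\<^bsub>S\<^esub>"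
  note m = SA.nonzero_triple[OF x]
  have "qact (\<pi> x) (F [\<pi> y, \<pi> z]) \<otimes>\<^bsub>B\<^esub> F [\<pi> x, \<pi> y \<otimes>\<^bsub>T\<^esub> \<pi> z]
      = F [\<pi> x \<otimes>\<^bsub>T\<^esub> \<pi> y, \<pi> z] \<otimes>\<^bsub>B\<^esub> F [\<pi> x, \<pi> y]"
    using x m by (intro TB.cocycle_2D[OF F]) (auto simp: proj_in proj_zero_iff simp flip: proj_mult)
  then show "act x (inflate F [y, z]) \<otimes> inflate F [x, y \<bullet> z] = inflate F [x \<bullet> y, z] \<otimes> inflate F [x, y]"
    using x m cocycle_2_proj_closed[OF F] by (simp add: inflate_apply mult_B qact_proj flip: proj_mult)
qed

lemma inflate_hom:
  "inflate \<in> hom (cochains T B 2\<lparr>carrier := cocycles T B qact 2\<rparr>)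
    (cochains S A 2\<lparr>carrier := cocycles S A act 2\<rparr>)"
proof (rule homI)
  fix F E assume "F \<in> carrier (cochains T B 2\<lparr>carrier := cocycles T B qact 2\<rparr>)"
    "E \<in> carrier (cochains T B 2\<lparr>carrier := cocycles T B qact 2\<rparr>)"
  have "map \<pi> xs \<in> nonzero_tuples T 2" if "xs \<in> nonzero_tuples S 2" for xs
    using that by (auto simp: nonzero_tuples_2_iff nonzero_proj proj_in)
  then show "inflate (F \<otimes>\<^bsub>cochains T B 2\<lparr>carrier := cocycles T B qact 2\<rparr>\<^esub> E)
      = inflate F \<otimes>\<^bsub>cochains S A 2\<lparr>carrier := cocycles S A act 2\<rparr>\<^esub> inflate E"
    by (auto simp: inflate_def cochains_def mult_B intro!: restrict_ext)
qed (simp add: inflate_cocycle)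

lemma inflate_coboundary:
  assumes F: "F \<in> coboundaries T B qact 2"
  shows "inflate F \<in> coboundaries S A act 2"
proof -
  have Z: "F \<in> cocycles T B qact 2" using F TB.coboundaries_2_subset_cocycles_2 by blast
  then have Fc: "F \<in> carrier (cochains T B 2)" by (simp add: TB.cocycles_2_iff)
  obtain h where h: "\<And>t. t \<in> carrier T - {\<zero>\<^sub>0\<^bsub>T\<^esub>} \<Longrightarrow> h t \<in> carrier B"
    "\<And>s t. \<lbrakk>s \<in> carrier T; t \<in> carrier T; s \<otimes>\<^bsub>T\<^esub> t \<noteq> \<zero>\<^sub>0\<^bsub>T\<^esub>\<rbrakk> \<Longrightarrow>
      F [s, t] \<otimes>\<^bsub>B\<^esub> h (s \<otimes>\<^bsub>T\<^esub> t) = qact s (h t) \<otimes>\<^bsub>B\<^esub> h s"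
    using F unfolding TB.coboundaries_2_iff[OF Fc] by auto
  have hB: "h (\<pi> x) \<in> carrier B" if "x \<in> nonzero" for x
    using h(1)[of "\<pi> x"] that proj_in proj_zero_iff by auto
  show ?thesis
    unfolding SA.coboundaries_2_iff[OF inflate_cochain[OF Fc]]
  proof (intro exI[of _ "\<lambda>x. h (\<pi> x)"] conjI ballI impI)
    fix x y assume x: "x \<in> carrier S" "y \<in> carrier S" "x \<bullet> y \<noteq> \<zero>\<^sub>0\<^bsub>S\<^esub>"
    then show "inflate F [x, y] \<otimes> h (\<pi> (x \<bullet> y)) = act x (h (\<pi> y)) \<otimes> h (\<pi> x)"
      using h(2)[of "\<pi> x" "\<pi> y"] SA.mult_nonzeroD[OF x] hB
      by (simp add: inflate_apply proj_in nonzero_proj proj_mult mult_B qact_proj)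
  qed (rule B_subset_A[OF hB])
qed

text \<open>If inflate F = \<partial>h, then h may be changed by a function with trivial coboundary.
  H^1 = 0 provides such a change after which h is constant on U; comparing the equations at (u, x)
  and (x, u) then shows that h is constant on orbits with U-invariant values, so it
  descends.\<close>

lemma inflate_inj:
  assumes F: "F \<in> cocycles T B qact 2" and triv: "inflate F \<in> coboundaries S A act 2"
  shows "F \<in> coboundaries T B qact 2"
proof -
  have Fc: "F \<in> carrier (cochains T B 2)" using F by (simp add: TB.cocycles_2_iff)
  obtain h where hA: "\<And>x. x \<in> nonzero \<Longrightarrow> h x \<in> carrier A"
    and h: "\<And>x y. \<lbrakk>x \<in> carrier S; y \<in> carrier S; x \<bullet> y \<noteq> \<zero>\<^sub>0\<^bsub>S\<^esub>\<rbrakk> \<Longrightarrow>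
      F [\<pi> x, \<pi> y] \<otimes> h (x \<bullet> y) = act x (h y) \<otimes> h x"
    using triv unfolding SA.coboundaries_2_iff[OF inflate_cochain[OF Fc]] by (auto simp: inflate_apply)
  have prod_nz: "x \<bullet> y \<in> nonzero" "x \<in> nonzero" "y \<in> nonzero"
    if "x \<in> carrier S" "y \<in> carrier S" "x \<bullet> y \<noteq> \<zero>\<^sub>0\<^bsub>S\<^esub>" for x y
    using that SA.mult_nonzeroD[OF that] by auto
  \<comment> \<open>F need not be normalised. The cocycle identity at (1, 1, x) and (x, 1, 1)
    expresses its values with one argument 1 through this constant, and these are its values with
    one argument in U.\<close>
  define c where "c = F [\<pi> \<one>\<^bsub>S\<^esub>, \<pi> \<one>\<^bsub>S\<^esub>]"
  have one: "\<one>\<^bsub>S\<^esub> \<in> nonzero" using one_nonzero by simp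
  have cB: "c \<in> carrier B" unfolding c_def using cocycle_2_proj_closed[OF F] one by simp
  have cA: "c \<in> carrier A" using B_subset_A[OF cB] .
  have actc: "act x c \<in> carrier A" if "x \<in> nonzero" for x using SA.act_closed[OF that cA] .
  note FZ = inflate_cocycle[OF F]
  have Fl: "F [\<pi> \<one>\<^bsub>S\<^esub>, \<pi> x] = c" and Fr: "F [\<pi> x, \<pi> \<one>\<^bsub>S\<^esub>] = act x c" if x: "x \<in> nonzero" for x
  proof -
    have cl: "F [\<pi> \<one>\<^bsub>S\<^esub>, \<pi> x] \<in> carrier A" "F [\<pi> x, \<pi> \<one>\<^bsub>S\<^esub>] \<in> carrier A"
      using B_subset_A cocycle_2_proj_closed[OF F] x by auto
    show "F [\<pi> \<one>\<^bsub>S\<^esub>, \<pi> x] = c"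
      using SA.cocycle_2D[OF FZ, of "\<one>\<^bsub>S\<^esub>" "\<one>\<^bsub>S\<^esub>" x] x one cl cA
      by (simp add: inflate_apply act_id flip: c_def)
    show "F [\<pi> x, \<pi> \<one>\<^bsub>S\<^esub>] = act x c"
      using SA.cocycle_2D[OF FZ, of x "\<one>\<^bsub>S\<^esub>" "\<one>\<^bsub>S\<^esub>"] x one cl cA actc[OF x]
      by (simp add: inflate_apply flip: c_def)
  qed
  have pu: "\<pi> u = \<pi> \<one>\<^bsub>S\<^esub>" if "u \<in> Units S" for u
    using proj_unit_mult[OF that, of "\<one>\<^bsub>S\<^esub>"] that by simp
  \<comment> \<open>On U the cochain F is constantly c, so c h(u v) = u(h v) h(u). As c is
    U-invariant, h/c is a crossed homomorphism of U, and a splits it.\<close>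
  obtain a where a: "a \<in> carrier A" "\<And>u. u \<in> Units S \<Longrightarrow> h u \<otimes> inv c \<otimes> a = act u a"
  proof -
    have "\<exists>a \<in> carrier A. \<forall>u \<in> Units S. h u \<otimes> inv c \<otimes> a = act u a"
    proof (rule H1_units)
      fix u v assume u: "u \<in> Units S" "v \<in> Units S"
      note n = unit_nonzero[OF u(1)] unit_nonzero[OF u(2)] unit_nonzero[OF M.Units_m_closed[OF u]]
      have cl: "h u \<in> carrier A" "h v \<in> carrier A" "h (u \<bullet> v) \<in> carrier A" "act u (h v) \<in> carrier A"
        using hA n SA.act_closed by auto
      have "c \<otimes> h (u \<bullet> v) = act u (h v) \<otimes> h u"
        using h[of u v] u n by (simp add: pu[OF u(1)] pu[OF u(2)] flip: c_def)
      then have "h (u \<bullet> v) = inv c \<otimes> (act u (h v) \<otimes> h u)"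
        using cl cA by (simp add: SA.A.m_assoc[symmetric] flip: \<open>c \<otimes> h (u \<bullet> v) = _\<close>)
      then show "h (u \<bullet> v) \<otimes> inv c = h u \<otimes> inv c \<otimes> act u (h v \<otimes> inv c)"
        using cl cA n act_B[OF cB u(1)]
        by (simp add: SA.act_mult SA.act_inv SA.A.m_ac)
    qed (use hA unit_nonzero cA in auto)
    then show ?thesis using that by blast
  qed
  have axa: "act x a \<in> carrier A" if "x \<in> nonzero" for x using SA.act_closed[OF that a(1)] .
  \<comment> \<open>The factor a/x(a) is the inverse of a principal crossed homomorphism: its
    coboundary is trivial because x(y(a)) = (x y)(a) for x y nonzero, and on U it turns h into the
    constant c.\<close>
  define k where "k x = h x \<otimes> (a \<otimes> inv (act x a))" for x
  have kA: "k x \<in> carrier A" if "x \<in> nonzero" for x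
    unfolding k_def using hA a(1) axa that by simp
  have k: "F [\<pi> x, \<pi> y] \<otimes> k (x \<bullet> y) = act x (k y) \<otimes> k x"
    if x: "x \<in> carrier S" "y \<in> carrier S" "x \<bullet> y \<noteq> \<zero>\<^sub>0\<^bsub>S\<^esub>" for x y
  proof -
    note n = prod_nz[OF x]
    have cl: "F [\<pi> x, \<pi> y] \<in> carrier A" "h (x \<bullet> y) \<in> carrier A" "h x \<in> carrier A" "h y \<in> carrier A"
      "act x (h y) \<in> carrier A" "act x a \<in> carrier A" "act (x \<bullet> y) a \<in> carrier A" "act y a \<in> carrier A"
      using B_subset_A[OF cocycle_2_proj_closed[OF F x]] hA axa n SA.act_closed by auto
    have "F [\<pi> x, \<pi> y] \<otimes> k (x \<bullet> y) = (F [\<pi> x, \<pi> y] \<otimes> h (x \<bullet> y)) \<otimes> (a \<otimes> inv (act (x \<bullet> y) a))"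
      unfolding k_def using cl a(1) by (simp add: SA.A.m_assoc)
    also have "\<dots> = (act x (h y) \<otimes> h x) \<otimes> (a \<otimes> inv (act (x \<bullet> y) a)) \<otimes> (act x a \<otimes> inv (act x a))"
      using cl a(1) by (simp add: h[OF x])
    also have "\<dots> = act x (h y) \<otimes> (act x a \<otimes> inv (act (x \<bullet> y) a)) \<otimes> (h x \<otimes> (a \<otimes> inv (act x a)))"
      using cl a(1) by (simp only: SA.A.m_ac SA.A.m_closed SA.A.inv_closed)
    also have "\<dots> = act x (k y) \<otimes> k x"
      unfolding k_def using cl a(1) n SA.act_act[OF n(2,3) x(3) a(1)] 
      by (simp add: SA.act_mult SA.act_inv)
    finally show ?thesis .
  qed
  have ku: "k u = c" if u: "u \<in> Units S" for u
  proof -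
    have cl: "h u \<in> carrier A" "act u a \<in> carrier A" using hA axa unit_nonzero[OF u] by auto
    have "k u \<otimes> (inv c \<otimes> c) = (h u \<otimes> inv c \<otimes> a) \<otimes> inv (act u a) \<otimes> c"
      unfolding k_def using cl a(1) cA by (simp only: SA.A.m_ac SA.A.m_closed SA.A.inv_closed)
    then show ?thesis using a(2)[OF u] kA[OF unit_nonzero[OF u]] cl cA by simp
  qed
  have k_unit: "k (u \<bullet> x) = k x" and k_fix: "act u (k x) = k x" if u: "u \<in> Units S" and x: "x \<in> nonzero" for u x
  proof -
    note ux = unit_mult_nonzero[OF u x]
    have xu: "x \<bullet> u = u \<bullet> x" using unit_comm x u by simp
    have cl: "k x \<in> carrier A" "k (u \<bullet> x) \<in> carrier A" "act u (k x) \<in> carrier A"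
      using kA x ux SA.act_closed[OF unit_nonzero[OF u]] by auto
    \<comment> \<open>The pair (u, x) shows that k(u x) = u(k x), the pair (x, u) that k(x u) = k x;
      centrality of u identifies the two left sides.\<close>
    have "c \<otimes> k (u \<bullet> x) = act u (k x) \<otimes> c"
      using k[of u x] u x ux by (simp add: pu[OF u] ku Fl)
    then have 1: "k (u \<bullet> x) = act u (k x)" using cl cA by (simp add: SA.A.m_comm)
    have "act x c \<otimes> k (u \<bullet> x) = act x c \<otimes> k x"
      using k[of x u] u x ux xu by (simp add: pu[OF u] ku Fr)
    then show 2: "k (u \<bullet> x) = k x" using cl actc[OF x] by simp
    show "act u (k x) = k x" using 1 2 by simp
  qed
  have kB: "k x \<in> carrier B" if "x \<in> nonzero" for x
    using kA k_fix that by (simp add: carrier_B)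
  have k_rep: "k (rep (\<pi> x)) = k x" if x: "x \<in> nonzero" for x
    using k_unit[OF unit_part(1) rep_proj_nonzero[OF x], of x] unit_part(2)[of x] x by simp
  have lift: "\<exists>x \<in> carrier S. t = \<pi> x" if "t \<in> carrier T" for t using that proj_surj by blast
  show ?thesis
    unfolding TB.coboundaries_2_iff[OF Fc]
  proof (intro exI[of _ "\<lambda>t. k (rep t)"] conjI ballI impI)
    fix t assume t: "t \<in> carrier T - {\<zero>\<^sub>0\<^bsub>T\<^esub>}"
    then obtain x where x: "x \<in> carrier S" "t = \<pi> x" using lift by blast
    then have "x \<in> nonzero" using t proj_zero_iff[of x] by auto
    then show "k (rep t) \<in> carrier B" using kB k_rep x(2) by simp
  next
    fix s t assume st: "s \<in> carrier T" "t \<in> carrier T" "s \<otimes>\<^bsub>T\<^esub> t \<noteq> \<zero>\<^sub>0\<^bsub>T\<^esub>"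
    obtain x y where x: "x \<in> carrier S" "y \<in> carrier S" "s = \<pi> x" "t = \<pi> y" using lift st by metis
    have nz: "x \<bullet> y \<noteq> \<zero>\<^sub>0\<^bsub>S\<^esub>" using st x nonzero_proj by simp
    note n = prod_nz[OF x(1,2) nz]
    show "F [s, t] \<otimes>\<^bsub>B\<^esub> k (rep (s \<otimes>\<^bsub>T\<^esub> t)) = qact s (k (rep t)) \<otimes>\<^bsub>B\<^esub> k (rep s)"
      using k[OF x(1,2) nz] k_rep n kB x(1,2)
      by (simp add: x(3,4) mult_B qact_proj flip: proj_mult)
  qed
qed

lemma inflation_iso: "zero_cohomology 2 S A act \<cong> zero_cohomology 2 T B qact"
proof -
  interpret ZS: comm_group "cochains S A 2\<lparr>carrier := cocycles S A act 2\<rparr>"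
    by (rule SA.comm_group_cocycles_2)
  interpret ZT: comm_group "cochains T B 2\<lparr>carrier := cocycles T B qact 2\<rparr>"
    by (rule TB.comm_group_cocycles_2)
  \<comment> \<open>Well-definedness and injectivity on cohomology together identify the kernel of
    the map from cocycles of T to cohomology classes of S.\<close>
  have "{F \<in> carrier (cochains T B 2\<lparr>carrier := cocycles T B qact 2\<rparr>). inflate F \<in> coboundaries S A act 2}
      = coboundaries T B qact 2"
    using inflate_inj inflate_coboundary TB.coboundaries_2_subset_cocycles_2 by auto
  moreover have "cochains S A 2\<lparr>carrier := cocycles S A act 2\<rparr> Mod coboundaries S A act 2
      \<cong> cochains T B 2\<lparr>carrier := cocycles T B qact 2\<rparr>
        Mod {F \<in> carrier (cochains T B 2\<lparr>carrier := cocycles T B qact 2\<rparr>). inflate F \<in> coboundaries S A act 2}"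
  proof (rule ZS.Mod_iso_Mod[OF ZT.is_group SA.subgroup_coboundaries_2 inflate_hom])
    fix f assume "f \<in> carrier (cochains S A 2\<lparr>carrier := cocycles S A act 2\<rparr>)"
    then show "\<exists>F\<in>carrier (cochains T B 2\<lparr>carrier := cocycles T B qact 2\<rparr>). \<exists>b\<in>coboundaries S A act 2.
        f \<otimes>\<^bsub>cochains S A 2\<lparr>carrier := cocycles S A act 2\<rparr>\<^esub> b = inflate F"
      using inflate_surj[of f] by (simp add: SA.cohomologous_def)
  qed
  ultimately show ?thesis unfolding zero_cohomology_def by simp
qed

end

section \<open>The modification of the Galois group as an instance\<close>

lemma finite_field_action_units:
  assumes L: "field L" "finite (carrier L)" and S: "modification (galois_group L K) S"
  shows "finite_field_action L (units_of S) (\<lambda>\<sigma>. \<sigma>)"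
proof -
  interpret L: field L by fact
  interpret modification "galois_group L K" S by fact
  interpret M: monoid S by (rule monoid_S)
  interpret W: group "units_of S" by (rule M.units_group)
  have U: "u \<in> carrier (galois_group L K)" if "u \<in> Units S" for u
    using Units_in_group[OF that] .
  show ?thesis
  proof unfold_locales
    fix w assume "w \<in> carrier (units_of S)"
    then show "w \<in> ring_hom L L" using U galois_groupD(2) by (auto simp: units_of_def)
  next
    fix v w x assume vw: "v \<in> carrier (units_of S)" "w \<in> carrier (units_of S)" and x: "x \<in> carrier L"
    then have u: "v \<in> Units S" "w \<in> Units S" by (simp_all add: units_of_def)
    \<comment> \<open>The product of two units is a unit and so not the zero of S; hence it is the
      product in the Galois group, that is, composition.\<close>
    have "v \<otimes>\<^bsub>S\<^esub> w = v \<otimes>\<^bsub>galois_group L K\<^esub> w"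
      using Units_in_group[OF M.Units_m_closed[OF u]] mult_modification[of v w] Units_in_group u szero_notin
      by metis
    then show "(v \<otimes>\<^bsub>units_of S\<^esub> w) x = v (w x)"
      using galois_mult_apply[OF U U x] u by (simp add: units_of_def)
  next
    fix x assume "x \<in> carrier L"
    then show "\<one>\<^bsub>units_of S\<^esub> x = x"
      by (simp add: units_of_def one_modification galois_group_def BijGroup_def)
  next
    fix v w assume "v \<in> carrier (units_of S)" "w \<in> carrier (units_of S)"
      and e: "\<And>x. x \<in> carrier L \<Longrightarrow> v x = w x"
    then have "v \<in> extensional (carrier L)" "w \<in> extensional (carrier L)"
      using U[THEN galois_groupD(1), THEN Bij_imp_extensional] by (simp_all add: units_of_def)
    then show "v = w" using e by (rule extensionalityI)
  qed (use L in auto)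
qed

theorem corollary3p1:
  fixes L :: "('a, 'm) ring_scheme" and K :: "'a set"
    and S :: "('a \<Rightarrow> 'a, 'n) monoid_zero_scheme"
  assumes "field L"
    and "subfield K L"
    and "ring.finite_dimension L K (carrier L)"
    and "normal_extension L K"
    and "finite (carrier L)"
    and "modification (galois_group L K) S"
  shows "zero_cohomology 2 S (units_of L) (\<lambda>\<sigma>. \<sigma>)
       \<cong> zero_cohomology 2 (quotient_by_units S) (units_of (L\<lparr>carrier := fixed_elements L (Units S)\<rparr>)) class_action"
proof -
  let ?P = "L\<lparr>carrier := fixed_elements L (Units S)\<rparr>"
  interpret L: field L by fact
  interpret modification "galois_group L K" S by fact
  interpret M: monoid S by (rule monoid_S)
  have cG: "comm_group (galois_group L K)"
    using assms(1,5) G.group_axioms by (rule comm_group_galois_group)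
  interpret SA: zero_module S "units_of L" "\<lambda>\<sigma>. \<sigma>" by (rule zero_module_units) fact+
  interpret TB: zero_module "quotient_by_units S" "units_of ?P" class_action
    by (rule zero_module_fixed_units) fact+
  interpret F: finite_field_action L "units_of S" "\<lambda>\<sigma>. \<sigma>"
    by (rule finite_field_action_units) fact+
  obtain t where "finite_cyclic_module (units_of S) (units_of L) (\<lambda>\<sigma>. \<sigma>) t"
    using F.finite_cyclic_module_units by blast
  then interpret C: finite_cyclic_module "units_of S" "units_of L" "\<lambda>\<sigma>. \<sigma>" t .
  have UW: "carrier (units_of S) = Units S" "x \<otimes>\<^bsub>units_of S\<^esub> y = x \<otimes>\<^bsub>S\<^esub> y" for x y
    by (simp_all add: units_of_def)
  have "Units S \<subseteq> ring_hom L L" using Units_in_group galois_groupD(2) by blast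
  then interpret P: field ?P
    using L.subfield_iff(2)[OF subfield_fixed_elements[OF assms(1)]] by blast
  \<comment> \<open>In both fields the units are the nonzero elements, so an invertible element of L
    fixed by U is also invertible in P.\<close>
  have cB: "carrier (units_of ?P) = {a \<in> carrier (units_of L). \<forall>u \<in> Units S. u a = a}"
    using P.field_Units L.field_Units by (auto simp: units_of_def fixed_elements_def)
  have cQ: "carrier (quotient_by_units S) = (\<lambda>x. unit_cong S `` {x}) ` carrier S"
    "\<zero>\<^sub>0\<^bsub>quotient_by_units S\<^esub> = unit_cong S `` {\<zero>\<^sub>0\<^bsub>S\<^esub>}"
    by (auto simp: quotient_by_units_def quotient_semigroup_def quotient_def)
  have eq: "unit_cong S `` {x} = unit_cong S `` {y} \<longleftrightarrow> (x, y) \<in> unit_cong S"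
    if "x \<in> carrier S" "y \<in> carrier S" for x y
    using eq_equiv_class_iff[OF equiv_unit_cong that] .
  \<comment> \<open>Centrality of the units comes from commutativity of the Galois group, and the
    vanishing of H^1 and H^2 from the cyclic module structure on the units of L.\<close>
  interpret unit_inflation S "units_of L" "\<lambda>\<sigma>. \<sigma>" "quotient_by_units S" "units_of ?P" class_action
    "\<lambda>x. unit_cong S `` {x}"
  proof unfold_locales
    show "\<one>\<^bsub>S\<^esub> \<noteq> \<zero>\<^sub>0\<^bsub>S\<^esub>" using one_modification szero_notin G.one_closed by metis
    show "unit_cong S `` {x} = \<zero>\<^sub>0\<^bsub>quotient_by_units S\<^esub> \<longleftrightarrow> x = \<zero>\<^sub>0\<^bsub>S\<^esub>" if "x \<in> carrier S" for x
      using that eq[OF that szero_closed] szero_closed unfolding cQ by (auto simp: unit_cong_def)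
    show "unit_cong S `` {x} = unit_cong S `` {y} \<longleftrightarrow> (\<exists>u \<in> Units S. y = u \<otimes>\<^bsub>S\<^esub> x)"
      if "x \<in> carrier S" "y \<in> carrier S" for x y
      using eq[OF that] that unit_commute[OF cG that(1)] by (auto simp: unit_cong_iff)
    \<comment> \<open>Freeness: u x = x is nonzero, so it is the product in the Galois group, where
      x can be cancelled.\<close>
    show "u = \<one>\<^bsub>S\<^esub>" if x: "x \<in> carrier S - {\<zero>\<^sub>0\<^bsub>S\<^esub>}" and u: "u \<in> Units S" and ux: "u \<otimes>\<^bsub>S\<^esub> x = x" for x u
    proof -
      have xG: "x \<in> carrier (galois_group L K)" using x carrier_modification by auto
      have "u \<otimes>\<^bsub>galois_group L K\<^esub> x = x"
        using mult_modification[OF Units_in_group[OF u] xG] ux x by auto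
      then show ?thesis using Units_in_group[OF u] xG by (simp add: one_modification)
    qed
    show "class_action (unit_cong S `` {x}) b = x b"
      if "x \<in> carrier S - {\<zero>\<^sub>0\<^bsub>S\<^esub>}" "b \<in> carrier (units_of ?P)" for x b
      using that P.field_Units by (intro class_action_class[OF assms(6)]) (auto simp: units_of_def)
    show "\<exists>a \<in> carrier (units_of L). \<forall>u \<in> Units S. c u \<otimes>\<^bsub>units_of L\<^esub> a = u a"
      if "\<And>u. u \<in> Units S \<Longrightarrow> c u \<in> carrier (units_of L)"
        "\<And>u v. \<lbrakk>u \<in> Units S; v \<in> Units S\<rbrakk> \<Longrightarrow> c (u \<otimes>\<^bsub>S\<^esub> v) = c u \<otimes>\<^bsub>units_of L\<^esub> u (c v)" for c
      using C.H1_trivial[of c, unfolded UW] that by blast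
    show "\<exists>h \<in> Units S \<rightarrow> carrier (units_of L). \<forall>u \<in> Units S. \<forall>v \<in> Units S.
        f u v \<otimes>\<^bsub>units_of L\<^esub> h (u \<otimes>\<^bsub>S\<^esub> v) = u (h v) \<otimes>\<^bsub>units_of L\<^esub> h u"
      if "\<And>u v. \<lbrakk>u \<in> Units S; v \<in> Units S\<rbrakk> \<Longrightarrow> f u v \<in> carrier (units_of L)"
        "\<And>u v w. \<lbrakk>u \<in> Units S; v \<in> Units S; w \<in> Units S\<rbrakk>
          \<Longrightarrow> u (f v w) \<otimes>\<^bsub>units_of L\<^esub> f u (v \<otimes>\<^bsub>S\<^esub> w) = f (u \<otimes>\<^bsub>S\<^esub> v) w \<otimes>\<^bsub>units_of L\<^esub> f u v" for f
      using C.H2_trivial[of f, unfolded UW] that by blast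
  next
    fix a assume "a \<in> carrier (units_of L)"
    then show "\<one>\<^bsub>S\<^esub> a = a" using C.act_id[of a] by (simp add: units_of_def)
  qed (use unit_commute[OF cG] quotient_mult[OF cG] cB cQ in \<open>simp_all add: units_of_def\<close>)
  show ?thesis by (rule inflation_iso)
qed

end
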